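(* Let $(X,\infty)$ be a Weierstrass curve and let $f_X^{(i)}$, $R_X^{\otimes[m_X-1]}$, $X_{\mathbb P}^{[m_X-1]}$, $R_X^{[m_X-1]}$, $X^{[m_X-1]}$ be as in the context. Then the identities $f_X^{(i)}(x,y_{r_i})=0$ in $R_X$ provide a surjective and an injective ring homomorphism $$\varphi: R_X^{\otimes[m_X-1]}\to R_X,\qquad \iota: R_{\mathbb P}\hookrightarrow R_X^{\otimes[m_X-1]}$$ such that $\varphi\circ\iota$ is the inclusion $R_{\mathbb P}\subset R_X$; dually, there is an injection $X\to X_{\mathbb P}^{[m_X-1]}$ whose composition with the projection $X_{\mathbb P}^{[m_X-1]}\to\mathbb P$ is the projection $\varpi_r:X\to\mathbb P$. Moreover, they induce, by dividing by the ideal $(x-x_2,x-x_3,\dots,x-x_{m_X})$ (identifying all the variables $x_i$ with $x$), a homomorphism $$R_X^{[m_X-1]}\to R_X$$ and an embedding $$X\hookrightarrow X^{[m_X-1]}\ (\subset\mathbb P^{2(m_X-1)}).$$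
   Context: Weierstrass curve. $(X,\infty)$ is a pointed compact Riemann surface (smooth complex projective curve); $R_X=H^0(X,\mathcal O_X( *\infty))$ is the ring of meromorphic functions on $X$ holomorphic on $X\setminus\{\infty\}$; $H_X=\{n\ge 0: \exists f \text{ meromorphic on } X \text{ with polar divisor } n\infty\}$ is the Weierstrass semigroup and $r$ its smallest positive element. The standard basis $\mathfrak e_0=0<\mathfrak e_1<\dots<\mathfrak e_{r-1}$ consists of the elements $\min\{h\in H_X: h\equiv i \bmod r\}$, $i=0,\dots,r-1$, in increasing order. It is assumed that $H_X$ has a minimal generating set $\{r_1=r,r_2=s,r_3,\dots,r_{m_X}\}$ with $s=\min\{\mathfrak e_i: i\geq 1,\gcd(\mathfrak e_i,r)=1\}$, and $X$ is the normalization of the plane curve given by an irreducible $f_X(x,y)=y^r+A_1(x)y^{r-1}+\dots+A_r(x)$ with $A_i\in\mathbb C[x]$, $\deg A_i\le is/r$, $A_r$ having $x^s$-coefficient $-1$; then $R_X=\mathbb C[x,y_{r_2},\dots,y_{r_{m_X}}]/(f_1^X,\dots,f_{k_X}^X)$, where $x$ and $y_{r_i}$ have their only pole at $\infty$, of order $r$ and $r_i$, $y_{r_2}=y_s=y$. $R_{\mathbb P}=\mathbb C[x]$ and $\varpi_r:X\to\mathbb P$ is the projection given by $x$. Curves are identified with the spectra of their affine rings (away from the point at infinity), $R_X$ being regarded as the coordinate ring of the affine part of $X$. For $i=2,\dots,m_X$, $f_X^{(i)}(x,y_{r_i})\in\mathbb C[x,y_{r_i}]$ is the irreducible polynomial,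 monic in $y_{r_i}$, with $f_X^{(i)}(x,y_{r_i})=0$ in $R_X$; $R_{X^{(i)}}=\mathbb C[x,y_{r_i}]/(f_X^{(i)})$, and $X^{(i)}$ is the associated (generally singular) plane curve with projection $\varpi_{X^{(i)}}:X^{(i)}\to\mathbb P$, $(x,y_{r_i})\mapsto x$. Put $R_X^{\otimes[m_X-1]}=R_{X^{(2)}}\otimes_{R_{\mathbb P}}\cdots\otimes_{R_{\mathbb P}}R_{X^{(m_X)}}=\mathbb C[x,y_{r_2},\dots,y_{r_{m_X}}]/(f_X^{(2)},\dots,f_X^{(m_X)})$, with $X_{\mathbb P}^{[m_X-1]}=X^{(2)}\times_{\mathbb P}\cdots\times_{\mathbb P}X^{(m_X)}$ its geometric counterpart. $X^{[m_X-1]}=\prod_{i=2}^{m_X}X^{(i)}$ is the product curve configuration (with coordinates $(x_i,y_{r_i})_{i=2}^{m_X}$, so lying in a $2(m_X-1)$-dimensional space) and $R_X^{[m_X-1]}=\mathbb C[x_2,y_{r_2},\dots,x_{m_X},y_{r_{m_X}}]/(f_X^{(i)}(x_i,y_{r_i}))_{i=2}^{m_X}$ is its coordinate ring. *)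

theory Defs
  imports
    "HOL-Complex_Analysis.Complex_Analysis"
    "HOL-Computational_Algebra.Computational_Algebra"
    "HOL-Library.Poly_Mapping"
    "HOL-Algebra.QuotRing"
begin

section \<open>Pointed compact Riemann surfaces\<close>

text \<open>An atlas is a set of pairs \<open>(U, z)\<close> of a coordinate neighbourhood and a chart on it; the chart
  is a total function of which only the values on \<open>U\<close> matter.\<close>

definition compact_riemann_surface :: "('a::t2_space set \<times> ('a \<Rightarrow> complex)) set \<Rightarrow> bool" where
  "compact_riemann_surface atl \<longleftrightarrow>
     compact (UNIV :: 'a set) \<and> connected (UNIV :: 'a set) \<and>
     (\<Union>(U, z)\<in>atl. U) = UNIV \<and>
     (\<forall>(U, z)\<in>atl. open U \<and> open (z ` U) \<and> homeomorphism U (z ` U) z (inv_into U z)) \<and>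
     (\<forall>(U, z)\<in>atl. \<forall>(V, w)\<in>atl. (w \<circ> inv_into U z) holomorphic_on (z ` (U \<inter> V)))"

text \<open>\<open>R_X\<close>: functions holomorphic away from the base point and meromorphic at it. They are
  functions on the punctured surface; as total functions they get the dummy value 0 at the base
  point, so that equality of total functions is equality on the punctured surface. (Neither
  \<open>meromorphic_on {c}\<close> nor \<open>is_pole\<close> and \<open>zorder\<close> at \<open>c\<close> depend on the value at \<open>c\<close>.)\<close>

definition meromorphic_fns :: "('a::t2_space set \<times> ('a \<Rightarrow> complex)) set \<Rightarrow> 'a \<Rightarrow> ('a \<Rightarrow> complex) set" where
  "meromorphic_fns atl infty =
     {g. g infty = 0 \<and>
         (\<forall>(U, z)\<in>atl. (g \<circ> inv_into U z) holomorphic_on (z ` (U - {infty}))) \<and>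
         (\<forall>(U, z)\<in>atl. infty \<in> U \<longrightarrow> (g \<circ> inv_into U z) meromorphic_on {z infty})}"

definition curve_ring :: "('a::t2_space set \<times> ('a \<Rightarrow> complex)) set \<Rightarrow> 'a \<Rightarrow> ('a \<Rightarrow> complex) ring" where
  "curve_ring atl infty =
     \<lparr>carrier = meromorphic_fns atl infty,
      monoid.mult = (\<lambda>g h P. g P * h P),
      one = (\<lambda>P. if P = infty then 0 else 1),
      zero = (\<lambda>P. 0),
      add = (\<lambda>g h P. g P + h P)\<rparr>"

text \<open>\<open>g\<close> is meromorphic on the surface with polar divisor \<open>n \<cdot> infty\<close>.\<close>

definition has_polar_divisor ::
    "('a::t2_space set \<times> ('a \<Rightarrow> complex)) set \<Rightarrow> 'a \<Rightarrow> ('a \<Rightarrow> complex) \<Rightarrow> nat \<Rightarrow> bool" where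
  "has_polar_divisor atl infty g n \<longleftrightarrow>
     g \<in> meromorphic_fns atl infty \<and>
     (\<forall>(U, z)\<in>atl. infty \<in> U \<longrightarrow>
        (if n = 0 then \<not> is_pole (g \<circ> inv_into U z) (z infty)
         else is_pole (g \<circ> inv_into U z) (z infty) \<and>
              zorder (g \<circ> inv_into U z) (z infty) = - int n))"

section \<open>Weierstrass semigroups\<close>

definition weierstrass_semigroup ::
    "('a::t2_space set \<times> ('a \<Rightarrow> complex)) set \<Rightarrow> 'a \<Rightarrow> nat set" where
  "weierstrass_semigroup atl infty = {n. \<exists>g. has_polar_divisor atl infty g n}"

text \<open>The standard basis as an increasing list, so that \<open>standard_basis H r ! i\<close> is the element
  with index \<open>i\<close>.\<close>

definition standard_basis :: "nat set \<Rightarrow> nat \<Rightarrow> nat list" where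
  "standard_basis H r = sorted_list_of_set ((\<lambda>i. LEAST h. h \<in> H \<and> h mod r = i) ` {..<r})"

definition semigroup_span :: "nat set \<Rightarrow> nat set" where
  "semigroup_span G = {(\<Sum>g\<in>G. c g * g) | c :: nat \<Rightarrow> nat. True}"

definition minimal_generating_set :: "nat set \<Rightarrow> nat set \<Rightarrow> bool" where
  "minimal_generating_set H G \<longleftrightarrow>
     finite G \<and> semigroup_span G = H \<and> (\<forall>G'. G' \<subset> G \<longrightarrow> semigroup_span G' \<noteq> H)"

section \<open>Plane curves and normalization\<close>

text \<open>An element of \<open>complex poly poly\<close> is a polynomial in \<open>y\<close> with coefficients in \<open>\<complex>[x]\<close>.\<close>

definition poly2 :: "complex poly poly \<Rightarrow> complex \<Rightarrow> complex \<Rightarrow> complex" where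
  "poly2 p a b = poly (map_poly (\<lambda>c. poly c a) p) b"

definition plane_curve :: "complex poly poly \<Rightarrow> (complex \<times> complex) set" where
  "plane_curve p = {(a, b). poly2 p a b = 0}"

definition plane_curve_sing :: "complex poly poly \<Rightarrow> (complex \<times> complex) set" where
  "plane_curve_sing p =
     {(a, b). poly2 p a b = 0 \<and> poly2 (map_poly pderiv p) a b = 0 \<and> poly2 (pderiv p) a b = 0}"

text \<open>The holomorphic map \<open>P \<mapsto> (x P, y P)\<close> from the punctured surface exhibits it as the
  normalization (resolution of singularities) of the affine plane curve \<open>p = 0\<close>: it is onto the
  curve, finite over the singular locus, and injective over the smooth locus.\<close>

definition normalizes_plane_curve ::
    "'a \<Rightarrow> ('a \<Rightarrow> complex) \<Rightarrow> ('a \<Rightarrow> complex) \<Rightarrow> complex poly poly \<Rightarrow> bool" where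
  "normalizes_plane_curve infty x y p \<longleftrightarrow>
     (\<lambda>P. (x P, y P)) ` (- {infty}) = plane_curve p \<and>
     finite {P. P \<noteq> infty \<and> (x P, y P) \<in> plane_curve_sing p} \<and>
     inj_on (\<lambda>P. (x P, y P)) {P. P \<noteq> infty \<and> (x P, y P) \<notin> plane_curve_sing p}"

section \<open>Weierstrass curves\<close>

text \<open>\<open>gen 1 = r, gen 2 = s, gen 3, \<dots>, gen m\<close> are the minimal generators; \<open>x\<close> has pole order
  \<open>r\<close>, and \<open>y i\<close> has pole order \<open>gen i\<close> for \<open>i = 2, \<dots>, m\<close>. The coefficient \<open>A_i\<close> of the
  defining polynomial \<open>fX\<close> is \<open>coeff fX (r - i)\<close>.\<close>

definition weierstrass_curve ::
    "('a::t2_space set \<times> ('a \<Rightarrow> complex)) set \<Rightarrow> 'a \<Rightarrow> nat \<Rightarrow> (nat \<Rightarrow> nat) \<Rightarrow>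
     ('a \<Rightarrow> complex) \<Rightarrow> (nat \<Rightarrow> 'a \<Rightarrow> complex) \<Rightarrow> complex poly poly \<Rightarrow> bool" where
  "weierstrass_curve atl infty m gen x y fX \<longleftrightarrow>
     (let H = weierstrass_semigroup atl infty; r = gen 1; s = gen 2;
          S = {standard_basis H r ! i | i. 1 \<le> i \<and> i < r \<and> coprime (standard_basis H r ! i) r}
      in
        compact_riemann_surface atl \<and>
        2 \<le> m \<and> inj_on gen {1..m} \<and> minimal_generating_set H (gen ` {1..m}) \<and>
        0 < r \<and> r \<in> H \<and> (\<forall>h\<in>H. 0 < h \<longrightarrow> r \<le> h) \<and>
        S \<noteq> {} \<and> s = Min S \<and>
        has_polar_divisor atl infty x r \<and>
        (\<forall>i\<in>{2..m}. has_polar_divisor atl infty (y i) (gen i)) \<and>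
        irreducible fX \<and> degree fX = r \<and> lead_coeff fX = 1 \<and>
        (\<forall>i\<in>{1..r}. r * degree (coeff fX (r - i)) \<le> i * s) \<and>
        coeff (coeff fX 0) s = - 1 \<and>
        normalizes_plane_curve infty x (y 2) fX)"

section \<open>Polynomial rings in several variables\<close>

text \<open>\<open>Vx\<close> is \<open>x\<close>, \<open>Vxi i\<close> is \<open>x_i\<close> and \<open>Vy i\<close> is \<open>y_{r_i}\<close>.\<close>

datatype var = Vx | Vxi nat | Vy nat

type_synonym mpoly = "(var \<Rightarrow>\<^sub>0 nat) \<Rightarrow>\<^sub>0 complex"

definition mvar :: "var \<Rightarrow> mpoly" where
  "mvar v = Poly_Mapping.single (Poly_Mapping.single v 1) 1"

definition mconst :: "complex \<Rightarrow> mpoly" where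
  "mconst c = Poly_Mapping.single 0 c"

definition mpoly_eval :: "(var \<Rightarrow> complex) \<Rightarrow> mpoly \<Rightarrow> complex" where
  "mpoly_eval z p =
     (\<Sum>t\<in>Poly_Mapping.keys p.
        Poly_Mapping.lookup p t * (\<Prod>v\<in>Poly_Mapping.keys t. z v ^ Poly_Mapping.lookup t v))"

definition mpoly_ring :: "var set \<Rightarrow> mpoly ring" where
  "mpoly_ring V =
     \<lparr>carrier = {p. \<forall>t\<in>Poly_Mapping.keys p. Poly_Mapping.keys t \<subseteq> V},
      monoid.mult = (*), one = 1, zero = 0, add = (+)\<rparr>"

text \<open>The polynomial \<open>p(u, v)\<close> as an element of the ring in several variables.\<close>

definition subst2 :: "complex poly poly \<Rightarrow> var \<Rightarrow> var \<Rightarrow> mpoly" where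
  "subst2 p u v =
     poly (map_poly (\<lambda>c. poly (map_poly mconst c) (mvar u)) p) (mvar v)"

section \<open>The affine rings of the statement\<close>

definition base_vars :: "var set" where
  "base_vars = {Vx}"

definition base_ring :: "mpoly ring" where
  "base_ring = mpoly_ring base_vars"

definition tensor_vars :: "nat \<Rightarrow> var set" where
  "tensor_vars m = {Vx} \<union> Vy ` {2..m}"

definition tensor_ideal :: "nat \<Rightarrow> (nat \<Rightarrow> complex poly poly) \<Rightarrow> mpoly set" where
  "tensor_ideal m f =
     genideal (mpoly_ring (tensor_vars m)) ((\<lambda>i. subst2 (f i) Vx (Vy i)) ` {2..m})"

definition tensor_ring :: "nat \<Rightarrow> (nat \<Rightarrow> complex poly poly) \<Rightarrow> mpoly set ring" where
  "tensor_ring m f = mpoly_ring (tensor_vars m) Quot tensor_ideal m f"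

definition tensor_class :: "nat \<Rightarrow> (nat \<Rightarrow> complex poly poly) \<Rightarrow> mpoly \<Rightarrow> mpoly set" where
  "tensor_class m f p = tensor_ideal m f +>\<^bsub>mpoly_ring (tensor_vars m)\<^esub> p"

definition product_vars :: "nat \<Rightarrow> var set" where
  "product_vars m = Vxi ` {2..m} \<union> Vy ` {2..m}"

definition product_ideal :: "nat \<Rightarrow> (nat \<Rightarrow> complex poly poly) \<Rightarrow> mpoly set" where
  "product_ideal m f =
     genideal (mpoly_ring (product_vars m)) ((\<lambda>i. subst2 (f i) (Vxi i) (Vy i)) ` {2..m})"

definition product_ring :: "nat \<Rightarrow> (nat \<Rightarrow> complex poly poly) \<Rightarrow> mpoly set ring" where
  "product_ring m f = mpoly_ring (product_vars m) Quot product_ideal m f"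

definition product_class :: "nat \<Rightarrow> (nat \<Rightarrow> complex poly poly) \<Rightarrow> mpoly \<Rightarrow> mpoly set" where
  "product_class m f p = product_ideal m f +>\<^bsub>mpoly_ring (product_vars m)\<^esub> p"

text \<open>Dividing the product ring by \<open>(x - x_2, \<dots>, x - x_m)\<close>: as \<open>x\<close> is not one of its variables,
  it is adjoined first.\<close>

definition diag_vars :: "nat \<Rightarrow> var set" where
  "diag_vars m = {Vx} \<union> product_vars m"

definition diag_ideal :: "nat \<Rightarrow> (nat \<Rightarrow> complex poly poly) \<Rightarrow> mpoly set" where
  "diag_ideal m f =
     genideal (mpoly_ring (diag_vars m))
       ((\<lambda>i. subst2 (f i) (Vxi i) (Vy i)) ` {2..m} \<union> (\<lambda>i. mvar Vx - mvar (Vxi i)) ` {2..m})"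

definition diag_ring :: "nat \<Rightarrow> (nat \<Rightarrow> complex poly poly) \<Rightarrow> mpoly set ring" where
  "diag_ring m f = mpoly_ring (diag_vars m) Quot diag_ideal m f"

definition diag_class :: "nat \<Rightarrow> (nat \<Rightarrow> complex poly poly) \<Rightarrow> mpoly \<Rightarrow> mpoly set" where
  "diag_class m f p = diag_ideal m f +>\<^bsub>mpoly_ring (diag_vars m)\<^esub> p"

section \<open>Points\<close>

text \<open>Points of affine space with coordinates in \<open>V\<close> are functions vanishing outside \<open>V\<close>.\<close>

definition fibre_product_points :: "nat \<Rightarrow> (nat \<Rightarrow> complex poly poly) \<Rightarrow> (var \<Rightarrow> complex) set" where
  "fibre_product_points m f =
     {z. (\<forall>v. v \<notin> tensor_vars m \<longrightarrow> z v = 0) \<and>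
         (\<forall>i\<in>{2..m}. (z Vx, z (Vy i)) \<in> plane_curve (f i))}"

definition product_points :: "nat \<Rightarrow> (nat \<Rightarrow> complex poly poly) \<Rightarrow> (var \<Rightarrow> complex) set" where
  "product_points m f =
     {z. (\<forall>v. v \<notin> product_vars m \<longrightarrow> z v = 0) \<and>
         (\<forall>i\<in>{2..m}. (z (Vxi i), z (Vy i)) \<in> plane_curve (f i))}"

definition curve_coord :: "('a \<Rightarrow> complex) \<Rightarrow> (nat \<Rightarrow> 'a \<Rightarrow> complex) \<Rightarrow> 'a \<Rightarrow> var \<Rightarrow> complex" where
  "curve_coord x y P v = (case v of Vx \<Rightarrow> x P | Vxi i \<Rightarrow> x P | Vy i \<Rightarrow> y i P)"

definition curve_point ::
    "var set \<Rightarrow> ('a \<Rightarrow> complex) \<Rightarrow> (nat \<Rightarrow> 'a \<Rightarrow> complex) \<Rightarrow> 'a \<Rightarrow> var \<Rightarrow> complex" where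
  "curve_point V x y P = (\<lambda>v. if v \<in> V then curve_coord x y P v else 0)"

text \<open>The element of \<open>R_X\<close> obtained from a polynomial by substituting the function \<open>x\<close> for all the
  variables \<open>x, x_i\<close> and the functions \<open>y i\<close> for the variables \<open>y_{r_i}\<close>.\<close>

definition curve_eval ::
    "'a \<Rightarrow> ('a \<Rightarrow> complex) \<Rightarrow> (nat \<Rightarrow> 'a \<Rightarrow> complex) \<Rightarrow> mpoly \<Rightarrow> 'a \<Rightarrow> complex" where
  "curve_eval infty x y p = (\<lambda>P. if P = infty then 0 else mpoly_eval (curve_coord x y P) p)"

definition projective_point :: "(var option \<Rightarrow> complex) \<Rightarrow> (var option \<Rightarrow> complex) set" where
  "projective_point w = {(\<lambda>k. c * w k) | c. c \<noteq> 0}"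

text \<open>Projective space with homogeneous coordinates indexed by \<open>None\<close> and the elements of \<open>V\<close>;
  the affine space over \<open>V\<close> is the chart where the coordinate \<open>None\<close> is 1.\<close>

definition projective_space :: "var set \<Rightarrow> (var option \<Rightarrow> complex) set set" where
  "projective_space V =
     projective_point ` {w. (\<exists>k. w k \<noteq> 0) \<and> (\<forall>v. v \<notin> V \<longrightarrow> w (Some v) = 0)}"

definition affine_chart :: "(var \<Rightarrow> complex) \<Rightarrow> (var option \<Rightarrow> complex) set" where
  "affine_chart z = projective_point (case_option 1 z)"

section \<open>Spectra\<close>

definition Spec :: "('b, 'c) ring_scheme \<Rightarrow> 'b set set" where
  "Spec R = {q. primeideal q R}"

definition zariski :: "('b, 'c) ring_scheme \<Rightarrow> 'b set topology" where
  "zariski R = topology (\<lambda>W. \<exists>E\<subseteq>carrier R. W = {q \<in> Spec R. \<not> E \<subseteq> q})"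

definition Spec_map :: "('b, 'c) ring_scheme \<Rightarrow> ('b \<Rightarrow> 'd) \<Rightarrow> 'd set \<Rightarrow> 'b set" where
  "Spec_map R h q = {a \<in> carrier R. h a \<in> q}"

text \<open>Closed embedding of affine schemes \<open>Spec S \<rightarrow> Spec R\<close> given by \<open>h : R \<rightarrow> S\<close>: a homeomorphism
  onto a closed subset, with surjective comorphism.\<close>

definition closed_embedding_of_spectra ::
    "('b, 'c) ring_scheme \<Rightarrow> ('d, 'e) ring_scheme \<Rightarrow> ('b \<Rightarrow> 'd) \<Rightarrow> bool" where
  "closed_embedding_of_spectra R S h \<longleftrightarrow>
     h \<in> ring_hom R S \<and> h ` carrier R = carrier S \<and>
     embedding_map (zariski S) (zariski R) (Spec_map R h) \<and>
     closed_map (zariski S) (zariski R) (Spec_map R h)"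

text \<open>The points of a curve as (closed) points of the spectrum of its affine ring.\<close>

definition curve_point_ideal ::
    "('a::t2_space set \<times> ('a \<Rightarrow> complex)) set \<Rightarrow> 'a \<Rightarrow> 'a \<Rightarrow> ('a \<Rightarrow> complex) set" where
  "curve_point_ideal atl infty P = {g \<in> carrier (curve_ring atl infty). g P = 0}"

definition tensor_point_ideal ::
    "nat \<Rightarrow> (nat \<Rightarrow> complex poly poly) \<Rightarrow> (var \<Rightarrow> complex) \<Rightarrow> mpoly set set" where
  "tensor_point_ideal m f z =
     tensor_class m f ` {p \<in> carrier (mpoly_ring (tensor_vars m)). mpoly_eval z p = 0}"

definition product_point_ideal ::
    "nat \<Rightarrow> (nat \<Rightarrow> complex poly poly) \<Rightarrow> (var \<Rightarrow> complex) \<Rightarrow> mpoly set set" where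
  "product_point_ideal m f z =
     product_class m f ` {p \<in> carrier (mpoly_ring (product_vars m)). mpoly_eval z p = 0}"

end

theory Submission
  imports Defs
begin

text \<open>
  Write \<open>R_X\<close> for the ring of the curve. All the homomorphisms are evaluations of polynomials at the functions
  \<open>x\<close> and \<open>y i\<close>; they are well defined on the quotients because these functions satisfy the relations \<open>f i\<close>.
  What carries content is that \<open>x\<close> and the \<open>y i\<close> generate \<open>R_X\<close>, that \<open>R_X\<close> separates the points of the
  punctured surface, and that \<open>x\<close> takes every complex value.

  Generation (\<open>curve_eval_surjective\<close>). The pole order of a nonconstant element of \<open>R_X\<close> belongs to the
  Weierstrass semigroup, so it is the pole order of a monomial in \<open>x\<close> and the \<open>y i\<close>; subtracting a multiple
  of the monomial lowers the pole order. The induction ends with functions without poles, which are constant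
  by the maximum modulus principle (\<open>no_pole_constant\<close>).

  Separation of points (\<open>separates_points\<close>). The normalization is injective over the smooth points of the
  plane curve only, so points over singularities need an argument. The fibre of \<open>x\<close> over \<open>a\<close> has at most \<open>r\<close>
  points counted with multiplicities (\<open>fibre_orders_le\<close>), as a nearby fibre lies over smooth points and
  injects into the roots of a polynomial of degree \<open>r\<close>. On the other hand the \<open>r\<close> functions whose
  pole orders form the standard basis are linearly independent modulo \<open>x - a\<close>. So they induce all jets on the
  fibre, and in particular separate its points.

  Everything else is formal. Since \<open>\<phi>\<close> and \<open>\<theta>\<close> are surjective, they induce closed embeddings of spectra
  (\<open>surjective_hom_closed_embedding\<close>), and since \<open>R_X\<close> separates points, the coordinates embed the points
  (\<open>inj_curve_point\<close>). As \<open>x\<close> is onto, no nonzero polynomial in \<open>x\<close> becomes 0 in \<open>R_X\<close>, which gives the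
  injectivity of \<open>\<iota>\<close> (\<open>inj_curve_eval_base\<close>). Dividing by the \<open>x - x_i\<close> is the substitution \<open>x_i := x\<close>
  (\<open>diag_ring_iso_tensor_ring\<close>).
\<close>

section \<open>Evaluation of polynomials in several variables\<close>

definition monomial_value :: "('v \<Rightarrow> 'b::comm_ring_1) \<Rightarrow> ('v \<Rightarrow>\<^sub>0 nat) \<Rightarrow> 'b" where
  "monomial_value z t = (\<Prod>v\<in>Poly_Mapping.keys t. z v ^ Poly_Mapping.lookup t v)"

lemma monomial_value_superset:
  assumes "finite A" "Poly_Mapping.keys t \<subseteq> A"
  shows "monomial_value z t = (\<Prod>v\<in>A. z v ^ Poly_Mapping.lookup t v)"
  unfolding monomial_value_def
  by (rule prod.mono_neutral_left) (use assms in \<open>auto simp: in_keys_iff\<close>)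

lemma monomial_value_0 [simp]: "monomial_value z 0 = 1"
  by (simp add: monomial_value_def)

lemma monomial_value_single [simp]: "monomial_value z (Poly_Mapping.single v n) = z v ^ n"
  by (simp add: monomial_value_def)

lemma monomial_value_add: "monomial_value z (s + t) = monomial_value z s * monomial_value z t"
proof -
  let ?A = "Poly_Mapping.keys s \<union> Poly_Mapping.keys t"
  have "monomial_value z (s + t) = (\<Prod>v\<in>?A. z v ^ Poly_Mapping.lookup (s + t) v)"
    by (rule monomial_value_superset) (use keys_add[of s t] in auto)
  also have "\<dots> = (\<Prod>v\<in>?A. z v ^ Poly_Mapping.lookup s v) * (\<Prod>v\<in>?A. z v ^ Poly_Mapping.lookup t v)"
    by (simp add: lookup_add power_add prod.distrib)
  also have "\<dots> = monomial_value z s * monomial_value z t"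
    by (simp add: monomial_value_superset[where A = ?A])
  finally show ?thesis .
qed

lemma poly_mapping_sum_singles:
  fixes p :: "'k \<Rightarrow>\<^sub>0 'c::comm_monoid_add"
  shows "p = (\<Sum>t\<in>Poly_Mapping.keys p. Poly_Mapping.single t (Poly_Mapping.lookup p t))"
proof (rule poly_mapping_eqI)
  fix k
  have "Poly_Mapping.lookup (\<Sum>t\<in>Poly_Mapping.keys p. Poly_Mapping.single t (Poly_Mapping.lookup p t)) k
      = (\<Sum>t\<in>Poly_Mapping.keys p. if t = k then Poly_Mapping.lookup p k else 0)"
    unfolding lookup_sum by (intro sum.cong) (auto simp: lookup_single when_def)
  then show "Poly_Mapping.lookup p k = Poly_Mapping.lookup
      (\<Sum>t\<in>Poly_Mapping.keys p. Poly_Mapping.single t (Poly_Mapping.lookup p t)) k"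
    by (auto simp: in_keys_iff)
qed

text \<open>Evaluation with an arbitrary homomorphism on the coefficients covers both the evaluation of a
  polynomial at a point and the substitution of polynomials for its variables.\<close>

definition insertion :: "('c \<Rightarrow> 'b::comm_ring_1) \<Rightarrow> ('v \<Rightarrow> 'b) \<Rightarrow> (('v \<Rightarrow>\<^sub>0 nat) \<Rightarrow>\<^sub>0 'c::comm_ring_1) \<Rightarrow> 'b" where
  "insertion h z p = (\<Sum>t\<in>Poly_Mapping.keys p. h (Poly_Mapping.lookup p t) * monomial_value z t)"

locale coefficient_hom =
  fixes h :: "'c::comm_ring_1 \<Rightarrow> 'b::comm_ring_1"
  assumes h_add: "h (a + b) = h a + h b"
    and h_mult: "h (a * b) = h a * h b"
    and h_one: "h 1 = 1"
begin

lemma h_zero: "h 0 = 0"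
  using h_add[of 0 0] by simp

lemma insertion_0 [simp]: "insertion h z 0 = 0"
  by (simp add: insertion_def)

lemma insertion_single: "insertion h z (Poly_Mapping.single t c) = h c * monomial_value z t"
  by (simp add: insertion_def h_zero)

lemma insertion_1: "insertion h z 1 = 1"
  by (simp add: insertion_single h_one flip: single_one)

lemma insertion_add: "insertion h z (p + q) = insertion h z p + insertion h z q"
  unfolding insertion_def
  by (rule setsum_keys_plus_distrib) (auto simp: h_zero h_add algebra_simps)

lemma insertion_sum: "insertion h z (sum g A) = (\<Sum>a\<in>A. insertion h z (g a))"
  by (induction A rule: infinite_finite_induct) (auto simp: insertion_add)

lemma insertion_mult: "insertion h z (p * q) = insertion h z p * insertion h z q"
proof -
  let ?s = "\<lambda>p t. Poly_Mapping.single t (Poly_Mapping.lookup p t)"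
  have "p * q = (\<Sum>s\<in>Poly_Mapping.keys p. \<Sum>t\<in>Poly_Mapping.keys q. ?s p s * ?s q t)"
    by (subst sum_product[symmetric]) (simp flip: poly_mapping_sum_singles)
  then have "insertion h z (p * q) =
      (\<Sum>s\<in>Poly_Mapping.keys p. \<Sum>t\<in>Poly_Mapping.keys q.
         (h (Poly_Mapping.lookup p s) * monomial_value z s) * (h (Poly_Mapping.lookup q t) * monomial_value z t))"
    by (simp add: insertion_sum insertion_single mult_single h_mult monomial_value_add algebra_simps)
  also have "\<dots> = insertion h z p * insertion h z q"
    by (simp add: insertion_def sum_product)
  finally show ?thesis .
qed

end

lemma mpoly_eval_eq_insertion: "mpoly_eval z = insertion id z"
  by (simp add: fun_eq_iff mpoly_eval_def insertion_def monomial_value_def)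

interpretation id_hom: coefficient_hom "id :: complex \<Rightarrow> complex"
  by unfold_locales auto

interpretation mconst_hom: coefficient_hom mconst
  by unfold_locales (auto simp: mconst_def single_add mult_single)

lemma mpoly_eval_mconst [simp]: "mpoly_eval z (mconst c) = c"
  by (simp add: mpoly_eval_eq_insertion mconst_def id_hom.insertion_single)

lemma mpoly_eval_mvar [simp]: "mpoly_eval z (mvar v) = z v"
  by (simp add: mpoly_eval_eq_insertion mvar_def id_hom.insertion_single)

lemma mpoly_eval_add: "mpoly_eval z (p + q) = mpoly_eval z p + mpoly_eval z q"
  by (simp add: mpoly_eval_eq_insertion id_hom.insertion_add)

lemma mpoly_eval_mult: "mpoly_eval z (p * q) = mpoly_eval z p * mpoly_eval z q"
  by (simp add: mpoly_eval_eq_insertion id_hom.insertion_mult)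

lemma mpoly_eval_0 [simp]: "mpoly_eval z 0 = 0"
  by (simp add: mpoly_eval_def)

lemma mpoly_eval_1 [simp]: "mpoly_eval z 1 = 1"
  by (simp add: mpoly_eval_eq_insertion id_hom.insertion_1)

definition mpoly_subst :: "(var \<Rightarrow> mpoly) \<Rightarrow> mpoly \<Rightarrow> mpoly" where
  "mpoly_subst = insertion mconst"

lemma mpoly_subst_mconst [simp]: "mpoly_subst z (mconst c) = mconst c"
  using mconst_hom.insertion_single[of z 0 c] by (simp add: mpoly_subst_def mconst_def)

lemma mpoly_subst_mvar [simp]: "mpoly_subst z (mvar v) = z v"
  by (simp add: mpoly_subst_def mvar_def mconst_hom.insertion_single mconst_hom.h_one)

lemma mpoly_subst_add: "mpoly_subst z (p + q) = mpoly_subst z p + mpoly_subst z q"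
  by (simp add: mpoly_subst_def mconst_hom.insertion_add)

lemma mpoly_subst_mult: "mpoly_subst z (p * q) = mpoly_subst z p * mpoly_subst z q"
  by (simp add: mpoly_subst_def mconst_hom.insertion_mult)

lemma mpoly_subst_1 [simp]: "mpoly_subst z 1 = 1"
  by (simp add: mpoly_subst_def mconst_hom.insertion_1)

section \<open>Rings of polynomials in some of the variables\<close>

lemma mpoly_ring_simps [simp]:
  "monoid.mult (mpoly_ring V) = (*)" "one (mpoly_ring V) = 1"
  "zero (mpoly_ring V) = 0" "add (mpoly_ring V) = (+)"
  by (simp_all add: mpoly_ring_def)

lemma mem_mpoly_ring:
  "p \<in> carrier (mpoly_ring V) \<longleftrightarrow> (\<forall>t\<in>Poly_Mapping.keys p. Poly_Mapping.keys t \<subseteq> V)"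
  by (simp add: mpoly_ring_def)

lemma mpoly_ring_mono: "V \<subseteq> W \<Longrightarrow> carrier (mpoly_ring V) \<subseteq> carrier (mpoly_ring W)"
  by (force simp: mem_mpoly_ring)

lemma mpoly_ring_closed [simp]:
  shows mconst_in_mpoly_ring: "mconst c \<in> carrier (mpoly_ring V)"
    and mvar_in_mpoly_ring: "v \<in> V \<Longrightarrow> mvar v \<in> carrier (mpoly_ring V)"
    and zero_in_mpoly_ring: "0 \<in> carrier (mpoly_ring V)"
    and one_in_mpoly_ring: "1 \<in> carrier (mpoly_ring V)"
  by (auto simp: mem_mpoly_ring mconst_def mvar_def)

lemma add_in_mpoly_ring:
  "p \<in> carrier (mpoly_ring V) \<Longrightarrow> q \<in> carrier (mpoly_ring V) \<Longrightarrow> p + q \<in> carrier (mpoly_ring V)"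
  unfolding mem_mpoly_ring using keys_add[of p q] by blast

lemma mult_in_mpoly_ring:
  assumes "p \<in> carrier (mpoly_ring V)" "q \<in> carrier (mpoly_ring V)"
  shows "p * q \<in> carrier (mpoly_ring V)"
  unfolding mem_mpoly_ring
proof
  fix t assume "t \<in> Poly_Mapping.keys (p * q)"
  then obtain a b where "t = a + b" "a \<in> Poly_Mapping.keys p" "b \<in> Poly_Mapping.keys q"
    using keys_mult[of p q] by blast
  then show "Poly_Mapping.keys t \<subseteq> V"
    using assms keys_add[of a b] unfolding mem_mpoly_ring by blast
qed

lemma cring_mpoly_ring: "cring (mpoly_ring V)"
proof (rule cringI)
  show "abelian_group (mpoly_ring V)"
  proof (rule abelian_groupI; simp add: add_in_mpoly_ring algebra_simps)
    fix p assume "p \<in> carrier (mpoly_ring V)"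
    then have "- p \<in> carrier (mpoly_ring V)"
      by (simp add: mem_mpoly_ring in_keys_iff)
    then show "\<exists>q\<in>carrier (mpoly_ring V). p + q = 0"
      by (intro bexI[of _ "- p"]) simp_all
  qed
  show "Group.comm_monoid (mpoly_ring V)"
    by (rule comm_monoidI) (auto simp: mult_in_mpoly_ring algebra_simps)
qed (simp add: algebra_simps)

lemma ring_mpoly_ring: "ring (mpoly_ring V)"
  using cring_mpoly_ring cring.axioms(1) by blast

lemma mvar_power: "mvar v ^ n = Poly_Mapping.single (Poly_Mapping.single v n) 1"
  by (induction n) (auto simp: mvar_def mult_single single_add[symmetric] simp flip: single_one)

lemma single_eq_monomial:
  "Poly_Mapping.single t c = mconst c * monomial_value mvar t"
proof -
  have *: "(\<Prod>v\<in>A. Poly_Mapping.single (w v) (1::complex)) = Poly_Mapping.single (sum w A) 1"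
    for A and w :: "var \<Rightarrow> var \<Rightarrow>\<^sub>0 nat"
    by (induction A rule: infinite_finite_induct) (auto simp: mult_single simp flip: single_one)
  have "monomial_value mvar t = Poly_Mapping.single t 1"
    by (subst (2) poly_mapping_sum_singles[of t]) (simp add: monomial_value_def mvar_power *)
  then show ?thesis
    by (simp add: mconst_def mult_single)
qed

text \<open>The polynomials in the variables \<open>V\<close> are generated by the constants and these variables; so
  two ring homomorphisms agree as soon as they agree on those.\<close>

lemma mpoly_induct [consumes 1, case_names const var add mult]:
  assumes p: "p \<in> carrier (mpoly_ring V)"
    and const: "\<And>c. P (mconst c)" and var: "\<And>v. v \<in> V \<Longrightarrow> P (mvar v)"
    and add: "\<And>p q. \<lbrakk>p \<in> carrier (mpoly_ring V); q \<in> carrier (mpoly_ring V); P p; P q\<rbrakk> \<Longrightarrow> P (p + q)"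
    and mult: "\<And>p q. \<lbrakk>p \<in> carrier (mpoly_ring V); q \<in> carrier (mpoly_ring V); P p; P q\<rbrakk> \<Longrightarrow> P (p * q)"
  shows "P p"
proof -
  let ?Q = "\<lambda>p. p \<in> carrier (mpoly_ring V) \<and> P p"
  have Q01: "?Q 0" "?Q 1"
    using const[of 0] const[of 1] by (auto simp: mconst_hom.h_zero mconst_hom.h_one)
  have Qmult: "?Q (p * q)" if "?Q p" "?Q q" for p q
    using that mult mult_in_mpoly_ring by blast
  have Qpow: "?Q (mvar v ^ n)" if "v \<in> V" for v n
    using that by (induction n) (auto simp: Q01 var intro!: Qmult[THEN conjunct1] Qmult[THEN conjunct2])
  have Qprod: "?Q (\<Prod>v\<in>A. mvar v ^ e v)" if "A \<subseteq> V" for A e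
    using that
  proof (induction A rule: infinite_finite_induct)
    case (insert v A)
    then show ?case using Qmult[of "mvar v ^ e v" "\<Prod>v\<in>A. mvar v ^ e v"] Qpow by simp
  qed (use Q01 in auto)
  have Qmono: "?Q (Poly_Mapping.single t c)" if "Poly_Mapping.keys t \<subseteq> V" for t c
    unfolding single_eq_monomial monomial_value_def
    by (rule Qmult) (auto simp: const Qprod[OF that])
  have "?Q (\<Sum>t\<in>A. Poly_Mapping.single t (Poly_Mapping.lookup p t))" if "A \<subseteq> Poly_Mapping.keys p" for A
    using that
  proof (induction A rule: infinite_finite_induct)
    case (insert t A)
    then show ?case using p Qmono[of t "Poly_Mapping.lookup p t"] add add_in_mpoly_ring
      by (auto simp: mem_mpoly_ring[of p])
  qed (use Q01 in auto)
  then show ?thesis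
    using poly_mapping_sum_singles[of p] by force
qed

lemma hom_poly_map_poly:
  assumes "\<And>a b. E (a + b) = E a + E b" "\<And>a b. E (a * b) = E a * E b" "E 0 = 0" "g 0 = 0"
  shows "E (poly (map_poly g p) a) = poly (map_poly (\<lambda>c. E (g c)) p) (E a)"
  by (induction p) (auto simp: map_poly_pCons assms)

lemma mpoly_eval_univariate: "mpoly_eval z (poly (map_poly mconst c) (mvar v)) = poly c (z v)"
  by (subst hom_poly_map_poly) (auto simp: mpoly_eval_add mpoly_eval_mult mconst_hom.h_zero map_poly_id')

lemma mpoly_eval_subst2: "mpoly_eval z (subst2 p u v) = poly2 p (z u) (z v)"
  unfolding subst2_def poly2_def
  by (subst hom_poly_map_poly) (auto simp: mpoly_eval_add mpoly_eval_mult mpoly_eval_univariate)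

lemma mpoly_subst_subst2:
  assumes "z u = mvar u'" "z v = mvar v'"
  shows "mpoly_subst z (subst2 p u v) = subst2 p u' v'"
proof -
  have z0: "mpoly_subst z 0 = 0"
    using mpoly_subst_mconst[of z 0] by (simp add: mconst_hom.h_zero)
  have "mpoly_subst z (poly (map_poly mconst c) (mvar u)) = poly (map_poly mconst c) (mvar u')" for c
    by (subst hom_poly_map_poly) (auto simp: mpoly_subst_add mpoly_subst_mult mconst_hom.h_zero assms z0)
  then show ?thesis
    unfolding subst2_def
    by (subst hom_poly_map_poly) (auto simp: mpoly_subst_add mpoly_subst_mult z0 assms)
qed

lemma poly_map_poly_in_mpoly_ring:
  assumes "\<And>c. g c \<in> carrier (mpoly_ring V)" "g 0 = 0" "a \<in> carrier (mpoly_ring V)"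
  shows "poly (map_poly g p) a \<in> carrier (mpoly_ring V)"
  by (induction p) (auto simp: map_poly_pCons assms add_in_mpoly_ring mult_in_mpoly_ring)

lemma subst2_in_mpoly_ring:
  "u \<in> V \<Longrightarrow> v \<in> V \<Longrightarrow> subst2 p u v \<in> carrier (mpoly_ring V)"
  unfolding subst2_def
  by (intro poly_map_poly_in_mpoly_ring) (auto simp: mconst_hom.h_zero)

lemma mpoly_eval_cong:
  assumes "p \<in> carrier (mpoly_ring V)" "\<And>v. v \<in> V \<Longrightarrow> z v = w v"
  shows "mpoly_eval z p = mpoly_eval w p"
  using assms(1) by (induction rule: mpoly_induct) (auto simp: assms(2) mpoly_eval_add mpoly_eval_mult)

section \<open>Homomorphisms out of quotients\<close>

lemma FactRing_carrierE:
  assumes "C \<in> carrier (R Quot I)"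
  obtains a where "a \<in> carrier R" "C = I +>\<^bsub>R\<^esub> a"
  using assms by (auto simp: FactRing_simps)

text \<open>The kernel of \<open>h\<close> is an ideal, so it contains the ideal generated by \<open>G\<close> as soon as it contains
  \<open>G\<close>; hence \<open>h\<close> is constant on the cosets.\<close>

lemma quotient_hom_exists:
  assumes R: "ring R" and S: "ring S" and h: "h \<in> ring_hom R S"
    and G: "G \<subseteq> carrier R" "\<And>a. a \<in> G \<Longrightarrow> h a = \<zero>\<^bsub>S\<^esub>"
  shows "\<exists>g. g \<in> ring_hom (R Quot genideal R G) S \<and> (\<forall>a\<in>carrier R. g (genideal R G +>\<^bsub>R\<^esub> a) = h a)"
proof -
  interpret R: ring R by fact
  interpret S: ring S by fact
  interpret h: ring_hom_ring R S h by (rule ring_hom_ringI2) fact+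
  define I where "I = genideal R G"
  interpret I: ideal I R unfolding I_def by (rule R.genideal_ideal) fact
  have kernel: "a_kernel R S h = {a \<in> carrier R. h a = \<zero>\<^bsub>S\<^esub>}"
    by (rule a_kernel_def')
  have "G \<subseteq> a_kernel R S h"
    unfolding kernel using G by blast
  then have "I \<subseteq> a_kernel R S h"
    unfolding I_def by (rule R.genideal_minimal[OF h.kernel_is_ideal])
  then have hI: "h a = \<zero>\<^bsub>S\<^esub>" if "a \<in> I" for a
    using that unfolding kernel by blast
  define g where "g C = the_elem (h ` C)" for C
  have g: "g (I +>\<^bsub>R\<^esub> a) = h a" if a: "a \<in> carrier R" for a
  proof -
    have "h ` (I +>\<^bsub>R\<^esub> a) = {h a}"
    proof
      show "h ` (I +>\<^bsub>R\<^esub> a) \<subseteq> {h a}"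
      proof
        fix b assume "b \<in> h ` (I +>\<^bsub>R\<^esub> a)"
        then obtain i where i: "i \<in> I" "b = h (i \<oplus>\<^bsub>R\<^esub> a)" by (auto simp: a_r_coset_def')
        then show "b \<in> {h a}" using a I.Icarr[OF i(1)] hI[OF i(1)] by simp
      qed
      have "a \<in> I +>\<^bsub>R\<^esub> a"
        using a I.a_rcos_self by blast
      then show "{h a} \<subseteq> h ` (I +>\<^bsub>R\<^esub> a)" by auto
    qed
    then show ?thesis by (simp add: g_def)
  qed
  have "g \<in> ring_hom (R Quot I) S"
  proof (rule ring_hom_memI)
    fix C assume "C \<in> carrier (R Quot I)"
    then obtain a where a: "a \<in> carrier R" "C = I +>\<^bsub>R\<^esub> a" by (rule FactRing_carrierE)
    then show "g C \<in> carrier S" by (simp add: g)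
    fix D assume "D \<in> carrier (R Quot I)"
    then obtain b where b: "b \<in> carrier R" "D = I +>\<^bsub>R\<^esub> b" by (rule FactRing_carrierE)
    show "g (C \<otimes>\<^bsub>R Quot I\<^esub> D) = g C \<otimes>\<^bsub>S\<^esub> g D"
      using a b by (simp add: g ring_hom_mult[OF I.rcos_ring_hom, symmetric])
    show "g (C \<oplus>\<^bsub>R Quot I\<^esub> D) = g C \<oplus>\<^bsub>S\<^esub> g D"
      using a b by (simp add: g ring_hom_add[OF I.rcos_ring_hom, symmetric])
  next
    show "g \<one>\<^bsub>R Quot I\<^esub> = \<one>\<^bsub>S\<^esub>"
      by (simp add: g ring_hom_one[OF I.rcos_ring_hom, symmetric])
  qed
  with g show ?thesis unfolding I_def by blast
qed

lemma genideal_class_eq_zero: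
  assumes "ring R" "G \<subseteq> carrier R" "a \<in> G"
  shows "genideal R G +>\<^bsub>R\<^esub> a = \<zero>\<^bsub>R Quot genideal R G\<^esub>"
proof -
  interpret R: ring R by fact
  interpret I: ideal "genideal R G" R by (rule R.genideal_ideal) fact
  have "a \<in> genideal R G" using R.genideal_self assms by blast
  then show ?thesis by (simp add: FactRing_def I.a_rcos_const)
qed

section \<open>Identifying the base coordinates of the factors\<close>

lemma vars_disjoint_simps [simp]:
  "Vx \<in> tensor_vars m" "Vy i \<in> tensor_vars m \<longleftrightarrow> i \<in> {2..m}" "Vxi i \<notin> tensor_vars m"
  "Vx \<notin> product_vars m" "Vy i \<in> product_vars m \<longleftrightarrow> i \<in> {2..m}" "Vxi i \<in> product_vars m \<longleftrightarrow> i \<in> {2..m}"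
  "Vx \<in> diag_vars m" "Vy i \<in> diag_vars m \<longleftrightarrow> i \<in> {2..m}" "Vxi i \<in> diag_vars m \<longleftrightarrow> i \<in> {2..m}"
  by (auto simp: tensor_vars_def product_vars_def diag_vars_def)

lemma vars_subset:
  "base_vars \<subseteq> tensor_vars m" "tensor_vars m \<subseteq> diag_vars m" "product_vars m \<subseteq> diag_vars m"
  by (auto simp: base_vars_def tensor_vars_def product_vars_def diag_vars_def)

definition diagonal :: "var \<Rightarrow> mpoly" where
  "diagonal v = (case v of Vxi i \<Rightarrow> mvar Vx | _ \<Rightarrow> mvar v)"

lemma tensor_gens: "(\<lambda>i. subst2 (f i) Vx (Vy i)) ` {2..m} \<subseteq> carrier (mpoly_ring (tensor_vars m))"
  by (auto intro!: subst2_in_mpoly_ring)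

lemma product_gens: "(\<lambda>i. subst2 (f i) (Vxi i) (Vy i)) ` {2..m} \<subseteq> carrier (mpoly_ring (product_vars m))"
  by (auto intro!: subst2_in_mpoly_ring)

lemma diag_gens:
  "(\<lambda>i. subst2 (f i) (Vxi i) (Vy i)) ` {2..m} \<union> (\<lambda>i. mvar Vx - mvar (Vxi i)) ` {2..m}
    \<subseteq> carrier (mpoly_ring (diag_vars m))"
proof -
  have "mconst (- 1) = - 1"
    by (simp add: mconst_def single_uminus)
  then have "mvar Vx - mvar (Vxi i) = mvar Vx + mconst (- 1) * mvar (Vxi i)" for i
    by simp
  then have "mvar Vx - mvar (Vxi i) \<in> carrier (mpoly_ring (diag_vars m))" if "i \<in> {2..m}" for i
    using that by (metis add_in_mpoly_ring mult_in_mpoly_ring mconst_in_mpoly_ring mvar_in_mpoly_ring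
        vars_disjoint_simps(7,9))
  then show ?thesis
    by (auto intro!: subst2_in_mpoly_ring)
qed

lemma tensor_class_hom: "tensor_class m f \<in> ring_hom (mpoly_ring (tensor_vars m)) (tensor_ring m f)"
  unfolding tensor_class_def tensor_ring_def tensor_ideal_def
  by (intro ideal.rcos_ring_hom ring.genideal_ideal ring_mpoly_ring tensor_gens)

lemma diag_class_hom: "diag_class m f \<in> ring_hom (mpoly_ring (diag_vars m)) (diag_ring m f)"
  unfolding diag_class_def diag_ring_def diag_ideal_def
  by (intro ideal.rcos_ring_hom ring.genideal_ideal ring_mpoly_ring diag_gens)

lemma product_class_hom: "product_class m f \<in> ring_hom (mpoly_ring (product_vars m)) (product_ring m f)"
  unfolding product_class_def product_ring_def product_ideal_def
  by (intro ideal.rcos_ring_hom ring.genideal_ideal ring_mpoly_ring product_gens)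

lemma cring_tensor_ring: "cring (tensor_ring m f)"
  unfolding tensor_ring_def tensor_ideal_def
  by (intro ideal.quotient_is_cring ring.genideal_ideal ring_mpoly_ring tensor_gens cring_mpoly_ring)

lemma cring_diag_ring: "cring (diag_ring m f)"
  unfolding diag_ring_def diag_ideal_def
  by (intro ideal.quotient_is_cring ring.genideal_ideal ring_mpoly_ring diag_gens cring_mpoly_ring)

lemma cring_product_ring: "cring (product_ring m f)"
  unfolding product_ring_def product_ideal_def
  by (intro ideal.quotient_is_cring ring.genideal_ideal ring_mpoly_ring product_gens cring_mpoly_ring)

lemma tensor_class_surj:
  assumes "C \<in> carrier (tensor_ring m f)"
  obtains p where "p \<in> carrier (mpoly_ring (tensor_vars m))" "C = tensor_class m f p"
  using assms unfolding tensor_ring_def tensor_class_def by (rule FactRing_carrierE)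

lemma diag_class_surj:
  assumes "C \<in> carrier (diag_ring m f)"
  obtains p where "p \<in> carrier (mpoly_ring (diag_vars m))" "C = diag_class m f p"
  using assms unfolding diag_ring_def diag_class_def by (rule FactRing_carrierE)

lemma product_class_surj:
  assumes "C \<in> carrier (product_ring m f)"
  obtains p where "p \<in> carrier (mpoly_ring (product_vars m))" "C = product_class m f p"
  using assms unfolding product_ring_def product_class_def by (rule FactRing_carrierE)

lemma mpoly_subst_diagonal_closed:
  "p \<in> carrier (mpoly_ring (diag_vars m)) \<Longrightarrow> mpoly_subst diagonal p \<in> carrier (mpoly_ring (tensor_vars m))"
proof (induction rule: mpoly_induct)
  case (var v)
  then show ?case by (cases v) (auto simp: diagonal_def)
qed (auto simp: mpoly_subst_add mpoly_subst_mult add_in_mpoly_ring mult_in_mpoly_ring)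

lemma mpoly_subst_diagonal_id:
  "p \<in> carrier (mpoly_ring (tensor_vars m)) \<Longrightarrow> mpoly_subst diagonal p = p"
proof (induction rule: mpoly_induct)
  case (var v)
  then show ?case by (cases v) (auto simp: diagonal_def)
qed (auto simp: mpoly_subst_add mpoly_subst_mult)

text \<open>Modulo \<open>x - x_i\<close> the substitution \<open>x_i := x\<close> changes nothing on the variables, hence nothing at all.\<close>

lemma diag_class_subst:
  assumes "p \<in> carrier (mpoly_ring (diag_vars m))"
  shows "diag_class m f (mpoly_subst diagonal p) = diag_class m f p"
  using assms
proof (induction rule: mpoly_induct)
  case (var v)
  show ?case
  proof (cases v)
    case (Vxi i)
    with var have i: "i \<in> {2..m}" by simp
    interpret D: cring "diag_ring m f" by (rule cring_diag_ring)
    let ?d = "mvar Vx - mvar (Vxi i)"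
    have cl: "?d \<in> carrier (mpoly_ring (diag_vars m))"
      using diag_gens[of f m] i by auto
    have "diag_class m f ?d = \<zero>\<^bsub>diag_ring m f\<^esub>"
      unfolding diag_class_def diag_ring_def diag_ideal_def
      by (rule genideal_class_eq_zero[OF ring_mpoly_ring diag_gens]) (use i in auto)
    moreover have "diag_class m f (mvar (Vxi i) + ?d)
        = diag_class m f (mvar (Vxi i)) \<oplus>\<^bsub>diag_ring m f\<^esub> diag_class m f ?d"
      using ring_hom_add[OF diag_class_hom, of "mvar (Vxi i)" m ?d f] i cl by simp
    moreover have "diag_class m f (mvar (Vxi i)) \<in> carrier (diag_ring m f)"
      using i by (intro ring_hom_closed[OF diag_class_hom]) simp
    ultimately show ?thesis using Vxi by (simp add: diagonal_def)
  qed (simp_all add: diagonal_def)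
next
  case (add p q)
  let ?s = "mpoly_subst diagonal"
  have "?s p \<in> carrier (mpoly_ring (diag_vars m))" "?s q \<in> carrier (mpoly_ring (diag_vars m))"
    using add mpoly_subst_diagonal_closed mpoly_ring_mono[OF vars_subset(2)] by blast+
  then show ?case
    using add ring_hom_add[OF diag_class_hom, of "?s p" m "?s q" f]
      ring_hom_add[OF diag_class_hom, of p m q f] by (simp add: mpoly_subst_add)
next
  case (mult p q)
  let ?s = "mpoly_subst diagonal"
  have "?s p \<in> carrier (mpoly_ring (diag_vars m))" "?s q \<in> carrier (mpoly_ring (diag_vars m))"
    using mult mpoly_subst_diagonal_closed mpoly_ring_mono[OF vars_subset(2)] by blast+
  then show ?case
    using mult ring_hom_mult[OF diag_class_hom, of "?s p" m "?s q" f]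
      ring_hom_mult[OF diag_class_hom, of p m q f] by (simp add: mpoly_subst_mult)
qed simp

text \<open>Substituting \<open>x\<close> for the \<open>x_i\<close> and including \<open>\<complex>[x, y_i]\<close> into \<open>\<complex>[x, x_i, y_i]\<close> induce mutually
  inverse maps of the quotients.\<close>

lemma diag_ring_iso_tensor_ring:
  "\<exists>\<kappa>. \<kappa> \<in> ring_iso (diag_ring m f) (tensor_ring m f) \<and>
     (\<forall>p\<in>carrier (mpoly_ring (diag_vars m)). \<kappa> (diag_class m f p) = tensor_class m f (mpoly_subst diagonal p))"
proof -
  let ?s = "mpoly_subst diagonal"
  have incl: "carrier (mpoly_ring (tensor_vars m)) \<subseteq> carrier (mpoly_ring (diag_vars m))"
    by (rule mpoly_ring_mono[OF vars_subset(2)])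
  have subst_diag: "?s (subst2 (f i) (Vxi i) (Vy i)) = subst2 (f i) Vx (Vy i)" for i
    by (rule mpoly_subst_subst2) (simp_all add: diagonal_def)
  have subst_hom: "(\<lambda>p. tensor_class m f (?s p)) \<in> ring_hom (mpoly_ring (diag_vars m)) (tensor_ring m f)"
  proof (rule ring_hom_memI)
    fix p assume p: "p \<in> carrier (mpoly_ring (diag_vars m))"
    show "tensor_class m f (?s p) \<in> carrier (tensor_ring m f)"
      by (intro ring_hom_closed[OF tensor_class_hom] mpoly_subst_diagonal_closed p)
    fix q assume q: "q \<in> carrier (mpoly_ring (diag_vars m))"
    note cl = mpoly_subst_diagonal_closed[OF p] mpoly_subst_diagonal_closed[OF q]
    show "tensor_class m f (?s (p \<otimes>\<^bsub>mpoly_ring (diag_vars m)\<^esub> q))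
        = tensor_class m f (?s p) \<otimes>\<^bsub>tensor_ring m f\<^esub> tensor_class m f (?s q)"
      using ring_hom_mult[OF tensor_class_hom cl, of f] by (simp add: mpoly_subst_mult)
    show "tensor_class m f (?s (p \<oplus>\<^bsub>mpoly_ring (diag_vars m)\<^esub> q))
        = tensor_class m f (?s p) \<oplus>\<^bsub>tensor_ring m f\<^esub> tensor_class m f (?s q)"
      using ring_hom_add[OF tensor_class_hom cl, of f] by (simp add: mpoly_subst_add)
  qed (use ring_hom_one[OF tensor_class_hom, of m f] in simp)
  have tensor_zero: "tensor_class m f 0 = \<zero>\<^bsub>tensor_ring m f\<^esub>"
    using ring_hom_zero[OF tensor_class_hom ring_mpoly_ring cring.axioms(1)[OF cring_tensor_ring]]
    by simp
  have subst_zero: "?s (mvar Vx - mvar (Vxi i)) = 0" for i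
    using mpoly_subst_add[of diagonal "mvar Vx - mvar (Vxi i)" "mvar (Vxi i)"]
    by (simp add: diagonal_def)
  have "\<exists>\<kappa>. \<kappa> \<in> ring_hom (diag_ring m f) (tensor_ring m f) \<and>
      (\<forall>p\<in>carrier (mpoly_ring (diag_vars m)). \<kappa> (diag_class m f p) = tensor_class m f (?s p))"
    unfolding diag_ring_def diag_class_def diag_ideal_def
  proof (rule quotient_hom_exists[OF ring_mpoly_ring _ subst_hom diag_gens])
    show "ring (tensor_ring m f)" using cring_tensor_ring cring.axioms(1) by blast
    fix a assume "a \<in> (\<lambda>i. subst2 (f i) (Vxi i) (Vy i)) ` {2..m} \<union> (\<lambda>i. mvar Vx - mvar (Vxi i)) ` {2..m}"
    then show "tensor_class m f (?s a) = \<zero>\<^bsub>tensor_ring m f\<^esub>"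
    proof
      assume "a \<in> (\<lambda>i. subst2 (f i) (Vxi i) (Vy i)) ` {2..m}"
      then obtain i where i: "i \<in> {2..m}" "?s a = subst2 (f i) Vx (Vy i)" by (auto simp: subst_diag)
      show ?thesis
        unfolding tensor_class_def tensor_ring_def tensor_ideal_def
        by (rule genideal_class_eq_zero[OF ring_mpoly_ring tensor_gens]) (use i in auto)
    qed (auto simp: subst_zero tensor_zero)
  qed
  then obtain \<kappa> where \<kappa>: "\<kappa> \<in> ring_hom (diag_ring m f) (tensor_ring m f)"
    "\<And>p. p \<in> carrier (mpoly_ring (diag_vars m)) \<Longrightarrow> \<kappa> (diag_class m f p) = tensor_class m f (?s p)"
    by blast
  have incl_hom: "diag_class m f \<in> ring_hom (mpoly_ring (tensor_vars m)) (diag_ring m f)"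
  proof (rule ring_hom_memI)
    fix p assume "p \<in> carrier (mpoly_ring (tensor_vars m))"
    then have p: "p \<in> carrier (mpoly_ring (diag_vars m))" using incl by blast
    show "diag_class m f p \<in> carrier (diag_ring m f)"
      by (intro ring_hom_closed[OF diag_class_hom] p)
    fix q assume "q \<in> carrier (mpoly_ring (tensor_vars m))"
    then have q: "q \<in> carrier (mpoly_ring (diag_vars m))" using incl by blast
    show "diag_class m f (p \<otimes>\<^bsub>mpoly_ring (tensor_vars m)\<^esub> q)
        = diag_class m f p \<otimes>\<^bsub>diag_ring m f\<^esub> diag_class m f q"
      using ring_hom_mult[OF diag_class_hom p q, of f] by simp
    show "diag_class m f (p \<oplus>\<^bsub>mpoly_ring (tensor_vars m)\<^esub> q)
        = diag_class m f p \<oplus>\<^bsub>diag_ring m f\<^esub> diag_class m f q"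
      using ring_hom_add[OF diag_class_hom p q, of f] by simp
  qed (use ring_hom_one[OF diag_class_hom, of m f] in simp)
  have "\<exists>l. l \<in> ring_hom (tensor_ring m f) (diag_ring m f) \<and>
      (\<forall>p\<in>carrier (mpoly_ring (tensor_vars m)). l (tensor_class m f p) = diag_class m f p)"
    unfolding tensor_ring_def tensor_class_def tensor_ideal_def
  proof (rule quotient_hom_exists[OF ring_mpoly_ring _ incl_hom tensor_gens])
    show "ring (diag_ring m f)" using cring_diag_ring cring.axioms(1) by blast
    fix a assume "a \<in> (\<lambda>i. subst2 (f i) Vx (Vy i)) ` {2..m}"
    then obtain i where i: "i \<in> {2..m}" "a = ?s (subst2 (f i) (Vxi i) (Vy i))" by (auto simp: subst_diag)
    have "subst2 (f i) (Vxi i) (Vy i) \<in> carrier (mpoly_ring (diag_vars m))"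
      using i by (intro subst2_in_mpoly_ring) auto
    then have "diag_class m f a = diag_class m f (subst2 (f i) (Vxi i) (Vy i))"
      by (simp add: i diag_class_subst)
    also have "\<dots> = \<zero>\<^bsub>diag_ring m f\<^esub>"
      unfolding diag_class_def diag_ring_def diag_ideal_def
      by (rule genideal_class_eq_zero[OF ring_mpoly_ring diag_gens]) (use i in auto)
    finally show "diag_class m f a = \<zero>\<^bsub>diag_ring m f\<^esub>" .
  qed
  then obtain l where l: "l \<in> ring_hom (tensor_ring m f) (diag_ring m f)"
    "\<And>p. p \<in> carrier (mpoly_ring (tensor_vars m)) \<Longrightarrow> l (tensor_class m f p) = diag_class m f p"
    by blast
  have "bij_betw \<kappa> (carrier (diag_ring m f)) (carrier (tensor_ring m f))"
  proof (rule bij_betw_byWitness[where f' = l])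
    show "\<forall>C\<in>carrier (diag_ring m f). l (\<kappa> C) = C"
    proof
      fix C assume "C \<in> carrier (diag_ring m f)"
      then obtain p where "p \<in> carrier (mpoly_ring (diag_vars m))" "C = diag_class m f p"
        by (rule diag_class_surj)
      then show "l (\<kappa> C) = C" by (simp add: \<kappa> l mpoly_subst_diagonal_closed diag_class_subst)
    qed
    show "\<forall>C\<in>carrier (tensor_ring m f). \<kappa> (l C) = C"
    proof
      fix C assume "C \<in> carrier (tensor_ring m f)"
      then obtain p where p: "p \<in> carrier (mpoly_ring (tensor_vars m))" "C = tensor_class m f p"
        by (rule tensor_class_surj)
      then have "p \<in> carrier (mpoly_ring (diag_vars m))" using incl by blast
      with p show "\<kappa> (l C) = C" by (simp add: \<kappa> l mpoly_subst_diagonal_id)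
    qed
  qed (use ring_hom_closed[OF \<kappa>(1)] ring_hom_closed[OF l(1)] in auto)
  with \<kappa> show ?thesis by (auto simp: ring_iso_def)
qed

section \<open>Closed embeddings of spectra\<close>

lemma Spec_one_notin:
  assumes "q \<in> Spec R"
  shows "\<one>\<^bsub>R\<^esub> \<notin> q"
proof -
  interpret q: primeideal q R using assms by (simp add: Spec_def)
  show ?thesis using q.one_imp_carrier q.I_notcarr by blast
qed

text \<open>The basic open sets are closed under finite intersections because a prime avoids a member of \<open>E\<close> and
  a member of \<open>F\<close> exactly if it avoids a product \<open>e \<otimes> g\<close> with \<open>e \<in> E\<close> and \<open>g \<in> F\<close>.\<close>

lemma openin_zariski:
  assumes "cring R"
  shows "openin (zariski R) W \<longleftrightarrow> (\<exists>E\<subseteq>carrier R. W = {q \<in> Spec R. \<not> E \<subseteq> q})"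
proof -
  interpret R: cring R by fact
  let ?D = "\<lambda>E. {q \<in> Spec R. \<not> E \<subseteq> q}"
  have "istopology (\<lambda>W. \<exists>E\<subseteq>carrier R. W = ?D E)"
    unfolding istopology_def
  proof (intro conjI allI impI)
    fix V W assume "\<exists>E\<subseteq>carrier R. V = ?D E" "\<exists>E\<subseteq>carrier R. W = ?D E"
    then obtain E F where E: "E \<subseteq> carrier R" "V = ?D E" and F: "F \<subseteq> carrier R" "W = ?D F" by blast
    let ?EF = "{e \<otimes>\<^bsub>R\<^esub> g | e g. e \<in> E \<and> g \<in> F}"
    have "V \<inter> W = ?D ?EF"
    proof (intro equalityI subsetI)
      fix q assume "q \<in> V \<inter> W"
      then obtain e g where "q \<in> Spec R" "e \<in> E" "e \<notin> q" "g \<in> F" "g \<notin> q"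
        using E F by blast
      moreover have "e \<otimes>\<^bsub>R\<^esub> g \<notin> q"
        using calculation primeideal.I_prime[of q R e g] E F by (auto simp: Spec_def)
      ultimately show "q \<in> ?D ?EF" by blast
    next
      fix q assume q: "q \<in> ?D ?EF"
      then obtain e g where eg: "e \<in> E" "g \<in> F" "e \<otimes>\<^bsub>R\<^esub> g \<notin> q" by blast
      interpret q: primeideal q R using q by (simp add: Spec_def)
      have "e \<notin> q" "g \<notin> q" using eg E F q.I_l_closed q.I_r_closed by blast+
      then show "q \<in> V \<inter> W" using q eg E F by blast
    qed
    moreover have "?EF \<subseteq> carrier R" using E F by auto
    ultimately show "\<exists>E\<subseteq>carrier R. V \<inter> W = ?D E" by blast
  next
    fix K assume "\<forall>W\<in>K. \<exists>E\<subseteq>carrier R. W = ?D E"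
    then obtain E where E: "\<And>W. W \<in> K \<Longrightarrow> E W \<subseteq> carrier R \<and> W = ?D (E W)" by metis
    have "\<Union>K = ?D (\<Union>(E ` K))" using E by blast
    moreover have "\<Union>(E ` K) \<subseteq> carrier R" using E by blast
    ultimately show "\<exists>E\<subseteq>carrier R. \<Union>K = ?D E" by blast
  qed
  then show ?thesis by (simp add: zariski_def)
qed

lemma topspace_zariski:
  assumes "cring R"
  shows "topspace (zariski R) = Spec R"
proof
  interpret R: cring R by fact
  show "topspace (zariski R) \<subseteq> Spec R"
    unfolding topspace_def openin_zariski[OF assms] by blast
  have "Spec R = {q \<in> Spec R. \<not> {\<one>\<^bsub>R\<^esub>} \<subseteq> q}" using Spec_one_notin by blast
  then have "openin (zariski R) (Spec R)" unfolding openin_zariski[OF assms] by (intro exI[of _ "{\<one>\<^bsub>R\<^esub>}"]) auto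
  then show "Spec R \<subseteq> topspace (zariski R)" by (rule openin_subset)
qed

lemma closedin_zariski:
  assumes "cring R"
  shows "closedin (zariski R) C \<longleftrightarrow> (\<exists>E\<subseteq>carrier R. C = {q \<in> Spec R. E \<subseteq> q})"
  unfolding closedin_def topspace_zariski[OF assms] openin_zariski[OF assms]
proof safe
  fix E assume "C \<subseteq> Spec R" "E \<subseteq> carrier R" "Spec R - C = {q \<in> Spec R. \<not> E \<subseteq> q}"
  then have "C = {q \<in> Spec R. E \<subseteq> q}" by blast
  then show "\<exists>E\<subseteq>carrier R. C = {q \<in> Spec R. E \<subseteq> q}" using \<open>E \<subseteq> carrier R\<close> by blast
next
  fix E assume "E \<subseteq> carrier R"
  moreover have "Spec R - {q \<in> Spec R. E \<subseteq> q} = {q \<in> Spec R. \<not> E \<subseteq> q}" by blast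
  ultimately show "\<exists>F\<subseteq>carrier R. Spec R - {q \<in> Spec R. E \<subseteq> q} = {q \<in> Spec R. \<not> F \<subseteq> q}" by blast
qed

lemma Spec_map_in_Spec:
  assumes "cring R" "cring S" "h \<in> ring_hom R S" "q \<in> Spec S"
  shows "Spec_map R h q \<in> Spec R"
proof -
  interpret R: cring R by fact
  interpret S: cring S by fact
  interpret h: ring_hom_ring R S h
    by (rule ring_hom_ringI2) (use assms R.ring_axioms S.ring_axioms in auto)
  interpret q: primeideal q S using assms by (simp add: Spec_def)
  have "ideal (Spec_map R h q) R"
    unfolding Spec_map_def by (rule h.ideal_vimage) (rule q.is_ideal)
  then have "primeideal (Spec_map R h q) R"
  proof (rule primeidealI[OF _ assms(1)])
    have "h \<one>\<^bsub>R\<^esub> \<notin> q" using Spec_one_notin assms(4) by (metis h.hom_one)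
    then show "carrier R \<noteq> Spec_map R h q" unfolding Spec_map_def using R.one_closed by blast
    show "\<And>a b. \<lbrakk>a \<in> carrier R; b \<in> carrier R; a \<otimes>\<^bsub>R\<^esub> b \<in> Spec_map R h q\<rbrakk>
        \<Longrightarrow> a \<in> Spec_map R h q \<or> b \<in> Spec_map R h q"
      using q.I_prime by (auto simp: Spec_map_def)
  qed
  then show ?thesis by (simp add: Spec_def)
qed

text \<open>A subset of the target of a surjection is the image of its preimage.\<close>

lemma inj_on_Spec_map:
  assumes surj: "h ` carrier R = carrier S"
  shows "inj_on (Spec_map R h) (Spec S)"
proof (rule inj_on_inverseI)
  fix q assume "q \<in> Spec S"
  then interpret q: primeideal q S by (simp add: Spec_def)
  show "h ` Spec_map R h q = q"
  proof
    show "q \<subseteq> h ` Spec_map R h q"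
    proof
      fix b assume b: "b \<in> q"
      then obtain a where "a \<in> carrier R" "b = h a"
        using q.Icarr surj by blast
      then show "b \<in> h ` Spec_map R h q" using b by (auto simp: Spec_map_def)
    qed
  qed (auto simp: Spec_map_def)
qed

text \<open>A prime that contains the kernel is a union of fibres of \<open>h\<close>, so membership in it can be tested after
  applying \<open>h\<close>.\<close>

lemma prime_image_of_surjective_hom:
  assumes "cring R" "cring S" "h \<in> ring_hom R S" "h ` carrier R = carrier S"
    and p: "p \<in> Spec R" and ker: "\<And>a. a \<in> carrier R \<Longrightarrow> h a = \<zero>\<^bsub>S\<^esub> \<Longrightarrow> a \<in> p"
  shows "h ` p \<in> Spec S" and "Spec_map R h (h ` p) = p"
proof -
  interpret R: cring R by fact
  interpret S: cring S by fact
  interpret h: ring_hom_ring R S h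
    by (rule ring_hom_ringI2) (use assms R.ring_axioms S.ring_axioms in auto)
  interpret P: primeideal p R using p by (simp add: Spec_def)
  have preimage: "a \<in> p" if "a \<in> carrier R" "h a \<in> h ` p" for a
  proof -
    from that obtain b where b: "b \<in> p" "h a = h b" by blast
    then have bc: "b \<in> carrier R" using P.Icarr by blast
    have "h (a \<ominus>\<^bsub>R\<^esub> b) = \<zero>\<^bsub>S\<^esub>"
      using that b bc by (simp add: R.minus_eq S.r_neg)
    then have "a \<ominus>\<^bsub>R\<^esub> b \<in> p" using ker that bc by simp
    then have "(a \<ominus>\<^bsub>R\<^esub> b) \<oplus>\<^bsub>R\<^esub> b \<in> p" using b P.a_closed by blast
    moreover have "(a \<ominus>\<^bsub>R\<^esub> b) \<oplus>\<^bsub>R\<^esub> b = a" using that bc by (simp add: R.minus_eq R.a_assoc R.l_neg)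
    ultimately show ?thesis by simp
  qed
  show "Spec_map R h (h ` p) = p"
    using preimage P.Icarr by (auto simp: Spec_map_def)
  have "ideal (h ` p) S"
  proof (rule idealI[OF S.ring_axioms])
    show "subgroup (h ` p) (add_monoid S)"
    proof (rule S.add.subgroupI)
      show "h ` p \<subseteq> carrier S" using P.Icarr by auto
      show "h ` p \<noteq> {}" using P.zero_closed by blast
    next
      fix a assume "a \<in> h ` p"
      then obtain b where b: "b \<in> p" "a = h b" by blast
      then have "\<ominus>\<^bsub>S\<^esub> a = h (\<ominus>\<^bsub>R\<^esub> b)" using P.Icarr by simp
      then show "\<ominus>\<^bsub>S\<^esub> a \<in> h ` p" using b P.a_inv_closed by blast
    next
      fix a a' assume "a \<in> h ` p" "a' \<in> h ` p"
      then obtain b b' where b: "b \<in> p" "a = h b" "b' \<in> p" "a' = h b'" by blast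
      then have "a \<oplus>\<^bsub>S\<^esub> a' = h (b \<oplus>\<^bsub>R\<^esub> b')" using P.Icarr by simp
      then show "a \<oplus>\<^bsub>S\<^esub> a' \<in> h ` p" using b P.a_closed by blast
    qed
    fix a c assume "a \<in> h ` p" and c: "c \<in> carrier S"
    then obtain b where b: "b \<in> p" "a = h b" by blast
    obtain d where d: "d \<in> carrier R" "c = h d" using c assms(4) by blast
    have "c \<otimes>\<^bsub>S\<^esub> a = h (d \<otimes>\<^bsub>R\<^esub> b)" "a \<otimes>\<^bsub>S\<^esub> c = h (b \<otimes>\<^bsub>R\<^esub> d)"
      using b d P.Icarr by simp_all
    then show "c \<otimes>\<^bsub>S\<^esub> a \<in> h ` p" "a \<otimes>\<^bsub>S\<^esub> c \<in> h ` p"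
      using b d P.I_l_closed P.I_r_closed by blast+
  qed
  then have "primeideal (h ` p) S"
  proof (rule primeidealI[OF _ assms(2)])
    have "\<one>\<^bsub>S\<^esub> \<notin> h ` p" using preimage[of "\<one>\<^bsub>R\<^esub>"] Spec_one_notin[OF p] by auto
    then show "carrier S \<noteq> h ` p" by auto
    fix a b assume "a \<in> carrier S" "b \<in> carrier S" and ab: "a \<otimes>\<^bsub>S\<^esub> b \<in> h ` p"
    then obtain a' b' where "a' \<in> carrier R" "b' \<in> carrier R" "a = h a'" "b = h b'"
      using assms(4) by (metis imageE)
    then show "a \<in> h ` p \<or> b \<in> h ` p"
      using preimage[of "a' \<otimes>\<^bsub>R\<^esub> b'"] ab P.I_prime[of a' b'] by auto
  qed
  then show "h ` p \<in> Spec S" by (simp add: Spec_def)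
qed

text \<open>A surjective homomorphism \<open>h\<close> identifies \<open>Spec S\<close> with the primes of \<open>R\<close> containing the kernel,
  and the closed set of the primes containing \<open>E\<close> with those containing the preimage of \<open>E\<close> as well.\<close>

lemma surjective_hom_closed_embedding:
  assumes R: "cring R" and S: "cring S" and h: "h \<in> ring_hom R S" and surj: "h ` carrier R = carrier S"
  shows "closed_embedding_of_spectra R S h"
proof -
  interpret R: cring R by fact
  interpret S: cring S by fact
  have cont: "continuous_map (zariski S) (zariski R) (Spec_map R h)"
    unfolding continuous_map_closedin topspace_zariski[OF R] topspace_zariski[OF S]
  proof (intro conjI allI impI Pi_I)
    show "q \<in> Spec S \<Longrightarrow> Spec_map R h q \<in> Spec R" for q
      by (rule Spec_map_in_Spec[OF R S h])
    fix C assume "closedin (zariski R) C"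
    then obtain E where E: "E \<subseteq> carrier R" "C = {q \<in> Spec R. E \<subseteq> q}"
      unfolding closedin_zariski[OF R] by blast
    have "{q \<in> Spec S. Spec_map R h q \<in> C} = {q \<in> Spec S. h ` E \<subseteq> q}"
      using E Spec_map_in_Spec[OF R S h] by (auto simp: Spec_map_def)
    moreover have "h ` E \<subseteq> carrier S" using E surj by blast
    ultimately show "closedin (zariski S) {q \<in> Spec S. Spec_map R h q \<in> C}"
      unfolding closedin_zariski[OF S] by blast
  qed
  have closed: "closed_map (zariski S) (zariski R) (Spec_map R h)"
    unfolding closed_map_def
  proof (intro allI impI)
    fix C assume "closedin (zariski S) C"
    then obtain E where E: "E \<subseteq> carrier S" "C = {q \<in> Spec S. E \<subseteq> q}"
      unfolding closedin_zariski[OF S] by blast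
    let ?F = "{a \<in> carrier R. h a \<in> insert \<zero>\<^bsub>S\<^esub> E}"
    have "Spec_map R h ` C = {p \<in> Spec R. ?F \<subseteq> p}"
    proof (intro equalityI subsetI)
      fix p assume "p \<in> Spec_map R h ` C"
      then obtain q where q: "q \<in> Spec S" "E \<subseteq> q" "p = Spec_map R h q" using E by blast
      interpret q: primeideal q S using q by (simp add: Spec_def)
      have "\<zero>\<^bsub>S\<^esub> \<in> q" by (rule q.zero_closed)
      then have "?F \<subseteq> p" using q by (auto simp: Spec_map_def)
      then show "p \<in> {p \<in> Spec R. ?F \<subseteq> p}" using Spec_map_in_Spec[OF R S h] q by auto
    next
      fix p assume "p \<in> {p \<in> Spec R. ?F \<subseteq> p}"
      then have p: "p \<in> Spec R" "?F \<subseteq> p" by auto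
      have *: "a \<in> carrier R \<Longrightarrow> h a = \<zero>\<^bsub>S\<^esub> \<Longrightarrow> a \<in> p" for a using p by auto
      have "E \<subseteq> h ` p"
      proof
        fix e assume e: "e \<in> E"
        then obtain a where "a \<in> carrier R" "e = h a" using E surj by blast
        then show "e \<in> h ` p" using p e by blast
      qed
      then show "p \<in> Spec_map R h ` C"
        using prime_image_of_surjective_hom[OF R S h surj p(1) *] E by (intro image_eqI[of _ _ "h ` p"]) auto
    qed
    then show "closedin (zariski R) (Spec_map R h ` C)"
      unfolding closedin_zariski[OF R] by (intro exI[of _ ?F]) auto
  qed
  have "embedding_map (zariski S) (zariski R) (Spec_map R h)"
    using injective_closed_imp_embedding_map[OF cont closed] inj_on_Spec_map[OF surj] topspace_zariski[OF S]
    by simp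
  with closed h surj show ?thesis by (simp add: closed_embedding_of_spectra_def)
qed

section \<open>The affine chart of projective space\<close>

lemma affine_chart_in_projective_space:
  "(\<And>v. v \<notin> V \<Longrightarrow> z v = 0) \<Longrightarrow> affine_chart z \<in> projective_space V"
  unfolding affine_chart_def projective_space_def
  by (intro imageI CollectI conjI exI[of _ None]) auto

text \<open>The homogeneous coordinate \<open>None\<close> is 1 in the chart, which fixes the scaling factor.\<close>

lemma inj_affine_chart: "inj affine_chart"
proof (rule injI)
  fix z w assume eq: "affine_chart z = affine_chart w"
  have "case_option 1 z \<in> affine_chart z"
    unfolding affine_chart_def projective_point_def by (intro CollectI exI[of _ 1]) auto
  then obtain c where c: "case_option 1 z = (\<lambda>k. c * case_option 1 w k)"
    unfolding eq by (auto simp: affine_chart_def projective_point_def)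
  have "c = 1" using fun_cong[OF c, of None] by simp
  then show "z = w" using fun_cong[OF c, of "Some _"] by (auto simp: fun_eq_iff)
qed

lemma card_product_vars: "card (product_vars m) = 2 * (m - 1)"
proof -
  have "card (product_vars m) = card (Vxi ` {2..m}) + card (Vy ` {2..m})"
    unfolding product_vars_def by (rule card_Un_disjoint) auto
  also have "\<dots> = 2 * (m - 1)"
    by (subst (1 2) card_image) (auto simp: inj_on_def)
  finally show ?thesis .
qed

section \<open>Local behaviour of holomorphic functions of one variable\<close>

text \<open>Write \<open>f - f c = k ^ e\<close> with \<open>k\<close> a local coordinate; then the preimages of \<open>a\<close> near \<open>c\<close> are the
  points where \<open>k\<close> takes one of the \<open>e\<close>-th roots of \<open>a - f c\<close>.\<close>

lemma local_preimages:
  fixes f :: "complex \<Rightarrow> complex"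
  assumes hol: "f holomorphic_on S" and S: "open S" "c \<in> S"
    and F: "(\<lambda>w. f (c + w) - f c) has_laurent_expansion F" "F \<noteq> 0" and e: "fls_subdegree F = int e"
  shows "\<exists>d>0. \<forall>a. a \<noteq> f c \<and> dist a (f c) < d \<longrightarrow>
    (\<exists>T\<subseteq>S. finite T \<and> card T = e \<and> (\<forall>w\<in>T. f w = a))"
proof (cases "e = 0")
  case True
  then show ?thesis by (intro exI[of _ 1]) (auto intro!: exI[of _ "{}"])
next
  case False
  define f0 where "f0 w = f w - f c" for w
  have hol0: "f0 holomorphic_on S" unfolding f0_def by (intro holomorphic_intros hol)
  have Fr: "\<exists>\<^sub>F w in at c. f0 w \<noteq> 0"
    using has_laurent_expansion_eventually_zero_iff[of f0 c F] F by (auto simp: f0_def frequently_def)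
  have order: "zorder f0 c = int e"
    using has_laurent_expansion_zorder[of f0 c F] F e by (simp add: f0_def)
  obtain r where r: "r > 0" "ball c r \<subseteq> S" using S openE by blast
  define g where "g = zor_poly f0 c"
  obtain r' where r': "r' > 0" "cball c r' \<subseteq> S" "g holomorphic_on cball c r'"
    "\<And>w. w \<in> cball c r' \<Longrightarrow> f0 w = g w * (w - c) ^ e \<and> g w \<noteq> 0"
  proof -
    have "\<exists>w\<in>ball c r. f0 w \<noteq> 0"
    proof -
      have "eventually (\<lambda>w. w \<in> ball c r) (at c)" using r by (intro eventually_at_in_open') auto
      then show ?thesis using Fr frequently_eventually_conj by (smt (verit) frequently_ex)
    qed
    then have "\<exists>r'>0. cball c r' \<subseteq> ball c r \<and> g holomorphic_on cball c r' \<and>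
        (\<forall>w\<in>cball c r'. f0 w = g w * (w - c) ^ nat (zorder f0 c) \<and> g w \<noteq> 0)"
      using zorder_exist_zero[of f0 "ball c r" c] hol0 r g_def
      by (metis (no_types, lifting) centre_in_ball connected_ball holomorphic_on_subset open_ball)
    then show ?thesis using that r order by auto
  qed
  obtain l where l: "l holomorphic_on ball c r'" "\<And>w. w \<in> ball c r' \<Longrightarrow> exp (l w) = g w"
    by (rule holomorphic_logarithm_exists[of "ball c r'" g c])
       (use r' in \<open>auto intro: holomorphic_on_subset\<close>)
  define k where "k w = (w - c) * exp (l w / of_nat e)" for w
  have kpow: "k w ^ e = f0 w" if "w \<in> ball c r'" for w
  proof -
    have "k w ^ e = (w - c) ^ e * exp (of_nat e * (l w / of_nat e))"
      by (simp add: k_def power_mult_distrib flip: exp_of_nat_mult)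
    also have "of_nat e * (l w / of_nat e) = l w" using False by simp
    also have "(w - c) ^ e * exp (l w) = f0 w" using l(2)[OF that] r'(4)[of w] that by simp
    finally show ?thesis .
  qed
  have kholo: "k holomorphic_on ball c r'"
    unfolding k_def using l(1) False by (intro holomorphic_intros) auto
  have "deriv k c = exp (l c / of_nat e)"
  proof (rule DERIV_imp_deriv)
    obtain l' where "(l has_field_derivative l') (at c)"
      using l(1) r'(1) holomorphic_derivI[of l "ball c r'" c] by auto
    then show "(k has_field_derivative exp (l c / of_nat e)) (at c)"
      unfolding k_def using False by (auto intro!: derivative_eq_intros)
  qed
  then have "deriv k c \<noteq> 0" by simp
  then obtain \<rho> where \<rho>: "\<rho> > 0" "ball c \<rho> \<subseteq> ball c r'" "open (k ` ball c \<rho>)" "inj_on k (ball c \<rho>)"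
    using has_complex_derivative_locally_invertible[OF kholo, of c] r'(1) by auto
  have "0 \<in> k ` ball c \<rho>" using \<rho>(1) by (intro image_eqI[of _ _ c]) (auto simp: k_def)
  then obtain \<epsilon> where \<epsilon>: "\<epsilon> > 0" "ball 0 \<epsilon> \<subseteq> k ` ball c \<rho>" using \<rho>(3) openE by blast
  show ?thesis
  proof (intro exI[of _ "\<epsilon> ^ e"] conjI allI impI)
    show "\<epsilon> ^ e > 0" using \<epsilon> by simp
    fix a assume a: "a \<noteq> f c \<and> dist a (f c) < \<epsilon> ^ e"
    let ?Z = "{\<zeta>. \<zeta> ^ e = a - f c}"
    have Z: "card ?Z = e" using a False by (intro card_nth_roots) auto
    have "?Z \<subseteq> k ` ball c \<rho>"
    proof
      fix \<zeta> assume "\<zeta> \<in> ?Z"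
      then have "norm \<zeta> ^ e = dist a (f c)" by (auto simp: dist_norm simp flip: norm_power)
      then have "norm \<zeta> < \<epsilon>" using a \<epsilon> power_less_imp_less_base[of "norm \<zeta>" e \<epsilon>] by auto
      then show "\<zeta> \<in> k ` ball c \<rho>" using \<epsilon> by auto
    qed
    then obtain T where T: "T \<subseteq> ball c \<rho>" "?Z = k ` T"
      by (meson subset_imageE)
    have "inj_on k T" using \<rho>(4) T(1) inj_on_subset by blast
    then have "card T = e" using Z card_image[of k T] T(2) by simp
    moreover from this have "finite T" using False card.infinite by force
    moreover have "T \<subseteq> S" using T \<rho>(2) r' by force
    moreover have "f w = a" if "w \<in> T" for w
    proof -
      have "k w ^ e = a - f c" using T(2) that by blast
      moreover have "w \<in> ball c r'" using T \<rho>(2) that by blast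
      ultimately show ?thesis using kpow by (simp add: f0_def)
    qed
    ultimately show "\<exists>T\<subseteq>S. finite T \<and> card T = e \<and> (\<forall>w\<in>T. f w = a)" by blast
  qed
qed

lemma finite_set_disjoint_nbhds:
  fixes F :: "'a::t2_space set"
  assumes "finite F"
  shows "\<exists>W. (\<forall>P\<in>F. open (W P) \<and> P \<in> W P) \<and> (\<forall>P\<in>F. \<forall>Q\<in>F. P \<noteq> Q \<longrightarrow> W P \<inter> W Q = {})"
proof -
  define sep where "sep P Q A \<longleftrightarrow> open (fst A) \<and> open (snd A) \<and> P \<in> fst A \<and> Q \<in> snd A \<and> fst A \<inter> snd A = {}"
    for P Q :: 'a and A
  define U where "U P Q = fst (SOME A. sep P Q A)" for P Q
  define V where "V P Q = snd (SOME A. sep P Q A)" for P Q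
  have UV: "open (U P Q) \<and> open (V P Q) \<and> P \<in> U P Q \<and> Q \<in> V P Q \<and> U P Q \<inter> V P Q = {}" if "P \<noteq> Q" for P Q
  proof -
    from hausdorff[OF that] obtain U' V' where "sep P Q (U', V')" unfolding sep_def by auto
    then have "sep P Q (SOME A. sep P Q A)" by (rule someI)
    then show ?thesis by (simp add: sep_def U_def V_def)
  qed
  define W where "W P = (\<Inter>Q\<in>F - {P}. U P Q \<inter> V Q P)" for P
  show ?thesis
  proof (intro exI[of _ W] conjI ballI impI)
    fix P assume "P \<in> F"
    show "open (W P)" unfolding W_def
    proof (rule open_INT)
      show "\<forall>Q\<in>F - {P}. open (U P Q \<inter> V Q P)" using UV by (metis DiffE open_Int singletonI)
    qed (use assms in simp)
    have "P \<in> U P Q \<inter> V Q P" if "Q \<in> F - {P}" for Q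
      using UV[of P Q] UV[of Q P] that by auto
    then show "P \<in> W P" unfolding W_def by blast
    fix Q assume "Q \<in> F" "P \<noteq> Q"
    then have "W P \<subseteq> U P Q" "W Q \<subseteq> V P Q" using \<open>P \<in> F\<close> by (auto simp: W_def)
    then show "W P \<inter> W Q = {}" using UV[OF \<open>P \<noteq> Q\<close>] by blast
  qed
qed

text \<open>Fewer homogeneous linear equations than unknowns, by Gaussian elimination of one unknown at a time.\<close>

lemma nontrivial_solution:
  fixes M :: "'e \<Rightarrow> 'i \<Rightarrow> 'k::field"
  assumes "finite E" "finite I" "card E < card I"
  shows "\<exists>c. (\<exists>i\<in>I. c i \<noteq> 0) \<and> (\<forall>e\<in>E. (\<Sum>i\<in>I. c i * M e i) = 0)"
  using assms
proof (induction E arbitrary: I M rule: finite_induct)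
  case empty
  then have "I \<noteq> {}" by auto
  then show ?case by (intro exI[of _ "\<lambda>_. 1"]) auto
next
  case (insert e E)
  show ?case
  proof (cases "\<forall>i\<in>I. M e i = 0")
    case True
    obtain c where "\<exists>i\<in>I. c i \<noteq> 0" "\<forall>e\<in>E. (\<Sum>i\<in>I. c i * M e i) = 0"
      using insert.IH[of I M] insert.prems insert.hyps by auto
    with True show ?thesis by (intro exI[of _ c]) auto
  next
    case False
    then obtain j where j: "j \<in> I" "M e j \<noteq> 0" by blast
    define J where "J = I - {j}"
    define N where "N e' i = M e' i - M e' j * M e i / M e j" for e' i
    have I: "I = insert j J" "j \<notin> J" "finite J" using j insert.prems by (auto simp: J_def)
    have "card E < card J" using I insert by auto
    then obtain c where c: "\<exists>i\<in>J. c i \<noteq> 0" "\<forall>e\<in>E. (\<Sum>i\<in>J. c i * N e i) = 0"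
      using insert.IH[of J N] I by auto
    \<comment> \<open>the equation \<open>e\<close> determines the coefficient of \<open>j\<close> from the others\<close>
    define d where "d = - (\<Sum>i\<in>J. c i * M e i) / M e j"
    define c' where "c' = c(j := d)"
    have sum: "(\<Sum>i\<in>I. c' i * M e' i) = d * M e' j + (\<Sum>i\<in>J. c i * M e' i)" for e'
    proof -
      have "(\<Sum>i\<in>J. c' i * M e' i) = (\<Sum>i\<in>J. c i * M e' i)"
        using I by (intro sum.cong) (auto simp: c'_def)
      then show ?thesis using I by (simp add: c'_def)
    qed
    have "(\<Sum>i\<in>I. c' i * M e' i) = 0" if "e' \<in> insert e E" for e'
    proof (cases "e' = e")
      case True
      then show ?thesis using j by (simp add: sum d_def)
    next
      case False
      then have "0 = (\<Sum>i\<in>J. c i * N e' i)" using c that by auto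
      also have "\<dots> = (\<Sum>i\<in>J. c i * M e' i) + d * M e' j"
        by (simp add: N_def d_def right_diff_distrib sum_subtractf sum_distrib_left sum_distrib_right
            sum_divide_distrib algebra_simps)
      finally show ?thesis by (simp add: sum add.commute)
    qed
    moreover have "\<exists>i\<in>I. c' i \<noteq> 0" using c I by (auto simp: c'_def)
    ultimately show ?thesis by blast
  qed
qed

section \<open>Functions on a pointed compact Riemann surface\<close>

locale pointed_riemann_surface =
  fixes atl :: "('a::t2_space set \<times> ('a \<Rightarrow> complex)) set" and infty :: 'a
  assumes surface: "compact_riemann_surface atl"
begin

lemma chartD:
  assumes "(U, z) \<in> atl"
  shows "open U" "open (z ` U)" "homeomorphism U (z ` U) z (inv_into U z)"
  using surface assms by (auto simp: compact_riemann_surface_def)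

lemma chart_inj:
  assumes "(U, z) \<in> atl"
  shows "inj_on z U"
  by (metis chartD(3)[OF assms] homeomorphism_apply1 inj_on_inverseI)

lemma chart_inverse [simp]: "(U, z) \<in> atl \<Longrightarrow> P \<in> U \<Longrightarrow> inv_into U z (z P) = P"
  using chart_inj inv_into_f_f by metis

lemma chart_exists: "\<exists>U z. (U, z) \<in> atl \<and> P \<in> U"
proof -
  have "P \<in> (\<Union>(U, z)\<in>atl. U)" using surface by (simp add: compact_riemann_surface_def)
  then show ?thesis by auto
qed

lemma transition_holomorphic:
  "(U, z) \<in> atl \<Longrightarrow> (V, w) \<in> atl \<Longrightarrow> (w \<circ> inv_into U z) holomorphic_on (z ` (U \<inter> V))"
  using surface by (fastforce simp: compact_riemann_surface_def)

lemma open_chart_image: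
  assumes "(U, z) \<in> atl" "open V"
  shows "open (z ` (U \<inter> V))"
proof -
  have "z ` (U \<inter> V) = z ` U \<inter> inv_into U z -` V"
    using assms by auto
  moreover have "open (z ` U \<inter> inv_into U z -` V)"
    using chartD[OF assms(1)] assms(2)
    by (intro continuous_open_preimage) (auto dest: homeomorphism_cont2)
  ultimately show ?thesis by simp
qed

lemma open_chart_punctured:
  assumes "(U, z) \<in> atl"
  shows "open (z ` (U - {infty}))"
proof -
  have "open (- {infty})" by (rule open_Compl) simp
  from open_chart_image[OF assms this] show ?thesis by (simp only: Diff_eq)
qed

lemma open_chart_preimage:
  assumes "(U, z) \<in> atl" "open S"
  shows "open (U \<inter> z -` S)"
  using chartD[OF assms(1)] assms(2) by (intro continuous_open_preimage) (auto dest: homeomorphism_cont1)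

text \<open>Charts are homeomorphisms, so limits on the surface are limits in any chart. This is how statements
  made in one chart are carried over to another.\<close>

lemma filtermap_chart:
  assumes c: "(U, z) \<in> atl" and P: "P \<in> U"
  shows "filtermap (inv_into U z) (at (z P)) = at P"
proof (rule filter_eqI)
  fix Q
  show "eventually Q (filtermap (inv_into U z) (at (z P))) \<longleftrightarrow> eventually Q (at P)"
  proof
    assume "eventually Q (filtermap (inv_into U z) (at (z P)))"
    then obtain S where S: "open S" "z P \<in> S" "\<And>w. w \<in> S \<Longrightarrow> w \<noteq> z P \<Longrightarrow> Q (inv_into U z w)"
      by (auto simp: eventually_filtermap eventually_at_topological)
    have "Q R" if "R \<in> U \<inter> z -` S" "R \<noteq> P" for R
    proof -
      have "z R \<noteq> z P" using that P chart_inj[OF c] by (meson IntD1 inj_onD)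
      then have "Q (inv_into U z (z R))" using that S(3) by auto
      then show ?thesis using c that by simp
    qed
    then show "eventually Q (at P)"
      unfolding eventually_at_topological using open_chart_preimage[OF c S(1)] S(2) P by blast
  next
    assume "eventually Q (at P)"
    then obtain V where V: "open V" "P \<in> V" "\<And>R. R \<in> V \<Longrightarrow> R \<noteq> P \<Longrightarrow> Q R"
      by (auto simp: eventually_at_topological)
    have "Q (inv_into U z w)" if w: "w \<in> z ` (U \<inter> V)" "w \<noteq> z P" for w
    proof -
      obtain R where "R \<in> U" "R \<in> V" "w = z R" using w by auto
      then show ?thesis using V(3)[of R] w c by auto
    qed
    moreover have "z P \<in> z ` (U \<inter> V)" using V P by auto
    ultimately have "eventually (\<lambda>w. Q (inv_into U z w)) (at (z P))"
      unfolding eventually_at_topological using open_chart_image[OF c V(1)] by blast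
    then show "eventually Q (filtermap (inv_into U z) (at (z P)))"
      by (simp add: eventually_filtermap)
  qed
qed

lemma filterlim_chart:
  assumes "(U, z) \<in> atl" "P \<in> U"
  shows "filterlim (g \<circ> inv_into U z) F (at (z P)) \<longleftrightarrow> filterlim g F (at P)"
  using filtermap_chart[OF assms] by (simp add: filterlim_def filtermap_compose comp_def flip: filtermap_filtermap)

lemma eventually_chart:
  assumes "(U, z) \<in> atl" "P \<in> U"
  shows "eventually (\<lambda>w. Q (inv_into U z w)) (at (z P)) \<longleftrightarrow> eventually Q (at P)"
  using filtermap_chart[OF assms] by (simp flip: eventually_filtermap)

lemma at_neq_bot: "at P \<noteq> (bot :: 'a filter)"
proof -
  obtain U z where "(U, z) \<in> atl" "P \<in> U" using chart_exists by blast
  then have "filtermap (inv_into U z) (at (z P)) = at P" by (rule filtermap_chart)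
  then show ?thesis by (metis filtermap_bot_iff at_neq_bot)
qed

abbreviation RX where "RX \<equiv> meromorphic_fns atl infty"

lemma mem_RX_chart:
  assumes g: "g \<in> RX" and c: "(U, z) \<in> atl"
  shows "(g \<circ> inv_into U z) holomorphic_on (z ` (U - {infty}))"
    and "P \<in> U \<Longrightarrow> (g \<circ> inv_into U z) meromorphic_on {z P}"
proof -
  show hol: "(g \<circ> inv_into U z) holomorphic_on (z ` (U - {infty}))"
    using g c by (fastforce simp: meromorphic_fns_def)
  assume P: "P \<in> U"
  show "(g \<circ> inv_into U z) meromorphic_on {z P}"
  proof (cases "P = infty")
    case True
    then show ?thesis using g c P by (fastforce simp: meromorphic_fns_def)
  next
    case False
    have "(g \<circ> inv_into U z) analytic_on (z ` (U - {infty}))"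
      using hol analytic_on_open[OF open_chart_punctured[OF c]] by blast
    then have "(g \<circ> inv_into U z) analytic_on {z P}"
      by (rule analytic_on_subset) (use P False in auto)
    then show ?thesis by (rule analytic_on_imp_meromorphic_on)
  qed
qed

lemma RX_infty: "g \<in> RX \<Longrightarrow> g infty = 0"
  by (simp add: meromorphic_fns_def)

lemma RX_I:
  assumes "g infty = 0"
    "\<And>U z. (U, z) \<in> atl \<Longrightarrow> (g \<circ> inv_into U z) holomorphic_on (z ` (U - {infty}))"
    "\<And>U z. (U, z) \<in> atl \<Longrightarrow> infty \<in> U \<Longrightarrow> (g \<circ> inv_into U z) meromorphic_on {z infty}"
  shows "g \<in> RX"
  using assms unfolding meromorphic_fns_def by blast

lemma RX_add: 
  assumes "g \<in> RX" "h \<in> RX"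
  shows "(\<lambda>P. g P + h P) \<in> RX"
proof (rule RX_I)
  fix U z assume c: "(U, z) \<in> atl"
  have eq: "(\<lambda>P. g P + h P) \<circ> inv_into U z = (\<lambda>w. (g \<circ> inv_into U z) w + (h \<circ> inv_into U z) w)" by auto
  show "((\<lambda>P. g P + h P) \<circ> inv_into U z) holomorphic_on (z ` (U - {infty}))"
    unfolding eq by (intro holomorphic_intros mem_RX_chart assms c)
  show "infty \<in> U \<Longrightarrow> ((\<lambda>P. g P + h P) \<circ> inv_into U z) meromorphic_on {z infty}"
    unfolding eq by (intro meromorphic_intros mem_RX_chart assms c)
qed (simp add: RX_infty[OF assms(1)] RX_infty[OF assms(2)])

lemma RX_mult: 
  assumes "g \<in> RX" "h \<in> RX"
  shows "(\<lambda>P. g P * h P) \<in> RX"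
proof (rule RX_I)
  fix U z assume c: "(U, z) \<in> atl"
  have eq: "(\<lambda>P. g P * h P) \<circ> inv_into U z = (\<lambda>w. (g \<circ> inv_into U z) w * (h \<circ> inv_into U z) w)" by auto
  show "((\<lambda>P. g P * h P) \<circ> inv_into U z) holomorphic_on (z ` (U - {infty}))"
    unfolding eq by (intro holomorphic_intros mem_RX_chart assms c)
  show "infty \<in> U \<Longrightarrow> ((\<lambda>P. g P * h P) \<circ> inv_into U z) meromorphic_on {z infty}"
    unfolding eq by (intro meromorphic_intros mem_RX_chart assms c)
qed (simp add: RX_infty[OF assms(1)] RX_infty[OF assms(2)])

text \<open>The constants of \<open>R_X\<close>: like all elements of that ring they have the dummy value 0 at the base point.\<close>

definition cst :: "complex \<Rightarrow> 'a \<Rightarrow> complex" where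
  "cst c = (\<lambda>P. if P = infty then 0 else c)"

lemma eventually_cst: "eventually (\<lambda>Q. cst c Q = c) (at P)"
proof (cases "P = infty")
  case True
  then show ?thesis by (auto simp: cst_def eventually_at_filter)
next
  case False
  have "eventually (\<lambda>Q. Q \<in> - {infty}) (at P)"
    using False by (intro eventually_at_in_open') auto
  then show ?thesis by (rule eventually_mono) (auto simp: cst_def)
qed

lemma RX_cst: "cst c' \<in> RX"
proof (rule RX_I)
  fix U z assume c: "(U, z) \<in> atl"
  have "(cst c' \<circ> inv_into U z) holomorphic_on z ` (U - {infty}) \<longleftrightarrow> (\<lambda>_. c') holomorphic_on z ` (U - {infty})"
    by (intro holomorphic_cong) (auto simp: cst_def c)
  then show "(cst c' \<circ> inv_into U z) holomorphic_on z ` (U - {infty})" by simp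
  assume "infty \<in> U"
  then have "eventually (\<lambda>w. cst c' (inv_into U z w) = c') (at (z infty))"
    using eventually_chart[OF c, of infty "\<lambda>Q. cst c' Q = c'"] eventually_cst[of c' infty] by simp
  then have "(cst c' \<circ> inv_into U z) meromorphic_on {z infty} \<longleftrightarrow> (\<lambda>_. c') meromorphic_on {z infty}"
    by (intro meromorphic_on_cong) (auto simp: comp_def)
  then show "(cst c' \<circ> inv_into U z) meromorphic_on {z infty}" by auto
qed (simp add: cst_def)

lemma RX_scale: 
  assumes "g \<in> RX"
  shows "(\<lambda>P. c * g P) \<in> RX"
proof -
  have "(\<lambda>P. c * g P) = (\<lambda>P. cst c P * g P)" using RX_infty[OF assms] by (auto simp: cst_def)
  then show ?thesis using RX_mult[OF RX_cst assms] by simp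
qed

lemma RX_diff:
  assumes "g \<in> RX" "h \<in> RX"
  shows "(\<lambda>P. g P - h P) \<in> RX"
  using RX_add[OF assms(1) RX_scale[OF assms(2), of "- 1"]] by simp

lemma RX_zero: "(\<lambda>P. 0) \<in> RX"
  using RX_cst[of 0] by (simp add: cst_def if_distrib cong: if_cong)

lemma RX_sum:
  assumes "\<And>i. i \<in> I \<Longrightarrow> g i \<in> RX"
  shows "(\<lambda>P. \<Sum>i\<in>I. g i P) \<in> RX"
  using assms by (induction I rule: infinite_finite_induct) (auto simp: RX_zero RX_add)

lemma cring_curve_ring: "cring (curve_ring atl infty)"
proof (rule cringI)
  show "abelian_group (curve_ring atl infty)"
  proof (rule abelian_groupI; simp add: curve_ring_def RX_add RX_zero algebra_simps)
    fix g assume "g \<in> RX"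
    then have "(\<lambda>P. - g P) \<in> RX" using RX_scale[of g "- 1"] by simp
    then show "\<exists>h\<in>RX. (\<lambda>P. g P + h P) = (\<lambda>P. 0)" by (intro bexI) auto
  qed
  show "Group.comm_monoid (curve_ring atl infty)"
    by (intro comm_monoidI)
       (auto simp: curve_ring_def RX_mult RX_cst[of 1, unfolded cst_def] algebra_simps fun_eq_iff dest: RX_infty)
qed (simp add: curve_ring_def algebra_simps)

section \<open>Laurent germs\<close>

text \<open>Pole orders do not depend on the chart, but the coefficients of an expansion do; so one chart is
  chosen at each point.\<close>

definition nbhd :: "'a \<Rightarrow> 'a set" where
  "nbhd P = fst (SOME c. c \<in> atl \<and> P \<in> fst c)"

definition coord :: "'a \<Rightarrow> 'a \<Rightarrow> complex" where
  "coord P = snd (SOME c. c \<in> atl \<and> P \<in> fst c)"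

lemma chosen_chart: "(nbhd P, coord P) \<in> atl" "P \<in> nbhd P"
proof -
  obtain U z where "(U, z) \<in> atl" "P \<in> U" using chart_exists by blast
  then have "\<exists>c. c \<in> atl \<and> P \<in> fst c" by (intro exI[of _ "(U, z)"]) auto
  then have "(SOME c. c \<in> atl \<and> P \<in> fst c) \<in> atl \<and> P \<in> fst (SOME c. c \<in> atl \<and> P \<in> fst c)"
    by (rule someI_ex)
  then show "(nbhd P, coord P) \<in> atl" "P \<in> nbhd P" by (simp_all add: nbhd_def coord_def)
qed

definition local_form :: "'a \<Rightarrow> ('a \<Rightarrow> complex) \<Rightarrow> complex \<Rightarrow> complex" where
  "local_form P g = g \<circ> inv_into (nbhd P) (coord P)"

definition germ :: "'a \<Rightarrow> ('a \<Rightarrow> complex) \<Rightarrow> complex fls" where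
  "germ P g = laurent_expansion (local_form P g) (coord P P)"

lemma germ_expansion:
  assumes "g \<in> RX"
  shows "(\<lambda>w. local_form P g (coord P P + w)) has_laurent_expansion germ P g"
  unfolding germ_def local_form_def
  by (rule meromorphic_on_imp_has_laurent_expansion[OF mem_RX_chart(2)[OF assms chosen_chart]]) simp

lemma germ_eqI: "(\<lambda>w. local_form P g (coord P P + w)) has_laurent_expansion F \<Longrightarrow> germ P g = F"
  unfolding germ_def by (rule laurent_expansion_eqI)

lemma germ_cong:
  assumes "eventually (\<lambda>Q. g Q = h Q) (at P)" "h \<in> RX"
  shows "germ P g = germ P h"
proof -
  have "eventually (\<lambda>w. local_form P g w = local_form P h w) (at (coord P P))"
    using eventually_chart[OF chosen_chart, of "\<lambda>Q. g Q = h Q" P] assms(1) by (simp add: local_form_def)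
  then show ?thesis unfolding germ_def by (intro laurent_expansion_cong) auto
qed

lemma germ_add: "g \<in> RX \<Longrightarrow> h \<in> RX \<Longrightarrow> germ P (\<lambda>Q. g Q + h Q) = germ P g + germ P h"
  using has_laurent_expansion_add[OF germ_expansion germ_expansion, of g h P P]
  by (intro germ_eqI) (simp add: local_form_def)

lemma germ_mult: "g \<in> RX \<Longrightarrow> h \<in> RX \<Longrightarrow> germ P (\<lambda>Q. g Q * h Q) = germ P g * germ P h"
  using has_laurent_expansion_mult[OF germ_expansion germ_expansion, of g h P P]
  by (intro germ_eqI) (simp add: local_form_def)

lemma germ_scale: "g \<in> RX \<Longrightarrow> germ P (\<lambda>Q. c * g Q) = fls_const c * germ P g"
  using has_laurent_expansion_cmult_left[OF germ_expansion[of g P], of c]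
  by (intro germ_eqI) (simp add: local_form_def)

lemma germ_diff: "g \<in> RX \<Longrightarrow> h \<in> RX \<Longrightarrow> germ P (\<lambda>Q. g Q - h Q) = germ P g - germ P h"
  using has_laurent_expansion_diff[OF germ_expansion germ_expansion, of g h P P]
  by (intro germ_eqI) (simp add: local_form_def)

lemma germ_cst: "germ P (cst c) = fls_const c"
proof (rule germ_eqI)
  have "eventually (\<lambda>w. local_form P (cst c) w = c) (at (coord P P))"
    using eventually_chart[OF chosen_chart, of "\<lambda>Q. cst c Q = c" P] eventually_cst
    by (simp add: local_form_def)
  then have "eventually (\<lambda>w. local_form P (cst c) (coord P P + w) = c) (at 0)"
    by (subst (asm) at_to_0) (simp add: eventually_filtermap add_ac)
  then show "(\<lambda>w. local_form P (cst c) (coord P P + w)) has_laurent_expansion fls_const c"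
    by (subst has_laurent_expansion_cong[of _ "\<lambda>_. c"]) auto
qed

lemma germ_zero: "germ P (\<lambda>Q. 0) = 0"
  using germ_cst[of P 0] by (simp add: cst_def if_distrib cong: if_cong)

lemma germ_sum: "(\<And>i. i \<in> I \<Longrightarrow> g i \<in> RX) \<Longrightarrow> germ P (\<lambda>Q. \<Sum>i\<in>I. g i Q) = (\<Sum>i\<in>I. germ P (g i))"
  by (induction I rule: infinite_finite_induct) (auto simp: germ_zero germ_add RX_sum)

lemma tendsto_germ:
  assumes "g \<in> RX" "fls_subdegree (germ P g) \<ge> 0"
  shows "(g \<longlongrightarrow> fls_nth (germ P g) 0) (at P)"
  using has_laurent_expansion_imp_tendsto[OF germ_expansion[OF assms(1)] assms(2)]
    filterlim_chart[OF chosen_chart[of P], of g] by (simp add: local_form_def comp_def)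

lemma pole_iff_germ:
  assumes "g \<in> RX"
  shows "filterlim g at_infinity (at P) \<longleftrightarrow> fls_subdegree (germ P g) < 0"
  using has_laurent_expansion_imp_is_pole_iff[OF germ_expansion[OF assms, of P]]
    filterlim_chart[OF chosen_chart[of P], of g] by (simp add: local_form_def is_pole_def comp_def)

lemma tendsto_value:
  assumes g: "g \<in> RX" and P: "P \<noteq> infty"
  shows "(g \<longlongrightarrow> g P) (at P)"
proof -
  note c = chosen_chart[of P]
  have "open (coord P ` (nbhd P - {infty}))" by (rule open_chart_punctured[OF c(1)])
  moreover have "coord P P \<in> coord P ` (nbhd P - {infty})" using P c by auto
  ultimately have "isCont (g \<circ> inv_into (nbhd P) (coord P)) (coord P P)"
    using holomorphic_on_imp_continuous_on[OF mem_RX_chart(1)[OF g c(1)]]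
      continuous_on_eq_continuous_at by blast
  then have "((g \<circ> inv_into (nbhd P) (coord P)) \<longlongrightarrow> g P) (at (coord P P))"
    using c by (simp add: isCont_def)
  then show ?thesis using filterlim_chart[OF c] by blast
qed

lemma germ_holomorphic:
  assumes g: "g \<in> RX" and P: "P \<noteq> infty"
  shows "fls_subdegree (germ P g) \<ge> 0" and "fls_nth (germ P g) 0 = g P"
proof -
  show 1: "fls_subdegree (germ P g) \<ge> 0"
    using pole_iff_germ[OF g, of P] tendsto_value[OF g P] at_neq_bot[of P]
      not_tendsto_and_filterlim_at_infinity by (metis not_less)
  show "fls_nth (germ P g) 0 = g P"
    using tendsto_unique[OF at_neq_bot tendsto_germ[OF g 1] tendsto_value[OF g P]] .
qed

section \<open>Functions without a pole are constant\<close>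

text \<open>Without a pole the function extends continuously over the base point, and then holomorphically, as the
  singularity is removable. On the compact surface the modulus attains its maximum; by the maximum modulus
  principle in the charts the set where the maximal value is taken is open, and it is closed, so it is the
  whole connected surface.\<close>

lemma no_pole_constant:
  assumes g: "g \<in> RX" and nopole: "fls_subdegree (germ infty g) \<ge> 0"
  shows "\<exists>c. g = cst c"
proof -
  define G where "G = g(infty := fls_nth (germ infty g) 0)"
  have lim: "(G \<longlongrightarrow> G P) (at P)" for P
  proof -
    have "(g \<longlongrightarrow> G P) (at P)"
      using tendsto_germ[OF g nopole] tendsto_value[OF g] by (auto simp: G_def)
    moreover have "eventually (\<lambda>Q. g Q = G Q) (at P)"
    proof (cases "P = infty")
      case False
      then have "eventually (\<lambda>Q. Q \<in> - {infty}) (at P)" by (intro eventually_at_in_open') auto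
      then show ?thesis by (rule eventually_mono) (auto simp: G_def)
    qed (auto simp: G_def eventually_at_filter)
    ultimately show ?thesis using tendsto_cong by blast
  qed
  then have cont: "continuous_on UNIV G" by (simp add: continuous_on_def)
  have hol: "(G \<circ> inv_into U z) holomorphic_on z ` U" if c: "(U, z) \<in> atl" for U z
  proof (rule no_isolated_singularity)
    show "continuous_on (z ` U) (G \<circ> inv_into U z)"
      by (rule continuous_on_compose) (use chartD(3)[OF c] homeomorphism_cont2 in blast,
          rule continuous_on_subset[OF cont], simp)
    have "(g \<circ> inv_into U z) holomorphic_on z ` (U - {infty})" by (rule mem_RX_chart(1)[OF g c])
    moreover have "z ` U - (z ` (U \<inter> {infty})) = z ` (U - {infty})"
      using chart_inj[OF c] by (auto dest: inj_onD)
    ultimately have "(g \<circ> inv_into U z) holomorphic_on z ` U - (z ` (U \<inter> {infty}))" by simp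
    then show "(G \<circ> inv_into U z) holomorphic_on z ` U - (z ` (U \<inter> {infty}))"
      by (rule holomorphic_transform) (auto simp: G_def c)
  qed (use chartD(2)[OF c] in auto)
  have "compact (UNIV :: 'a set)" "connected (UNIV :: 'a set)"
    using surface by (auto simp: compact_riemann_surface_def)
  then obtain P0 where P0: "\<And>Q. norm (G Q) \<le> norm (G P0)"
    using continuous_attains_sup[of UNIV "\<lambda>Q. norm (G Q)"] cont by (auto intro: continuous_intros)
  define A where "A = {Q. G Q = G P0}"
  have "closed A" unfolding A_def using cont by (intro closed_Collect_eq) auto
  moreover have "open A"
  proof (subst open_subopen, intro ballI)
    fix Q assume Q: "Q \<in> A"
    obtain U z where c: "(U, z) \<in> atl" and QU: "Q \<in> U" using chart_exists by blast
    obtain r where r: "r > 0" "ball (z Q) r \<subseteq> z ` U" using chartD(2)[OF c] QU openE by blast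
    have "(G \<circ> inv_into U z) constant_on ball (z Q) r"
    proof (rule maximum_modulus_principle[of _ _ "ball (z Q) r" "z Q"])
      show "(G \<circ> inv_into U z) holomorphic_on ball (z Q) r"
        using hol[OF c] r(2) holomorphic_on_subset by blast
      show "cmod ((G \<circ> inv_into U z) w) \<le> cmod ((G \<circ> inv_into U z) (z Q))" for w
        using P0 Q c QU by (simp add: A_def)
    qed (use r in auto)
    then have const: "G (inv_into U z w) = G Q" if "w \<in> ball (z Q) r" for w
    proof -
      obtain y where "\<And>w. w \<in> ball (z Q) r \<Longrightarrow> G (inv_into U z w) = y"
        using \<open>(G \<circ> inv_into U z) constant_on ball (z Q) r\<close> by (auto simp: constant_on_def)
      from this[OF that] this[of "z Q"] show ?thesis using r(1) QU c by simp
    qed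
    have "U \<inter> z -` ball (z Q) r \<subseteq> A"
    proof
      fix R assume "R \<in> U \<inter> z -` ball (z Q) r"
      then show "R \<in> A" using const[of "z R"] c Q by (auto simp: A_def)
    qed
    then show "\<exists>T. open T \<and> Q \<in> T \<and> T \<subseteq> A"
      using open_chart_preimage[OF c open_ball] QU r(1)
      by (intro exI[of _ "U \<inter> z -` ball (z Q) r"]) auto
  qed
  ultimately have "A = UNIV"
    using \<open>connected UNIV\<close> unfolding connected_clopen by (auto simp: A_def)
  then have "G Q = G P0" for Q by (auto simp: A_def)
  then have "g Q = cst (G P0) Q" for Q
    using RX_infty[OF g] unfolding G_def cst_def by (metis fun_upd_apply)
  then show ?thesis by blast
qed

section \<open>Pole orders at the base point\<close>

lemma has_polar_divisor_germ:
  assumes "has_polar_divisor atl infty g n"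
  shows "g \<in> RX" and "n = 0 \<Longrightarrow> fls_subdegree (germ infty g) \<ge> 0"
    and "n > 0 \<Longrightarrow> fls_subdegree (germ infty g) = - int n"
proof -
  note c = chosen_chart[of infty]
  show g: "g \<in> RX" using assms by (simp add: has_polar_divisor_def)
  have p: "is_pole (local_form infty g) (coord infty infty) \<longleftrightarrow> fls_subdegree (germ infty g) < 0"
    by (rule has_laurent_expansion_imp_is_pole_iff[OF germ_expansion[OF g]])
  have D: "if n = 0 then \<not> is_pole (local_form infty g) (coord infty infty)
      else is_pole (local_form infty g) (coord infty infty) \<and> zorder (local_form infty g) (coord infty infty) = - int n"
    using assms c unfolding has_polar_divisor_def local_form_def by fastforce
  show "n = 0 \<Longrightarrow> fls_subdegree (germ infty g) \<ge> 0" using p D by simp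
  assume n: "n > 0"
  then have "fls_subdegree (germ infty g) < 0" using p D by simp
  then have "germ infty g \<noteq> 0" by auto
  then show "fls_subdegree (germ infty g) = - int n"
    using has_laurent_expansion_zorder[OF germ_expansion[OF g]] D n by simp
qed

text \<open>Pole orders do not depend on the chart: transition functions are injective, so their
  derivatives do not vanish.\<close>

lemma germ_has_polar_divisor:
  assumes g: "g \<in> RX"
  shows "has_polar_divisor atl infty g (nat (- fls_subdegree (germ infty g)))"
proof -
  let ?n = "nat (- fls_subdegree (germ infty g))"
  define f where "f = local_form infty g"
  define p where "p = coord infty infty"
  note c0 = chosen_chart[of infty]
  have "if ?n = 0 then \<not> is_pole (g \<circ> inv_into U z) (z infty)
      else is_pole (g \<circ> inv_into U z) (z infty) \<and> zorder (g \<circ> inv_into U z) (z infty) = - int ?n"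
    if c: "(U, z) \<in> atl" and I: "infty \<in> U" for U z
  proof -
    have pole: "is_pole (g \<circ> inv_into U z) (z infty) \<longleftrightarrow> fls_subdegree (germ infty g) < 0"
      using filterlim_chart[OF c I, of g at_infinity] pole_iff_germ[OF g, of infty] by (simp add: is_pole_def comp_def)
    have "zorder (g \<circ> inv_into U z) (z infty) = fls_subdegree (germ infty g)"
      if neg: "fls_subdegree (germ infty g) < 0"
    proof -
      have nz: "germ infty g \<noteq> 0" using neg by auto
      define S where "S = z ` (U \<inter> nbhd infty)"
      define \<tau> where "\<tau> = coord infty \<circ> inv_into U z"
      have S: "open S" "z infty \<in> S"
        using open_chart_image[OF c chartD(1)[OF c0(1)]] I c0 by (auto simp: S_def)
      have hol: "\<tau> holomorphic_on S"
        unfolding \<tau>_def S_def by (rule transition_holomorphic[OF c c0(1)])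
      have inj: "inj_on \<tau> S"
        using chart_inj[OF c0(1)] by (auto simp: inj_on_def S_def \<tau>_def c)
      have dnz: "deriv \<tau> (z infty) \<noteq> 0"
        by (rule holomorphic_injective_imp_regular[OF hol S(1) inj S(2)])
      have \<tau>p: "\<tau> (z infty) = p" using c I by (simp add: \<tau>_def p_def)
      have "zorder (\<lambda>w. \<tau> w - \<tau> (z infty)) (z infty) = 1"
      proof (rule zorder_zero_eqI)
        show "(\<lambda>w. \<tau> w - \<tau> (z infty)) holomorphic_on S" by (intro holomorphic_intros hol)
        have "deriv (\<lambda>w. \<tau> w - \<tau> (z infty)) (z infty) = deriv \<tau> (z infty)"
          using hol S holomorphic_on_imp_differentiable_at by (subst deriv_diff) auto
        then show "(deriv ^^ nat 1) (\<lambda>w. \<tau> w - \<tau> (z infty)) (z infty) \<noteq> 0" using dnz by simp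
      qed (use S in auto)
      moreover have "zorder (f \<circ> \<tau>) (z infty) = zorder f (\<tau> (z infty)) * zorder (\<lambda>w. \<tau> w - \<tau> (z infty)) (z infty)"
      proof (rule zorder_compose')
        have "f meromorphic_on {p}"
          unfolding f_def p_def local_form_def by (rule mem_RX_chart(2)[OF g c0])
        then show "isolated_singularity_at f (\<tau> (z infty))" "not_essential f (\<tau> (z infty))"
          unfolding \<tau>p by (simp_all add: meromorphic_at_iff)
        show "\<tau> analytic_on {z infty}" using hol S analytic_at by blast
        show "eventually (\<lambda>w. f w \<noteq> 0) (at (\<tau> (z infty)))"
          unfolding \<tau>p
          using has_laurent_expansion_eventually_nonzero_iff[OF germ_expansion[OF g, of infty]] nz
          by (simp add: f_def p_def)
        have "eventually (\<lambda>w. w \<in> S - {z infty}) (at (z infty))"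
          using S by (intro eventually_at_in_open) auto
        then show "eventually (\<lambda>w. \<tau> w \<noteq> \<tau> (z infty)) (at (z infty))"
          by (rule eventually_mono) (use inj S in \<open>auto dest: inj_onD\<close>)
      qed
      moreover have "zorder (f \<circ> \<tau>) (z infty) = zorder (g \<circ> inv_into U z) (z infty)"
      proof (rule zorder_cong)
        have "eventually (\<lambda>w. w \<in> S) (at (z infty))" using S by (intro eventually_at_in_open') auto
        then show "eventually (\<lambda>w. (f \<circ> \<tau>) w = (g \<circ> inv_into U z) w) (at (z infty))"
          by (rule eventually_mono) (auto simp: S_def f_def \<tau>_def local_form_def c c0)
      qed simp
      moreover have "zorder f p = fls_subdegree (germ infty g)"
        unfolding f_def p_def using has_laurent_expansion_zorder[OF germ_expansion[OF g]] nz by simp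
      ultimately show ?thesis using \<tau>p by simp
    qed
    then show ?thesis using pole by auto
  qed
  then show ?thesis using g unfolding has_polar_divisor_def by blast
qed

section \<open>Division\<close>

text \<open>The quotient takes its limits as values at the zeros of the denominator.\<close>

lemma RX_divide:
  assumes G: "G \<in> RX" and X: "X \<in> RX"
    and nz: "\<And>P. germ P X \<noteq> 0"
    and zeros: "\<And>P. P \<noteq> infty \<Longrightarrow> germ P G = 0 \<or> fls_subdegree (germ P X) \<le> fls_subdegree (germ P G)"
  shows "\<exists>h\<in>RX. \<forall>P. germ P h * germ P X = germ P G"
proof -
  define q where "q P = G P / X P" for P
  define h where "h P = (if P = infty then 0 else Lim (at P) q)" for P
  have qgerm: "(\<lambda>w. local_form P q (coord P P + w)) has_laurent_expansion germ P G / germ P X" for P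
    using has_laurent_expansion_divide[OF germ_expansion[OF G] germ_expansion[OF X], of P P]
    by (simp add: local_form_def q_def)
  have qlim: "(q \<longlongrightarrow> h P) (at P)" if P: "P \<noteq> infty" for P
  proof -
    have "fls_subdegree (germ P G / germ P X) \<ge> 0"
      using zeros[OF P] nz[of P] by (cases "germ P G = 0") (auto simp: fls_divide_subdegree)
    then have "\<exists>l. (q \<longlongrightarrow> l) (at P)"
      using has_laurent_expansion_imp_tendsto[OF qgerm] filterlim_chart[OF chosen_chart[of P], of q]
      unfolding local_form_def by blast
    then show ?thesis using P tendsto_Lim[OF at_neq_bot] by (auto simp: h_def)
  qed
  have merq: "(q \<circ> inv_into U z) meromorphic_on {z P}" if c: "(U, z) \<in> atl" "P \<in> U" for U z P
  proof -
    have "q \<circ> inv_into U z = (\<lambda>w. (G \<circ> inv_into U z) w / (X \<circ> inv_into U z) w)" by (auto simp: q_def)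
    then show ?thesis by (simp only:) (intro meromorphic_intros mem_RX_chart G X c)
  qed
  have h_chart: "remove_sings (q \<circ> inv_into U z) (z P) = h P"
    "remove_sings (q \<circ> inv_into U z) analytic_on {z P}"
    if c: "(U, z) \<in> atl" "P \<in> U" and P: "P \<noteq> infty" for U z P
  proof -
    have lim: "((q \<circ> inv_into U z) \<longlongrightarrow> h P) (at (z P))"
      using qlim[OF P] filterlim_chart[OF c] by blast
    then show "remove_sings (q \<circ> inv_into U z) (z P) = h P" by (rule remove_sings_eqI)
    show "remove_sings (q \<circ> inv_into U z) analytic_on {z P}"
      using lim merq[OF c] by (intro remove_sings_analytic_at) (auto simp: meromorphic_at_iff)
  qed
  have "h \<in> RX"
  proof (rule RX_I)
    show "h infty = 0" by (simp add: h_def)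
    fix U z assume c: "(U, z) \<in> atl"
    let ?S = "z ` (U - {infty})"
    have "remove_sings (q \<circ> inv_into U z) analytic_on {w}" if "w \<in> ?S" for w
      using that h_chart(2)[OF c] by auto
    then have "remove_sings (q \<circ> inv_into U z) analytic_on ?S"
      using analytic_on_analytic_at by blast
    then have "remove_sings (q \<circ> inv_into U z) holomorphic_on ?S"
      using analytic_imp_holomorphic by blast
    then show "(h \<circ> inv_into U z) holomorphic_on ?S"
    proof (rule holomorphic_transform)
      fix w assume "w \<in> ?S"
      then obtain P where "P \<in> U" "P \<noteq> infty" "w = z P" by auto
      then show "remove_sings (q \<circ> inv_into U z) w = (h \<circ> inv_into U z) w"
        using h_chart(1)[OF c] c by simp
    qed
    assume I: "infty \<in> U"
    have "eventually (\<lambda>w. w \<in> z ` U - {z infty}) (at (z infty))"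
      using chartD(2)[OF c] I by (intro eventually_at_in_open) auto
    then have "eventually (\<lambda>w. (h \<circ> inv_into U z) w = remove_sings (q \<circ> inv_into U z) w) (at (z infty))"
    proof (rule eventually_mono)
      fix w assume "w \<in> z ` U - {z infty}"
      then obtain P where "P \<in> U" "P \<noteq> infty" "w = z P" by auto
      then show "(h \<circ> inv_into U z) w = remove_sings (q \<circ> inv_into U z) w"
        using h_chart(1)[OF c] c by simp
    qed
    then have "(h \<circ> inv_into U z) meromorphic_on {z infty}
        \<longleftrightarrow> remove_sings (q \<circ> inv_into U z) meromorphic_on {z infty}"
      by (intro meromorphic_on_cong) auto
    then show "(h \<circ> inv_into U z) meromorphic_on {z infty}"
      using remove_sings_meromorphic[OF merq[OF c I]] by simp
  qed
  moreover have "germ P h * germ P X = germ P G" for P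
  proof -
    have XP: "eventually (\<lambda>Q. X Q \<noteq> 0) (at P)" for P
      using has_laurent_expansion_eventually_nonzero_iff[OF germ_expansion[OF X, of P]] nz
        eventually_chart[OF chosen_chart, of "\<lambda>Q. X Q \<noteq> 0" P] by (simp add: local_form_def)
    have ev: "eventually (\<lambda>Q. Q \<noteq> infty) (at P)"
    proof (cases "P = infty")
      case False
      then have "eventually (\<lambda>Q. Q \<in> - {infty}) (at P)" by (intro eventually_at_in_open') auto
      then show ?thesis by simp
    qed (auto simp: eventually_at_filter)
    have "h Q * X Q = G Q" if "X Q \<noteq> 0" "Q \<noteq> infty" for Q
    proof -
      have "(q \<longlongrightarrow> G Q / X Q) (at Q)"
        unfolding q_def using that by (intro tendsto_intros tendsto_value G X)
      then have "h Q = G Q / X Q" using tendsto_unique[OF at_neq_bot qlim] that by blast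
      then show ?thesis using that by simp
    qed
    then have "eventually (\<lambda>Q. h Q * X Q = G Q) (at P)"
      using eventually_conj[OF XP[of P] ev] by (auto elim: eventually_mono)
    then have "germ P (\<lambda>Q. h Q * X Q) = germ P G" by (rule germ_cong[OF _ G])
    then show ?thesis using germ_mult[OF \<open>h \<in> RX\<close> X] by simp
  qed
  ultimately show ?thesis by blast
qed

end

context pointed_riemann_surface
begin

section \<open>The number of zeros on a fibre\<close>

text \<open>Near a zero of order \<open>e\<close> of \<open>x - a\<close> there are \<open>e\<close> points where \<open>x\<close> takes any given value that is
  close to \<open>a\<close>, but not \<open>a\<close>; so the orders add up to at most the size of a general fibre.\<close>

lemma sum_zero_orders_le:
  assumes x: "x \<in> RX" and A: "finite A"
    and fibres: "\<And>b. b \<notin> A \<Longrightarrow> finite {P. P \<noteq> infty \<and> x P = b} \<and> card {P. P \<noteq> infty \<and> x P = b} \<le> r"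
    and F: "finite F" "\<And>P. P \<in> F \<Longrightarrow> P \<noteq> infty \<and> x P = a"
    and nz: "\<And>P. P \<in> F \<Longrightarrow> germ P (\<lambda>Q. x Q - cst a Q) \<noteq> 0"
  shows "(\<Sum>P\<in>F. nat (fls_subdegree (germ P (\<lambda>Q. x Q - cst a Q)))) \<le> r"
proof -
  define e where "e P = nat (fls_subdegree (germ P (\<lambda>Q. x Q - cst a Q)))" for P
  from finite_set_disjoint_nbhds[OF F(1)] obtain W where nbhds:
    "(\<forall>P\<in>F. open (W P) \<and> P \<in> W P) \<and> (\<forall>P\<in>F. \<forall>Q\<in>F. P \<noteq> Q \<longrightarrow> W P \<inter> W Q = {})"
    by (rule exE)
  have W: "\<And>P. P \<in> F \<Longrightarrow> open (W P) \<and> P \<in> W P"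
    "\<And>P Q. P \<in> F \<Longrightarrow> Q \<in> F \<Longrightarrow> P \<noteq> Q \<Longrightarrow> W P \<inter> W Q = {}"
    using nbhds by simp_all
  define S where "S P = coord P ` (nbhd P \<inter> (W P - {infty}))" for P
  have "\<exists>d>0. \<forall>b. b \<noteq> a \<and> dist b a < d \<longrightarrow>
      (\<exists>T\<subseteq>S P. finite T \<and> card T = e P \<and> (\<forall>w\<in>T. local_form P x w = b))" if P: "P \<in> F" for P
  proof -
    have xP: "P \<noteq> infty" "x P = a" using F(2)[OF P] by auto
    note c = chosen_chart[of P]
    have "open (W P - {infty})" using W(1)[OF P] by (intro open_Diff) auto
    then have op: "open (S P)" unfolding S_def by (rule open_chart_image[OF c(1)])
    have mem: "coord P P \<in> S P" using W(1)[OF P] xP c by (auto simp: S_def)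
    have "local_form P x holomorphic_on (coord P ` (nbhd P - {infty}))"
      unfolding local_form_def by (rule mem_RX_chart(1)[OF x c(1)])
    then have hol: "local_form P x holomorphic_on S P"
      by (rule holomorphic_on_subset) (auto simp: S_def)
    have val: "local_form P x (coord P P) = a" using xP c by (simp add: local_form_def)
    have G: "germ P (\<lambda>Q. x Q - cst a Q) = germ P x - fls_const a"
      by (simp add: germ_diff[OF x RX_cst] germ_cst)
    have "(\<lambda>w. local_form P x (coord P P + w) - a) has_laurent_expansion germ P x - fls_const a"
      by (intro laurent_expansion_intros germ_expansion x)
    then have ex: "(\<lambda>w. local_form P x (coord P P + w) - local_form P x (coord P P))
        has_laurent_expansion germ P (\<lambda>Q. x Q - cst a Q)" by (simp add: G val)
    have "fls_subdegree (germ P (\<lambda>Q. x Q - cst a Q)) = int (e P)"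
      using germ_holomorphic(1)[OF RX_diff[OF x RX_cst] xP(1)] by (simp add: e_def)
    from local_preimages[OF hol op mem ex nz[OF P] this] show ?thesis unfolding val .
  qed
  then obtain d where d: "\<And>P. P \<in> F \<Longrightarrow> d P > 0"
    "\<And>P b. P \<in> F \<Longrightarrow> b \<noteq> a \<Longrightarrow> dist b a < d P \<Longrightarrow>
      (\<exists>T\<subseteq>S P. finite T \<and> card T = e P \<and> (\<forall>w\<in>T. local_form P x w = b))" by metis
  define \<delta> where "\<delta> = Min (insert 1 (d ` F))"
  have \<delta>: "\<delta> > 0" "\<And>P. P \<in> F \<Longrightarrow> \<delta> \<le> d P" using F(1) d(1) by (auto simp: \<delta>_def)
  have "\<not> ball a \<delta> \<subseteq> insert a A"
    using uncountable_ball[OF \<delta>(1), of a] A countable_finite[of "insert a A"] countable_subset by blast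
  then obtain b where b: "b \<in> ball a \<delta>" "b \<noteq> a" "b \<notin> A" by blast
  have "\<exists>T\<subseteq>S P. finite T \<and> card T = e P \<and> (\<forall>w\<in>T. local_form P x w = b)" if "P \<in> F" for P
    using d(2)[OF that b(2)] \<delta>(2)[OF that] b(1) by (simp add: dist_commute)
  then obtain T where T: "\<And>P. P \<in> F \<Longrightarrow> T P \<subseteq> S P \<and> finite (T P) \<and> card (T P) = e P \<and>
      (\<forall>w\<in>T P. local_form P x w = b)" by metis
  define T' where "T' P = inv_into (nbhd P) (coord P) ` T P" for P
  have T': "finite (T' P)" "card (T' P) = e P" "T' P \<subseteq> W P" "T' P \<subseteq> {P. P \<noteq> infty \<and> x P = b}"
    if P: "P \<in> F" for P
  proof -
    have "T P \<subseteq> coord P ` nbhd P" using T[OF P] by (auto simp: S_def)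
    then have "inj_on (inv_into (nbhd P) (coord P)) (T P)"
      by (intro inj_on_inv_into)
    then show "card (T' P) = e P" "finite (T' P)" using T[OF P] by (simp_all add: T'_def card_image)
    have *: "inv_into (nbhd P) (coord P) w \<in> W P - {infty}" if "w \<in> S P" for w
      using that chosen_chart[of P] by (auto simp: S_def)
    then show "T' P \<subseteq> W P" using T[OF P] by (auto simp: T'_def)
    show "T' P \<subseteq> {P. P \<noteq> infty \<and> x P = b}"
      using T[OF P] * by (auto simp: T'_def local_form_def)
  qed
  have "(\<Sum>P\<in>F. e P) = (\<Sum>P\<in>F. card (T' P))" using T' by simp
  also have "\<dots> = card (\<Union>P\<in>F. T' P)"
  proof (rule card_UN_disjoint[symmetric])
    show "\<forall>P\<in>F. \<forall>Q\<in>F. P \<noteq> Q \<longrightarrow> T' P \<inter> T' Q = {}" using W(2) T'(3) by blast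
  qed (use F T' in auto)
  also have "\<dots> \<le> card {P. P \<noteq> infty \<and> x P = b}"
    using fibres[OF b(3)] T'(4) by (intro card_mono) auto
  also have "\<dots> \<le> r" using fibres[OF b(3)] by blast
  finally show ?thesis by (simp add: e_def)
qed

text \<open>A vanishing germ means that \<open>x = a\<close> on a neighbourhood, which has infinitely many points.\<close>

lemma germ_eq_zero_infinite_fibre:
  assumes x: "x \<in> RX" and P: "P \<noteq> infty" and zero: "germ P (\<lambda>Q. x Q - cst a Q) = 0"
  shows "infinite {Q. Q \<noteq> infty \<and> x Q = a}"
proof
  assume fin: "finite {Q. Q \<noteq> infty \<and> x Q = a}"
  note c = chosen_chart[of P]
  let ?X = "\<lambda>Q. x Q - cst a Q"
  have "eventually (\<lambda>w. local_form P ?X w = 0) (at (coord P P))"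
    using has_laurent_expansion_eventually_zero_iff[OF germ_expansion[OF RX_diff[OF x RX_cst]], of P a] zero
    by simp
  then obtain S where S: "open S" "coord P P \<in> S" "\<And>w. w \<in> S \<Longrightarrow> w \<noteq> coord P P \<Longrightarrow> local_form P ?X w = 0"
    by (auto simp: eventually_at_topological)
  define S' where "S' = S \<inter> coord P ` (nbhd P - {infty})"
  have S': "open S'" "coord P P \<in> S'"
    using S P c open_chart_punctured[OF c(1)] by (auto simp: S'_def)
  let ?i = "inv_into (nbhd P) (coord P)"
  have "inj_on ?i S'" by (rule inj_on_inv_into) (auto simp: S'_def)
  moreover have "?i ` S' \<subseteq> insert P {Q. Q \<noteq> infty \<and> x Q = a}"
  proof
    fix Q assume "Q \<in> ?i ` S'"
    then obtain w where w: "w \<in> S'" "Q = ?i w" by (rule imageE)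
    then obtain R where "R \<in> nbhd P - {infty}" "w = coord P R" unfolding S'_def by blast
    then have R: "coord P R \<in> S" "R \<in> nbhd P" "R \<noteq> infty" "Q = R"
      using w c by (simp_all add: S'_def)
    show "Q \<in> insert P {Q. Q \<noteq> infty \<and> x Q = a}"
    proof (cases "coord P R = coord P P")
      case True
      then have "R = P" using chart_inj[OF c(1)] R c by (auto dest: inj_onD)
      then show ?thesis using R by simp
    next
      case False
      then show ?thesis using S(3)[OF R(1)] R c by (simp add: local_form_def cst_def)
    qed
  qed
  ultimately have "finite S'" using fin by (meson finite.insertI finite_imageD finite_subset)
  moreover obtain \<epsilon> where "\<epsilon> > 0" "ball (coord P P) \<epsilon> \<subseteq> S'" using S' openE by blast
  ultimately show False
    using uncountable_ball[of \<epsilon> "coord P P"] countable_finite finite_subset by blast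
qed

end

text \<open>Since the pole orders \<open>e i\<close> are distinct, the largest one with a nonzero coefficient cannot cancel.\<close>

lemma fls_subdegree_combination:
  fixes g :: "'i \<Rightarrow> 'k::field fls" and e :: "'i \<Rightarrow> nat"
  assumes "finite I" and g: "\<And>i. i \<in> I \<Longrightarrow> g i \<noteq> 0 \<and> fls_subdegree (g i) = - int (e i)"
    and inj: "inj_on e I" and c: "\<exists>i\<in>I. c i \<noteq> 0"
  shows "\<exists>i\<in>I. (\<Sum>i\<in>I. fls_const (c i) * g i) \<noteq> 0 \<and>
    fls_subdegree (\<Sum>i\<in>I. fls_const (c i) * g i) = - int (e i)"
proof -
  let ?J = "{i \<in> I. c i \<noteq> 0}"
  define M where "M = Max (e ` ?J)"
  have "M \<in> e ` ?J" unfolding M_def using assms by (intro Max_in) auto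
  then obtain k where k: "k \<in> I" "c k \<noteq> 0" "e k = M" by auto
  have le: "e i \<le> M" if "i \<in> I" "c i \<noteq> 0" for i
    unfolding M_def using assms that by (intro Max_ge) auto
  have nth: "fls_nth (\<Sum>i\<in>I. fls_const (c i) * g i) n = (\<Sum>i\<in>I. c i * fls_nth (g i) n)" for n
    by (simp add: fls_nth_sum)
  have top: "fls_nth (\<Sum>i\<in>I. fls_const (c i) * g i) (- int M) \<noteq> 0"
  proof -
    have "c i * fls_nth (g i) (- int M) = 0" if "i \<in> I - {k}" for i
    proof (cases "c i = 0")
      case False
      then have "e i < M" using le[of i] that k inj by (metis DiffE inj_onD le_neq_implies_less singletonI)
      then show ?thesis using g[of i] that by simp
    qed simp
    then have "(\<Sum>i\<in>I - {k}. c i * fls_nth (g i) (- int M)) = 0" by (rule sum.neutral[OF ballI])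
    then have "(\<Sum>i\<in>I. c i * fls_nth (g i) (- int M)) = c k * fls_nth (g k) (- int M)"
      using sum.remove[OF assms(1) k(1), of "\<lambda>i. c i * fls_nth (g i) (- int M)"] by simp
    moreover have "fls_nth (g k) (- int M) \<noteq> 0"
      using g[OF k(1)] k(3) nth_fls_subdegree_nonzero[of "g k"] by simp
    ultimately show ?thesis using k nth by simp
  qed
  have "fls_subdegree (\<Sum>i\<in>I. fls_const (c i) * g i) = - int M"
  proof (rule fls_subdegree_eqI[OF top])
    fix n assume n: "n < - int M"
    have "c i * fls_nth (g i) n = 0" if "i \<in> I" for i
      using le[OF that] g[OF that] n by (cases "c i = 0") auto
    then show "fls_nth (\<Sum>i\<in>I. fls_const (c i) * g i) n = 0" unfolding nth by (rule sum.neutral[OF ballI])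
  qed
  moreover have "(\<Sum>i\<in>I. fls_const (c i) * g i) \<noteq> 0"
    using top by (metis fls_zero_nth)
  ultimately show ?thesis using k by blast
qed

section \<open>Weierstrass curves\<close>

locale weierstrass = pointed_riemann_surface atl infty
  for atl :: "('a::t2_space set \<times> ('a \<Rightarrow> complex)) set" and infty :: 'a +
  fixes m :: nat and gen :: "nat \<Rightarrow> nat" and x :: "'a \<Rightarrow> complex" and y :: "nat \<Rightarrow> 'a \<Rightarrow> complex"
    and fX :: "complex poly poly"
  assumes weierstrass: "weierstrass_curve atl infty m gen x y fX"
begin

definition H where "H = weierstrass_semigroup atl infty"

definition r where "r = gen 1"

lemma curve_data:
  shows m_ge: "2 \<le> m"
    and gens: "minimal_generating_set H (gen ` {1..m})"
    and r_pos: "0 < r" and x_pole: "has_polar_divisor atl infty x r"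
    and y_pole: "\<And>i. i \<in> {2..m} \<Longrightarrow> has_polar_divisor atl infty (y i) (gen i)"
    and fX: "degree fX = r" "lead_coeff fX = 1"
    and normalization: "normalizes_plane_curve infty x (y 2) fX"
proof -
  note w = weierstrass[unfolded weierstrass_curve_def Let_def, folded H_def, folded r_def]
  show "2 \<le> m" "minimal_generating_set H (gen ` {1..m})" "0 < r"
    "has_polar_divisor atl infty x r" "degree fX = r" "lead_coeff fX = 1"
    "normalizes_plane_curve infty x (y 2) fX"
    using w by - (elim conjE, assumption)+
  show "has_polar_divisor atl infty (y i) (gen i)" if "i \<in> {2..m}" for i
    using w that by (elim conjE) (erule bspec)
qed

lemma coprime_generator: "coprime (gen 2) r"
proof -
  let ?S = "{standard_basis H r ! i | i. 1 \<le> i \<and> i < r \<and> coprime (standard_basis H r ! i) r}"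
  note w = weierstrass[unfolded weierstrass_curve_def Let_def, folded H_def, folded r_def]
  have "?S \<noteq> {}" "gen 2 = Min ?S"
    using w by - (elim conjE, assumption)+
  moreover have "?S \<subseteq> (\<lambda>i. standard_basis H r ! i) ` {..<r}" by blast
  then have "finite ?S" by (rule finite_subset) simp
  ultimately have "gen 2 \<in> ?S" using Min_in[of ?S] by simp
  then have "\<exists>i. gen 2 = standard_basis H r ! i \<and> 1 \<le> i \<and> i < r \<and> coprime (standard_basis H r ! i) r"
    by (simp only: mem_Collect_eq)
  then show ?thesis by metis
qed

lemma span: "semigroup_span (gen ` {1..m}) = H"
  using gens by (simp add: minimal_generating_set_def)

text \<open>A generator 0 could be dropped, against minimality.\<close>

lemma gen_pos:
  assumes "i \<in> {1..m}"
  shows "gen i > 0"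
proof (rule ccontr)
  assume "\<not> gen i > 0"
  let ?G = "gen ` {1..m}"
  have 0: "0 \<in> ?G" using assms \<open>\<not> gen i > 0\<close> by force
  have "(\<Sum>g\<in>?G - {0}. c g * g) = (\<Sum>g\<in>?G. c g * g)" for c :: "nat \<Rightarrow> nat"
    by (rule sum.mono_neutral_left) auto
  then have "semigroup_span (?G - {0}) = H" using span by (simp add: semigroup_span_def)
  moreover have "?G - {0} \<subset> ?G" using 0 by blast
  ultimately show False using gens by (auto simp: minimal_generating_set_def)
qed

lemma x_in: "x \<in> RX"
  and y_in: "i \<in> {2..m} \<Longrightarrow> y i \<in> RX"
  using has_polar_divisor_germ(1) x_pole y_pole by blast+

lemma x_order: "fls_subdegree (germ infty x) = - int r"
  using has_polar_divisor_germ(3)[OF x_pole] r_pos by simp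

lemma y_order: "i \<in> {2..m} \<Longrightarrow> fls_subdegree (germ infty (y i)) = - int (gen i)"
  using has_polar_divisor_germ(3)[OF y_pole] gen_pos by simp

lemma pole_order_in_H: "g \<in> RX \<Longrightarrow> nat (- fls_subdegree (germ infty g)) \<in> H"
  using germ_has_polar_divisor unfolding H_def weierstrass_semigroup_def by blast

lemma function_of_order:
  assumes "n \<in> H"
  shows "\<exists>g\<in>RX. germ infty g \<noteq> 0 \<and> fls_subdegree (germ infty g) = - int n"
proof (cases "n = 0")
  case True
  then show ?thesis by (intro bexI[OF _ RX_cst[of 1]]) (simp add: germ_cst)
next
  case False
  obtain g where g: "has_polar_divisor atl infty g n"
    using assms unfolding H_def weierstrass_semigroup_def by blast
  have "fls_subdegree (germ infty g) = - int n" using has_polar_divisor_germ(3)[OF g] False by simp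
  then show ?thesis using has_polar_divisor_germ(1)[OF g] False by force
qed

text \<open>The generator \<open>gen 2\<close> is prime to \<open>r\<close>, so its multiples meet all residue classes. This is what makes the
  elements of the standard basis genuine minima.\<close>

lemma H_residues:
  assumes "k < r"
  shows "\<exists>h\<in>H. h mod r = k"
proof -
  have "gen 2 \<noteq> 0" using gen_pos[of 2] m_ge by simp
  then obtain u v where uv: "gen 2 * u = r * v + gcd (gen 2) r" using bezout_nat by blast
  have "gcd (gen 2) r = 1" using coprime_generator by simp
  then have "(u * k) * gen 2 = r * (v * k) + k" using uv by (simp add: algebra_simps)
  then have "((u * k) * gen 2) mod r = k" using assms by simp
  moreover have "(u * k) * gen 2 \<in> H"
  proof -
    have "gen 2 \<in> gen ` {1..m}" using m_ge by auto
    then have "(\<Sum>g\<in>gen ` {1..m}. if g = gen 2 then (u * k) * gen 2 else 0) = (u * k) * gen 2"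
      by (subst sum.delta) auto
    moreover have "(\<Sum>g\<in>gen ` {1..m}. (if g = gen 2 then u * k else 0) * g)
        = (\<Sum>g\<in>gen ` {1..m}. if g = gen 2 then (u * k) * gen 2 else 0)"
      by (rule sum.cong) simp_all
    ultimately have "(u * k) * gen 2 \<in> semigroup_span (gen ` {1..m})"
      unfolding semigroup_span_def
      by (intro CollectI exI[of _ "\<lambda>g. if g = gen 2 then u * k else 0"]) simp
    then show ?thesis by (simp only: span)
  qed
  ultimately show ?thesis by blast
qed

section \<open>Fibres of the projection\<close>

definition fibre_poly :: "complex \<Rightarrow> complex poly" where
  "fibre_poly a = map_poly (\<lambda>c. poly c a) fX"

text \<open>The defining polynomial is monic in \<open>y\<close>, so its degree in \<open>y\<close> does not drop at any \<open>x = a\<close>.\<close>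

lemma fibre_poly: "degree (fibre_poly a) = r" "fibre_poly a \<noteq> 0"
proof -
  have c: "coeff (fibre_poly a) r = 1"
    using fX by (simp add: fibre_poly_def coeff_map_poly)
  then have "r \<le> degree (fibre_poly a)" by (intro le_degree) simp
  moreover have "degree (fibre_poly a) \<le> r" 
    using fX by (intro degree_le) (auto simp: fibre_poly_def coeff_map_poly coeff_eq_0)
  ultimately show "degree (fibre_poly a) = r" by simp
  show "fibre_poly a \<noteq> 0" using c by auto
qed

lemma plane_curve_fX: "(a, b) \<in> plane_curve fX \<longleftrightarrow> poly (fibre_poly a) b = 0"
  by (simp add: plane_curve_def poly2_def fibre_poly_def)

lemma x_surjective: "\<exists>P. P \<noteq> infty \<and> x P = a"
proof -
  have "\<not> constant (poly (fibre_poly a))"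
    using fibre_poly r_pos by (simp add: constant_degree)
  then obtain b where "poly (fibre_poly a) b = 0" using fundamental_theorem_of_algebra by blast
  then have "(a, b) \<in> (\<lambda>P. (x P, y 2 P)) ` (- {infty})"
    using normalization by (simp add: normalizes_plane_curve_def plane_curve_fX)
  then show ?thesis by auto
qed

definition Sing where "Sing = {P. P \<noteq> infty \<and> (x P, y 2 P) \<in> plane_curve_sing fX}"

lemma finite_Sing: "finite Sing"
  using normalization by (simp add: normalizes_plane_curve_def Sing_def)

text \<open>The normalization is injective over smooth points, and the plane curve has at most \<open>r\<close> points over \<open>a\<close>,
  the roots of a polynomial of degree \<open>r\<close>.\<close>

lemma smooth_fibre:
  shows "finite ({P. P \<noteq> infty \<and> x P = a} - Sing)" "card ({P. P \<noteq> infty \<and> x P = a} - Sing) \<le> r"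
proof -
  let ?F = "{P. P \<noteq> infty \<and> x P = a} - Sing"
  let ?Z = "{b. poly (fibre_poly a) b = 0}"
  have smooth: "inj_on (\<lambda>P. (x P, y 2 P)) {P. P \<noteq> infty \<and> (x P, y 2 P) \<notin> plane_curve_sing fX}"
    using normalization unfolding normalizes_plane_curve_def by blast
  have inj: "inj_on (y 2) ?F"
  proof (rule inj_onI)
    fix P Q assume P: "P \<in> ?F" and Q: "Q \<in> ?F" and "y 2 P = y 2 Q"
    then have "(x P, y 2 P) = (x Q, y 2 Q)" by simp
    moreover have "P \<noteq> infty \<and> (x P, y 2 P) \<notin> plane_curve_sing fX"
      "Q \<noteq> infty \<and> (x Q, y 2 Q) \<notin> plane_curve_sing fX"
      using P Q unfolding Sing_def by blast+
    ultimately show "P = Q" using inj_onD[OF smooth, of P Q] by simp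
  qed
  have sub: "y 2 ` ?F \<subseteq> ?Z"
  proof
    fix b assume "b \<in> y 2 ` ?F"
    then obtain P where P: "P \<noteq> infty" "x P = a" "b = y 2 P" by auto
    then have "(x P, y 2 P) \<in> plane_curve fX"
      using normalization by (auto simp: normalizes_plane_curve_def)
    then show "b \<in> ?Z" using P by (simp add: plane_curve_fX)
  qed
  have Z: "finite ?Z" "card ?Z \<le> r"
    using poly_roots_finite[OF fibre_poly(2)] card_poly_roots_bound[OF fibre_poly(2), of a] fibre_poly(1)
    by auto
  show "finite ?F" using finite_imageD[OF finite_subset[OF sub Z(1)] inj] .
  have "card ?F \<le> card ?Z" using card_inj_on_le[OF inj sub Z(1)] .
  then show "card ?F \<le> r" using Z by simp
qed

lemma finite_fibre: "finite {P. P \<noteq> infty \<and> x P = a}"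
  using finite_subset[of _ "({P. P \<noteq> infty \<and> x P = a} - Sing) \<union> Sing"] smooth_fibre(1) finite_Sing by blast

lemma fibre_order_at_infty: "fls_subdegree (germ infty (\<lambda>Q. x Q - cst a Q)) = - int r"
proof -
  have "germ infty x \<noteq> 0" using x_order r_pos by auto
  then show ?thesis using x_order r_pos
    by (simp add: germ_diff[OF x_in RX_cst] germ_cst fls_subdegree_diff_eq1)
qed

lemma germ_fibre_nonzero: "germ P (\<lambda>Q. x Q - cst a Q) \<noteq> 0"
proof (cases "P = infty")
  case True
  then show ?thesis using fibre_order_at_infty[of a] r_pos by auto
next
  case False
  then show ?thesis using germ_eq_zero_infinite_fibre[OF x_in] finite_fibre by blast
qed

text \<open>Only the finitely many values of \<open>x\<close> at points over singularities have to be avoided to apply the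
  count on a general fibre.\<close>

lemma fibre_orders_le:
  "(\<Sum>P | P \<noteq> infty \<and> x P = a. nat (fls_subdegree (germ P (\<lambda>Q. x Q - cst a Q)))) \<le> r"
proof (rule sum_zero_orders_le[OF x_in])
  show "finite (x ` Sing)" using finite_Sing by simp
  fix b assume "b \<notin> x ` Sing"
  then have "{P. P \<noteq> infty \<and> x P = b} - Sing = {P. P \<noteq> infty \<and> x P = b}" by auto
  then show "finite {P. P \<noteq> infty \<and> x P = b} \<and> card {P. P \<noteq> infty \<and> x P = b} \<le> r"
    using smooth_fibre[of b] by simp
qed (use finite_fibre germ_fibre_nonzero in auto)

section \<open>The functions separate points\<close>

text \<open>This is where the normalization hypothesis enters, through the bound \<open>r\<close> for the number of zeros of
  \<open>x - a\<close> with multiplicities; it replaces the theorem of Riemann and Roch.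

  Suppose that \<open>P0\<close> and \<open>Q0\<close> cannot be separated; then they lie over the same \<open>a\<close>. Let \<open>b 0, \<dots>, b (r - 1)\<close> be
  functions whose pole orders are the elements of the standard basis. That a linear combination of them be
  divisible by \<open>x - a\<close> amounts to at most \<open>r\<close> linear conditions, on its Taylor coefficients at the points of
  the fibre, and two of these coincide, the vanishing at \<open>P0\<close> and at \<open>Q0\<close>. So some nontrivial combination
  \<open>G\<close> is divisible. The pole order of \<open>G / (x - a)\<close> is \<open>r\<close> less than a standard basis element, in the same
  residue class, which contradicts the minimality of that element; if the difference is negative, the
  quotient is a function without poles that vanishes at the base point, but is not 0.\<close>

lemma separates_points:
  assumes P0: "P0 \<noteq> infty" and Q0: "Q0 \<noteq> infty" and ne: "P0 \<noteq> Q0"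
  shows "\<exists>g\<in>RX. g P0 \<noteq> g Q0"
proof (rule ccontr)
  assume "\<not> ?thesis"
  then have same: "g P0 = g Q0" if "g \<in> RX" for g using that by blast
  define a where "a = x P0"
  have xQ0: "x Q0 = a" using same[OF x_in] by (simp add: a_def)
  define X where "X = (\<lambda>Q. x Q - cst a Q)"
  have X: "X \<in> RX" unfolding X_def by (intro RX_diff x_in RX_cst)
  define F where "F = {P. P \<noteq> infty \<and> x P = a}"
  have F: "finite F" "P0 \<in> F" "Q0 \<in> F" using finite_fibre P0 Q0 xQ0 by (auto simp: F_def a_def)
  define ord where "ord P = nat (fls_subdegree (germ P X))" for P
  have ord: "fls_subdegree (germ P X) = int (ord P)" if "P \<noteq> infty" for P
    using germ_holomorphic(1)[OF X that] by (simp add: ord_def)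
  have ord_pos: "ord P > 0" if "P \<in> F" for P
  proof (rule ccontr)
    assume "\<not> ord P > 0"
    then have "fls_nth (germ P X) 0 \<noteq> 0"
      using nth_fls_subdegree_nonzero[OF germ_fibre_nonzero[of P a]] ord[of P] that
      by (simp add: X_def F_def)
    then show False using germ_holomorphic(2)[OF X] that by (simp add: X_def F_def cst_def)
  qed
  define ebase where "ebase k = (LEAST h. h \<in> H \<and> h mod r = k)" for k
  have ebase: "ebase k \<in> H" "ebase k mod r = k" "\<And>h. h \<in> H \<Longrightarrow> h mod r = k \<Longrightarrow> ebase k \<le> h"
    if k: "k < r" for k
  proof -
    obtain h where "h \<in> H \<and> h mod r = k" using H_residues[OF k] by blast
    then have "ebase k \<in> H \<and> ebase k mod r = k" unfolding ebase_def by (rule LeastI)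
    then show "ebase k \<in> H" "ebase k mod r = k" by auto
    show "\<And>h. h \<in> H \<Longrightarrow> h mod r = k \<Longrightarrow> ebase k \<le> h" unfolding ebase_def by (rule Least_le) simp
  qed
  have "\<forall>k<r. \<exists>g. g \<in> RX \<and> germ infty g \<noteq> 0 \<and> fls_subdegree (germ infty g) = - int (ebase k)"
    using function_of_order ebase(1) by blast
  then obtain b where b: "\<And>k. k < r \<Longrightarrow> b k \<in> RX \<and> germ infty (b k) \<noteq> 0 \<and>
      fls_subdegree (germ infty (b k)) = - int (ebase k)" by metis
  \<comment> \<open>the order conditions on the fibre; that at \<open>Q0\<close> for the value repeats the one at \<open>P0\<close>\<close>
  define E where "E = (SIGMA P:F. {..<ord P}) - {(Q0, 0)}"
  have finE: "finite E" unfolding E_def using F by (intro finite_Diff finite_SigmaI) auto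
  have "(Q0, 0) \<in> (SIGMA P:F. {..<ord P})" using F ord_pos by auto
  then have "card E < card (SIGMA P:F. {..<ord P})"
    unfolding E_def using F by (intro psubset_card_mono finite_SigmaI) auto
  also have "\<dots> = (\<Sum>P\<in>F. ord P)" using F by (subst card_SigmaI) auto
  also have "\<dots> \<le> r" using fibre_orders_le[of a] by (simp add: F_def ord_def X_def)
  finally have "card E < card {..<r}" by simp
  then obtain c where c: "\<exists>k\<in>{..<r}. c k \<noteq> 0"
    "\<forall>e\<in>E. (\<Sum>k\<in>{..<r}. c k * (case e of (P, j) \<Rightarrow> fls_nth (germ P (b k)) (int j))) = 0"
    using nontrivial_solution[OF finE finite_lessThan,
        of r "\<lambda>e k. case e of (P, j) \<Rightarrow> fls_nth (germ P (b k)) (int j)"] by blast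
  define G where "G = (\<lambda>Q. \<Sum>k\<in>{..<r}. c k * b k Q)"
  have G: "G \<in> RX" unfolding G_def using b by (intro RX_sum RX_scale) auto
  have germG: "germ P G = (\<Sum>k\<in>{..<r}. fls_const (c k) * germ P (b k))" for P
    unfolding G_def using b by (subst germ_sum) (auto intro!: RX_scale sum.cong germ_scale)
  have coeff: "fls_nth (germ P G) (int j) = 0" if "P \<in> F" "j < ord P" for P j
  proof -
    have inE: "fls_nth (germ P G) (int j) = 0" if "(P, j) \<in> E" for P j
      using c(2) that by (auto simp: germG fls_nth_sum)
    show ?thesis
    proof (cases "(P, j) = (Q0, 0)")
      case True
      have "(P0, 0) \<in> E" using F ord_pos ne by (auto simp: E_def)
      then have "G P0 = 0" using inE[of P0 0] germ_holomorphic(2)[OF G P0] by simp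
      then show ?thesis using True same[OF G] germ_holomorphic(2)[OF G Q0] by simp
    next
      case False
      then show ?thesis using that by (intro inE) (auto simp: E_def)
    qed
  qed
  have div: "germ P G = 0 \<or> fls_subdegree (germ P X) \<le> fls_subdegree (germ P G)" if P: "P \<noteq> infty" for P
  proof (cases "P \<in> F")
    case True
    have "int (ord P) \<le> fls_subdegree (germ P G)" if nz: "germ P G \<noteq> 0"
    proof (rule fls_subdegree_geI[OF nz])
      fix k assume k: "k < int (ord P)"
      show "fls_nth (germ P G) k = 0"
      proof (cases "k < 0")
        case True
        then show ?thesis using germ_holomorphic(1)[OF G P] by simp
      next
        case False
        then show ?thesis using coeff[OF \<open>P \<in> F\<close>, of "nat k"] k by simp
      qed
    qed
    then show ?thesis using ord[OF P] by auto
  next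
    case False
    then have "fls_nth (germ P X) 0 \<noteq> 0"
      using P germ_holomorphic(2)[OF X P] by (simp add: F_def X_def cst_def)
    then have "fls_subdegree (germ P X) \<le> 0" by (rule fls_subdegree_leI)
    then show ?thesis using germ_holomorphic(1)[OF G P] by simp
  qed
  have Xnz: "germ P X \<noteq> 0" for P unfolding X_def by (rule germ_fibre_nonzero)
  from RX_divide[OF G X Xnz div] obtain h where h: "h \<in> RX" and prod: "\<forall>P. germ P h * germ P X = germ P G"
    by (rule bexE)
  have prod_infty: "germ infty h * germ infty X = germ infty G" using prod by (rule spec)
  have inj: "inj_on ebase {..<r}"
    by (rule inj_on_inverseI[of _ "\<lambda>n. n mod r"]) (simp add: ebase(2))
  have b': "germ infty (b k) \<noteq> 0 \<and> fls_subdegree (germ infty (b k)) = - int (ebase k)" if "k \<in> {..<r}" for k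
    using b that by simp
  from fls_subdegree_combination[of "{..<r}" "\<lambda>k. germ infty (b k)" ebase c, OF finite_lessThan b' inj c(1)]
  obtain k where "k \<in> {..<r}"
    and k': "germ infty G \<noteq> 0 \<and> fls_subdegree (germ infty G) = - int (ebase k)"
    unfolding germG by (rule bexE)
  then have k: "k < r" "germ infty G \<noteq> 0" "fls_subdegree (germ infty G) = - int (ebase k)" by simp_all
  have hnz: "germ infty h \<noteq> 0" using prod_infty k(2) by auto
  have "fls_subdegree (germ infty h) + fls_subdegree (germ infty X) = - int (ebase k)"
    using fls_subdegree_mult[OF hnz Xnz[of infty]] k(3) unfolding prod_infty by simp
  then have hdeg: "fls_subdegree (germ infty h) = int r - int (ebase k)"
    using fibre_order_at_infty[of a] by (simp add: X_def)
  show False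
  proof (cases "ebase k < r")
    case True
    then obtain c' where "h = cst c'" using no_pole_constant[OF h] hdeg by auto
    then show False using hdeg True by (simp add: germ_cst)
  next
    case False
    have "nat (- fls_subdegree (germ infty h)) = ebase k - r" using hdeg False by simp
    then have "ebase k - r \<in> H" using pole_order_in_H[OF h] by simp
    moreover have "(ebase k - r) mod r = k" using False ebase(2)[OF k(1)] by (simp add: le_mod_geq)
    ultimately have "ebase k \<le> ebase k - r" using ebase(3)[OF k(1)] by blast
    then show False using r_pos False by simp
  qed
qed

section \<open>The coordinates generate the ring\<close>

lemma curve_eval_cst: "curve_eval infty x y (mconst c) = cst c"
  by (auto simp: curve_eval_def cst_def)

lemma curve_eval_add: "curve_eval infty x y (p + q) = (\<lambda>P. curve_eval infty x y p P + curve_eval infty x y q P)"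
  by (auto simp: curve_eval_def mpoly_eval_add)

lemma curve_eval_mult: "curve_eval infty x y (p * q) = (\<lambda>P. curve_eval infty x y p P * curve_eval infty x y q P)"
  by (auto simp: curve_eval_def mpoly_eval_mult)

lemma curve_eval_mvar:
  "curve_eval infty x y (mvar Vx) = x" "curve_eval infty x y (mvar (Vxi i)) = x"
  "i \<in> {2..m} \<Longrightarrow> curve_eval infty x y (mvar (Vy i)) = y i"
  using RX_infty[OF x_in] RX_infty[OF y_in] by (auto simp: curve_eval_def curve_coord_def fun_eq_iff)

lemma curve_eval_in_RX:
  assumes "p \<in> carrier (mpoly_ring (diag_vars m))"
  shows "curve_eval infty x y p \<in> RX"
  using assms
proof (induction rule: mpoly_induct)
  case (var v)
  then show ?case by (cases v) (auto simp: curve_eval_mvar x_in y_in)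
qed (auto simp: curve_eval_cst RX_cst curve_eval_add RX_add curve_eval_mult RX_mult)

lemma curve_eval_hom:
  assumes "V \<subseteq> diag_vars m"
  shows "curve_eval infty x y \<in> ring_hom (mpoly_ring V) (curve_ring atl infty)"
proof (rule ring_hom_memI)
  show "curve_eval infty x y p \<in> carrier (curve_ring atl infty)" if "p \<in> carrier (mpoly_ring V)" for p
    using curve_eval_in_RX that mpoly_ring_mono[OF assms] by (auto simp: curve_ring_def)
qed (simp_all add: curve_ring_def curve_eval_add curve_eval_mult, simp add: curve_eval_def cong: if_cong)

text \<open>Every pole order is that of a monomial, and subtracting a multiple of the monomial lowers the
  pole order.\<close>

lemma curve_eval_surjective:
  assumes V: "V \<subseteq> diag_vars m" and yV: "\<And>i. i \<in> {2..m} \<Longrightarrow> Vy i \<in> V"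
    and u: "u \<in> V" "curve_eval infty x y (mvar u) = x"
    and g: "g \<in> RX"
  shows "\<exists>p\<in>carrier (mpoly_ring V). g = curve_eval infty x y p"
proof -
  let ?ev = "curve_eval infty x y"
  have ev: "?ev p \<in> RX" if "p \<in> carrier (mpoly_ring V)" for p
    using curve_eval_in_RX that mpoly_ring_mono[OF V] by blast
  define has where "has n \<longleftrightarrow> (\<exists>p\<in>carrier (mpoly_ring V). germ infty (?ev p) \<noteq> 0 \<and>
      fls_subdegree (germ infty (?ev p)) = - int n)" for n
  have has0: "has 0"
    unfolding has_def by (rule bexI[of _ "mconst 1"]) (simp_all add: curve_eval_cst germ_cst)
  have has_add: "has (n + n')" if n: "has n" "has n'" for n n'
  proof -
    obtain p q where "p \<in> carrier (mpoly_ring V)" "germ infty (?ev p) \<noteq> 0"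
        "fls_subdegree (germ infty (?ev p)) = - int n"
      "q \<in> carrier (mpoly_ring V)" "germ infty (?ev q) \<noteq> 0"
        "fls_subdegree (germ infty (?ev q)) = - int n'"
      using n unfolding has_def by blast
    then show ?thesis unfolding has_def
      by (intro bexI[of _ "p * q"]) (auto simp: curve_eval_mult germ_mult ev mult_in_mpoly_ring)
  qed
  have has_mult: "has (k * n)" if "has n" for k n
    using that by (induction k) (auto simp: has0 has_add)
  have has_gen: "has (gen i)" if i: "i \<in> {1..m}" for i
  proof (cases "i = 1")
    case True
    have "germ infty x \<noteq> 0" using x_order r_pos by auto
    then show ?thesis unfolding has_def using True u x_order
      by (intro bexI[of _ "mvar u"]) (auto simp: r_def)
  next
    case False
    then have i2: "i \<in> {2..m}" using i by auto
    have "germ infty (y i) \<noteq> 0" using y_order[OF i2] gen_pos[OF i] by auto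
    then show ?thesis unfolding has_def using i2 yV[OF i2] y_order[OF i2]
      by (intro bexI[of _ "mvar (Vy i)"]) (auto simp: curve_eval_mvar)
  qed
  have hasH: "has n" if n: "n \<in> H" for n
  proof -
    obtain c where c: "n = (\<Sum>g\<in>gen ` {1..m}. c g * g)"
      using n unfolding span[symmetric] semigroup_span_def by blast
    have "has (\<Sum>g\<in>A. c g * g)" if "A \<subseteq> gen ` {1..m}" for A
      using that
    proof (induction A rule: infinite_finite_induct)
      case (insert g A)
      then have "has g" using has_gen by blast
      then show ?case using insert has_add has_mult by simp
    qed (auto simp: has0)
    then show ?thesis unfolding c by simp
  qed
  show ?thesis using g
  proof (induction "nat (- fls_subdegree (germ infty g))" arbitrary: g rule: less_induct)
    case (less g)
    define n where "n = nat (- fls_subdegree (germ infty g))"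
    show ?case
    proof (cases "fls_subdegree (germ infty g) \<ge> 0")
      case True
      then obtain c where "g = cst c" using no_pole_constant less.prems by blast
      then show ?thesis by (intro bexI[of _ "mconst c"]) (simp_all add: curve_eval_cst)
    next
      case False
      then have n: "fls_subdegree (germ infty g) = - int n" "n > 0" by (auto simp: n_def)
      have "n \<in> H" using pole_order_in_H[OF less.prems] by (simp add: n_def)
      then obtain p where p: "p \<in> carrier (mpoly_ring V)" "germ infty (?ev p) \<noteq> 0"
        "fls_subdegree (germ infty (?ev p)) = - int n" using hasH unfolding has_def by blast
      define l where "l = fls_nth (germ infty g) (- int n) / fls_nth (germ infty (?ev p)) (- int n)"
      define g' where "g' = (\<lambda>P. g P - l * ?ev p P)"
      have g': "g' \<in> RX" unfolding g'_def by (intro RX_diff RX_scale ev p less.prems)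
      have germ': "germ infty g' = germ infty g - fls_const l * germ infty (?ev p)"
        unfolding g'_def using less.prems ev[OF p(1)] by (simp add: germ_diff RX_scale germ_scale)
      have "fls_nth (germ infty (?ev p)) (- int n) \<noteq> 0"
        using p(2,3) nth_fls_subdegree_nonzero by metis
      then have low: "fls_nth (germ infty g') k = 0" if "k \<le> - int n" for k
        using that n p(3) by (cases "k = - int n") (auto simp: germ' l_def)
      have "germ infty g' = 0 \<or> - int n < fls_subdegree (germ infty g')"
        using fls_subdegree_greaterI[of "germ infty g'" "- int n"] low by blast
      then have "nat (- fls_subdegree (germ infty g')) < n" using n(2) by auto
      then obtain q where q: "q \<in> carrier (mpoly_ring V)" "g' = ?ev q"
        using less.hyps[of g'] g' n_def by blast
      have "g P = ?ev (q + mconst l * p) P" for P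
        using fun_cong[OF q(2), of P] RX_infty[OF less.prems] RX_infty[OF ev[OF p(1)]] RX_infty[OF ev[OF q(1)]]
        by (auto simp: curve_eval_add curve_eval_mult curve_eval_cst g'_def cst_def diff_eq_eq)
      then have "g = ?ev (q + mconst l * p)" by blast
      moreover have "q + mconst l * p \<in> carrier (mpoly_ring V)"
        using p q by (intro add_in_mpoly_ring mult_in_mpoly_ring) auto
      ultimately show ?thesis by blast
    qed
  qed
qed

end

section \<open>The homomorphisms and the embeddings\<close>

lemma map_poly_mconst_add: "map_poly mconst (p + q) = map_poly mconst p + map_poly mconst q"
  by (rule poly_eqI) (simp add: coeff_map_poly mconst_hom.h_zero mconst_hom.h_add)

lemma map_poly_mconst_mult: "map_poly mconst (p * q) = map_poly mconst p * map_poly mconst q"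
proof (rule poly_eqI)
  have sum: "mconst (sum g A) = (\<Sum>a\<in>A. mconst (g a))" for g :: "nat \<Rightarrow> complex" and A
    by (induction A rule: infinite_finite_induct) (auto simp: mconst_hom.h_zero mconst_hom.h_add)
  show "coeff (map_poly mconst (p * q)) n = coeff (map_poly mconst p * map_poly mconst q) n" for n
    by (simp add: coeff_map_poly coeff_mult mconst_hom.h_zero mconst_hom.h_mult sum)
qed

lemma base_ring_univariate:
  assumes "p \<in> carrier base_ring"
  shows "\<exists>c. p = poly (map_poly mconst c) (mvar Vx)"
  using assms unfolding base_ring_def
proof (induction rule: mpoly_induct)
  case (const c)
  show ?case by (intro exI[of _ "[:c:]"]) (simp add: map_poly_pCons mconst_hom.h_zero)
next
  case (var v)
  then show ?case
    by (intro exI[of _ "[:0, 1:]"]) (simp add: map_poly_pCons mconst_hom.h_zero mconst_hom.h_one base_vars_def)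
next
  case (add p q)
  then show ?case by (metis map_poly_mconst_add poly_add)
next
  case (mult p q)
  then show ?case by (metis map_poly_mconst_mult poly_mult)
qed

lemma mpoly_eval_diagonal:
  "p \<in> carrier (mpoly_ring (diag_vars m)) \<Longrightarrow>
    mpoly_eval (curve_coord x y P) (mpoly_subst diagonal p) = mpoly_eval (curve_coord x y P) p"
proof (induction rule: mpoly_induct)
  case (var v)
  then show ?case by (cases v) (simp_all add: diagonal_def curve_coord_def)
qed (simp_all add: mpoly_subst_add mpoly_subst_mult mpoly_eval_add mpoly_eval_mult)

lemma mpoly_eval_curve_point:
  "p \<in> carrier (mpoly_ring V) \<Longrightarrow> P \<noteq> infty \<Longrightarrow>
    mpoly_eval (curve_point V x y P) p = curve_eval infty x y p P"
  by (simp add: curve_eval_def curve_point_def cong: mpoly_eval_cong)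

context weierstrass
begin

lemma ring_curve_ring: "ring (curve_ring atl infty)"
  using cring_curve_ring cring.axioms(1) by blast

text \<open>A polynomial in \<open>x\<close> alone that vanishes on the curve vanishes at all complex numbers, because \<open>x\<close> is onto.\<close>

lemma inj_curve_eval_base: "inj_on (curve_eval infty x y) (carrier base_ring)"
proof (rule inj_onI)
  fix p q assume pq: "p \<in> carrier base_ring" "q \<in> carrier base_ring"
    and eq: "curve_eval infty x y p = curve_eval infty x y q"
  obtain c d where c: "p = poly (map_poly mconst c) (mvar Vx)" and d: "q = poly (map_poly mconst d) (mvar Vx)"
    using base_ring_univariate pq by blast
  have "poly c a = poly d a" for a
  proof -
    obtain P where P: "P \<noteq> infty" "x P = a" using x_surjective by blast
    have "mpoly_eval (curve_coord x y P) p = mpoly_eval (curve_coord x y P) q"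
      using fun_cong[OF eq, of P] P by (simp add: curve_eval_def)
    then show ?thesis using P by (simp add: c d mpoly_eval_univariate curve_coord_def)
  qed
  then have "c = d" using poly_eq_poly_eq_iff by blast
  then show "p = q" by (simp add: c d)
qed

text \<open>All functions are polynomials in the coordinates, and the functions separate points.\<close>

lemma inj_curve_point:
  assumes V: "V \<subseteq> diag_vars m" and yV: "\<And>i. i \<in> {2..m} \<Longrightarrow> Vy i \<in> V"
    and u: "u \<in> V" "curve_eval infty x y (mvar u) = x"
  shows "inj_on (curve_point V x y) (- {infty})"
proof (rule inj_onI)
  fix P Q assume P: "P \<in> - {infty}" and Q: "Q \<in> - {infty}" and eq: "curve_point V x y P = curve_point V x y Q"
  have "g P = g Q" if "g \<in> RX" for g
  proof -
    obtain p where p: "p \<in> carrier (mpoly_ring V)" "g = curve_eval infty x y p"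
      using curve_eval_surjective[OF V yV u \<open>g \<in> RX\<close>] by blast
    show ?thesis
      using mpoly_eval_curve_point[OF p(1), of P infty x y] mpoly_eval_curve_point[OF p(1), of Q infty x y]
        P Q eq p(2) by simp
  qed
  then show "P = Q" using separates_points[of P Q] P Q by blast
qed

lemma curve_eval_relation:
  assumes rel: "\<And>P. P \<noteq> infty \<Longrightarrow> poly2 f (x P) (y i P) = 0"
    and u: "\<And>P. curve_coord x y P u = x P"
  shows "curve_eval infty x y (subst2 f u (Vy i)) = \<zero>\<^bsub>curve_ring atl infty\<^esub>"
proof -
  have "curve_eval infty x y (subst2 f u (Vy i)) P = 0" for P
    by (simp add: curve_eval_def mpoly_eval_subst2 u) (simp add: curve_coord_def rel)
  then show ?thesis by (simp add: curve_ring_def fun_eq_iff)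
qed

end

theorem proposition3p15:
  fixes atl :: "('a::t2_space set \<times> ('a \<Rightarrow> complex)) set" and infty :: 'a
    and m :: nat and gen :: "nat \<Rightarrow> nat"
    and x :: "'a \<Rightarrow> complex" and y :: "nat \<Rightarrow> 'a \<Rightarrow> complex"
    and fX :: "complex poly poly" and f :: "nat \<Rightarrow> complex poly poly"
  assumes "weierstrass_curve atl infty m gen x y fX"
    and "\<forall>i\<in>{2..m}. irreducible (f i) \<and> lead_coeff (f i) = 1 \<and>
           (\<forall>P. P \<noteq> infty \<longrightarrow> poly2 (f i) (x P) (y i P) = 0)"
  shows "\<exists>\<phi> \<iota> \<kappa> \<theta>.
    \<comment> \<open>the homomorphisms between the affine rings\<close>
    \<phi> \<in> ring_hom (tensor_ring m f) (curve_ring atl infty) \<and>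
    \<phi> ` carrier (tensor_ring m f) = carrier (curve_ring atl infty) \<and>
    (\<forall>p\<in>carrier (mpoly_ring (tensor_vars m)).
       \<phi> (tensor_class m f p) = curve_eval infty x y p) \<and>
    \<iota> \<in> ring_hom base_ring (tensor_ring m f) \<and>
    inj_on \<iota> (carrier base_ring) \<and>
    (\<forall>p\<in>carrier base_ring. \<iota> p = tensor_class m f p) \<and>
    (\<forall>p\<in>carrier base_ring. \<phi> (\<iota> p) = curve_eval infty x y p) \<and>
    inj_on (curve_eval infty x y) (carrier base_ring) \<and>
    \<comment> \<open>dually, the injection into the fibre product: on spectra and on points\<close>
    Spec_map (tensor_ring m f) \<phi> ` Spec (curve_ring atl infty) \<subseteq> Spec (tensor_ring m f) \<and>
    inj_on (Spec_map (tensor_ring m f) \<phi>) (Spec (curve_ring atl infty)) \<and>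
    (\<forall>q\<in>Spec (curve_ring atl infty).
       Spec_map base_ring \<iota> (Spec_map (tensor_ring m f) \<phi> q) =
       Spec_map base_ring (curve_eval infty x y) q) \<and>
    curve_point (tensor_vars m) x y ` (- {infty}) \<subseteq> fibre_product_points m f \<and>
    inj_on (curve_point (tensor_vars m) x y) (- {infty}) \<and>
    (\<forall>P\<in>- {infty}. curve_point (tensor_vars m) x y P Vx = x P) \<and>
    (\<forall>P\<in>- {infty}. Spec_map (tensor_ring m f) \<phi> (curve_point_ideal atl infty P) =
       tensor_point_ideal m f (curve_point (tensor_vars m) x y P)) \<and>
    \<comment> \<open>dividing by the ideal generated by all \<open>x - x_i\<close>\<close>
    \<kappa> \<in> ring_iso (diag_ring m f) (tensor_ring m f) \<and>
    \<kappa> (diag_class m f (mvar Vx)) = tensor_class m f (mvar Vx) \<and>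
    (\<forall>i\<in>{2..m}. \<kappa> (diag_class m f (mvar (Vxi i))) = tensor_class m f (mvar Vx) \<and>
       \<kappa> (diag_class m f (mvar (Vy i))) = tensor_class m f (mvar (Vy i))) \<and>
    (\<forall>c. \<kappa> (diag_class m f (mconst c)) = tensor_class m f (mconst c)) \<and>
    \<theta> \<in> ring_hom (product_ring m f) (curve_ring atl infty) \<and>
    (\<forall>p\<in>carrier (mpoly_ring (product_vars m)).
       \<theta> (product_class m f p) = \<phi> (\<kappa> (diag_class m f p)) \<and>
       \<theta> (product_class m f p) = curve_eval infty x y p) \<and>
    \<comment> \<open>the embedding into the product configuration: on spectra and on points\<close>
    closed_embedding_of_spectra (product_ring m f) (curve_ring atl infty) \<theta> \<and>
    curve_point (product_vars m) x y ` (- {infty}) \<subseteq> product_points m f \<and>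
    inj_on (curve_point (product_vars m) x y) (- {infty}) \<and>
    (\<forall>P\<in>- {infty}. Spec_map (product_ring m f) \<theta> (curve_point_ideal atl infty P) =
       product_point_ideal m f (curve_point (product_vars m) x y P)) \<and>
    \<comment> \<open>the ambient projective space of the product configuration\<close>
    card (product_vars m) = 2 * (m - 1) \<and>
    affine_chart ` product_points m f \<subseteq> projective_space (product_vars m) \<and>
    inj_on affine_chart (product_points m f)"
proof -
  have surface: "compact_riemann_surface atl"
    using assms(1)[unfolded weierstrass_curve_def Let_def] by (rule conjunct1)
  interpret weierstrass atl infty m gen x y fX
    by unfold_locales (fact surface, fact assms(1))
  let ?ev = "curve_eval infty x y"
  have rel: "poly2 (f i) (x P) (y i P) = 0" if "i \<in> {2..m}" "P \<noteq> infty" for i P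
    using assms(2) that by blast
  have tensor_sub: "tensor_vars m \<subseteq> diag_vars m" and product_sub: "product_vars m \<subseteq> diag_vars m"
    by (rule vars_subset)+
  have base_sub: "carrier base_ring \<subseteq> carrier (mpoly_ring (tensor_vars m))"
    unfolding base_ring_def by (rule mpoly_ring_mono[OF vars_subset(1)])
  have Vxi2: "Vxi 2 \<in> product_vars m" using m_ge by simp
  have "\<exists>\<phi>. \<phi> \<in> ring_hom (tensor_ring m f) (curve_ring atl infty) \<and>
      (\<forall>p\<in>carrier (mpoly_ring (tensor_vars m)). \<phi> (tensor_class m f p) = ?ev p)"
    unfolding tensor_ring_def tensor_class_def tensor_ideal_def
  proof (rule quotient_hom_exists[OF ring_mpoly_ring ring_curve_ring curve_eval_hom[OF tensor_sub] tensor_gens])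
    fix p assume "p \<in> (\<lambda>i. subst2 (f i) Vx (Vy i)) ` {2..m}"
    then obtain i where i: "i \<in> {2..m}" "p = subst2 (f i) Vx (Vy i)" by blast
    then show "?ev p = \<zero>\<^bsub>curve_ring atl infty\<^esub>"
      by (simp only:) (rule curve_eval_relation, simp_all add: rel curve_coord_def)
  qed
  then obtain \<phi> where \<phi>: "\<phi> \<in> ring_hom (tensor_ring m f) (curve_ring atl infty)"
    and \<phi>_class: "\<And>p. p \<in> carrier (mpoly_ring (tensor_vars m)) \<Longrightarrow> \<phi> (tensor_class m f p) = ?ev p"
    by blast
  have "\<exists>\<theta>. \<theta> \<in> ring_hom (product_ring m f) (curve_ring atl infty) \<and>
      (\<forall>p\<in>carrier (mpoly_ring (product_vars m)). \<theta> (product_class m f p) = ?ev p)"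
    unfolding product_ring_def product_class_def product_ideal_def
  proof (rule quotient_hom_exists[OF ring_mpoly_ring ring_curve_ring curve_eval_hom[OF product_sub] product_gens])
    fix p assume "p \<in> (\<lambda>i. subst2 (f i) (Vxi i) (Vy i)) ` {2..m}"
    then obtain i where i: "i \<in> {2..m}" "p = subst2 (f i) (Vxi i) (Vy i)" by blast
    then show "?ev p = \<zero>\<^bsub>curve_ring atl infty\<^esub>"
      by (simp only:) (rule curve_eval_relation, simp_all add: rel curve_coord_def)
  qed
  then obtain \<theta> where \<theta>: "\<theta> \<in> ring_hom (product_ring m f) (curve_ring atl infty)"
    and \<theta>_class: "\<And>p. p \<in> carrier (mpoly_ring (product_vars m)) \<Longrightarrow> \<theta> (product_class m f p) = ?ev p"
    by blast
  obtain \<kappa> where \<kappa>: "\<kappa> \<in> ring_iso (diag_ring m f) (tensor_ring m f)"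
    and \<kappa>_class: "\<And>p. p \<in> carrier (mpoly_ring (diag_vars m)) \<Longrightarrow>
      \<kappa> (diag_class m f p) = tensor_class m f (mpoly_subst diagonal p)"
    using diag_ring_iso_tensor_ring[of m f] by blast
  have \<phi>_surj: "\<phi> ` carrier (tensor_ring m f) = carrier (curve_ring atl infty)"
  proof
    show "\<phi> ` carrier (tensor_ring m f) \<subseteq> carrier (curve_ring atl infty)"
      using ring_hom_closed[OF \<phi>] by blast
    show "carrier (curve_ring atl infty) \<subseteq> \<phi> ` carrier (tensor_ring m f)"
    proof
      fix g assume "g \<in> carrier (curve_ring atl infty)"
      then have "g \<in> RX" by (simp add: curve_ring_def)
      then obtain p where p: "p \<in> carrier (mpoly_ring (tensor_vars m))" "g = ?ev p"
        using curve_eval_surjective[OF tensor_sub, of Vx g] curve_eval_mvar(1) by auto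
      then show "g \<in> \<phi> ` carrier (tensor_ring m f)"
        using \<phi>_class ring_hom_closed[OF tensor_class_hom p(1)] by (intro image_eqI) auto
    qed
  qed
  have \<theta>_surj: "\<theta> ` carrier (product_ring m f) = carrier (curve_ring atl infty)"
  proof
    show "\<theta> ` carrier (product_ring m f) \<subseteq> carrier (curve_ring atl infty)"
      using ring_hom_closed[OF \<theta>] by blast
    show "carrier (curve_ring atl infty) \<subseteq> \<theta> ` carrier (product_ring m f)"
    proof
      fix g assume "g \<in> carrier (curve_ring atl infty)"
      then have "g \<in> RX" by (simp add: curve_ring_def)
      then obtain p where p: "p \<in> carrier (mpoly_ring (product_vars m))" "g = ?ev p"
        using curve_eval_surjective[OF product_sub, of "Vxi 2" g] curve_eval_mvar(2) Vxi2 by auto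
      then show "g \<in> \<theta> ` carrier (product_ring m f)"
        using \<theta>_class ring_hom_closed[OF product_class_hom p(1)] by (intro image_eqI) auto
    qed
  qed
  have \<iota>: "tensor_class m f \<in> ring_hom base_ring (tensor_ring m f)"
  proof (rule ring_hom_memI)
    fix p assume "p \<in> carrier base_ring"
    then have p: "p \<in> carrier (mpoly_ring (tensor_vars m))" using base_sub by blast
    show "tensor_class m f p \<in> carrier (tensor_ring m f)" by (rule ring_hom_closed[OF tensor_class_hom p])
    fix q assume "q \<in> carrier base_ring"
    then have q: "q \<in> carrier (mpoly_ring (tensor_vars m))" using base_sub by blast
    show "tensor_class m f (p \<otimes>\<^bsub>base_ring\<^esub> q) = tensor_class m f p \<otimes>\<^bsub>tensor_ring m f\<^esub> tensor_class m f q"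
      using ring_hom_mult[OF tensor_class_hom p q, of f] by (simp add: base_ring_def)
    show "tensor_class m f (p \<oplus>\<^bsub>base_ring\<^esub> q) = tensor_class m f p \<oplus>\<^bsub>tensor_ring m f\<^esub> tensor_class m f q"
      using ring_hom_add[OF tensor_class_hom p q, of f] by (simp add: base_ring_def)
  qed (use ring_hom_one[OF tensor_class_hom, of m f] in \<open>simp add: base_ring_def\<close>)
  have \<phi>\<iota>: "\<phi> (tensor_class m f p) = ?ev p" if "p \<in> carrier base_ring" for p
    using \<phi>_class base_sub that by blast
  have \<iota>_inj: "inj_on (tensor_class m f) (carrier base_ring)"
    using inj_curve_eval_base \<phi>\<iota> by (metis (no_types, lifting) inj_on_def)
  have Spec_comp: "Spec_map base_ring (tensor_class m f) (Spec_map (tensor_ring m f) \<phi> q)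
      = Spec_map base_ring ?ev q" for q
    unfolding Spec_map_def using ring_hom_closed[OF \<iota>] \<phi>\<iota> by auto
  have tensor_points: "curve_point (tensor_vars m) x y ` (- {infty}) \<subseteq> fibre_product_points m f"
    using rel by (auto simp: fibre_product_points_def plane_curve_def curve_point_def curve_coord_def)
  have product_points: "curve_point (product_vars m) x y ` (- {infty}) \<subseteq> product_points m f"
    using rel by (auto simp: product_points_def plane_curve_def curve_point_def curve_coord_def)
  have tensor_inj: "inj_on (curve_point (tensor_vars m) x y) (- {infty})"
    by (rule inj_curve_point[OF tensor_sub, of Vx]) (simp_all add: curve_eval_mvar)
  have product_inj: "inj_on (curve_point (product_vars m) x y) (- {infty})"
    by (rule inj_curve_point[OF product_sub, of "Vxi 2"]) (use Vxi2 in \<open>simp_all add: curve_eval_mvar\<close>)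
  have tensor_point: "Spec_map (tensor_ring m f) \<phi> (curve_point_ideal atl infty P) =
      tensor_point_ideal m f (curve_point (tensor_vars m) x y P)" if P: "P \<in> - {infty}" for P
  proof -
    have key: "\<phi> (tensor_class m f p) \<in> curve_point_ideal atl infty P \<longleftrightarrow>
        mpoly_eval (curve_point (tensor_vars m) x y P) p = 0"
      if p: "p \<in> carrier (mpoly_ring (tensor_vars m))" for p
      using \<phi>_class[OF p] mpoly_eval_curve_point[OF p, of P infty x y] P
        ring_hom_closed[OF curve_eval_hom[OF tensor_sub] p]
      by (simp add: curve_point_ideal_def)
    show ?thesis
    proof (intro equalityI subsetI)
      fix C assume "C \<in> Spec_map (tensor_ring m f) \<phi> (curve_point_ideal atl infty P)"
      then have C: "C \<in> carrier (tensor_ring m f)" "\<phi> C \<in> curve_point_ideal atl infty P"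
        by (simp_all add: Spec_map_def)
      obtain p where "p \<in> carrier (mpoly_ring (tensor_vars m))" "C = tensor_class m f p"
        by (rule tensor_class_surj[OF C(1)])
      then show "C \<in> tensor_point_ideal m f (curve_point (tensor_vars m) x y P)"
        using key C(2) by (simp add: tensor_point_ideal_def)
    next
      fix C assume "C \<in> tensor_point_ideal m f (curve_point (tensor_vars m) x y P)"
      then obtain p where p: "p \<in> carrier (mpoly_ring (tensor_vars m))"
        "mpoly_eval (curve_point (tensor_vars m) x y P) p = 0" "C = tensor_class m f p"
        by (auto simp: tensor_point_ideal_def)
      then show "C \<in> Spec_map (tensor_ring m f) \<phi> (curve_point_ideal atl infty P)"
        using key[OF p(1)] ring_hom_closed[OF tensor_class_hom p(1)] by (simp add: Spec_map_def)
    qed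
  qed
  have product_point: "Spec_map (product_ring m f) \<theta> (curve_point_ideal atl infty P) =
      product_point_ideal m f (curve_point (product_vars m) x y P)" if P: "P \<in> - {infty}" for P
  proof -
    have key: "\<theta> (product_class m f p) \<in> curve_point_ideal atl infty P \<longleftrightarrow>
        mpoly_eval (curve_point (product_vars m) x y P) p = 0"
      if p: "p \<in> carrier (mpoly_ring (product_vars m))" for p
      using \<theta>_class[OF p] mpoly_eval_curve_point[OF p, of P infty x y] P
        ring_hom_closed[OF curve_eval_hom[OF product_sub] p]
      by (simp add: curve_point_ideal_def)
    show ?thesis
    proof (intro equalityI subsetI)
      fix C assume "C \<in> Spec_map (product_ring m f) \<theta> (curve_point_ideal atl infty P)"
      then have C: "C \<in> carrier (product_ring m f)" "\<theta> C \<in> curve_point_ideal atl infty P"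
        by (simp_all add: Spec_map_def)
      obtain p where "p \<in> carrier (mpoly_ring (product_vars m))" "C = product_class m f p"
        by (rule product_class_surj[OF C(1)])
      then show "C \<in> product_point_ideal m f (curve_point (product_vars m) x y P)"
        using key C(2) by (simp add: product_point_ideal_def)
    next
      fix C assume "C \<in> product_point_ideal m f (curve_point (product_vars m) x y P)"
      then obtain p where p: "p \<in> carrier (mpoly_ring (product_vars m))"
        "mpoly_eval (curve_point (product_vars m) x y P) p = 0" "C = product_class m f p"
        by (auto simp: product_point_ideal_def)
      then show "C \<in> Spec_map (product_ring m f) \<theta> (curve_point_ideal atl infty P)"
        using key[OF p(1)] ring_hom_closed[OF product_class_hom p(1)] by (simp add: Spec_map_def)
    qed
  qed
  have \<theta>_factor: "\<theta> (product_class m f p) = \<phi> (\<kappa> (diag_class m f p)) \<and> \<theta> (product_class m f p) = ?ev p"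
    if p: "p \<in> carrier (mpoly_ring (product_vars m))" for p
  proof -
    have p': "p \<in> carrier (mpoly_ring (diag_vars m))" using mpoly_ring_mono[OF product_sub] p by blast
    have "\<phi> (\<kappa> (diag_class m f p)) = ?ev (mpoly_subst diagonal p)"
      by (simp add: \<kappa>_class[OF p'] \<phi>_class mpoly_subst_diagonal_closed[OF p'])
    also have "\<dots> = ?ev p" unfolding curve_eval_def by (simp only: mpoly_eval_diagonal[OF p'])
    finally show ?thesis using \<theta>_class[OF p] by simp
  qed
  have \<kappa>_vars: "\<kappa> (diag_class m f (mvar Vx)) = tensor_class m f (mvar Vx)"
    "\<And>i. i \<in> {2..m} \<Longrightarrow> \<kappa> (diag_class m f (mvar (Vxi i))) = tensor_class m f (mvar Vx)"
    "\<And>i. i \<in> {2..m} \<Longrightarrow> \<kappa> (diag_class m f (mvar (Vy i))) = tensor_class m f (mvar (Vy i))"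
    "\<And>c. \<kappa> (diag_class m f (mconst c)) = tensor_class m f (mconst c)"
    by (simp_all add: \<kappa>_class diagonal_def)
  have chart: "affine_chart ` product_points m f \<subseteq> projective_space (product_vars m)"
    using affine_chart_in_projective_space by (auto simp: product_points_def)
  have emb: "closed_embedding_of_spectra (product_ring m f) (curve_ring atl infty) \<theta>"
    by (rule surjective_hom_closed_embedding[OF cring_product_ring cring_curve_ring \<theta> \<theta>_surj])
  have Spec_sub: "Spec_map (tensor_ring m f) \<phi> ` Spec (curve_ring atl infty) \<subseteq> Spec (tensor_ring m f)"
    using Spec_map_in_Spec[OF cring_tensor_ring cring_curve_ring \<phi>] by blast
  have proj: "curve_point (tensor_vars m) x y P Vx = x P" for P
    by (simp add: curve_point_def curve_coord_def)
  show ?thesis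
    by (rule exI[of _ \<phi>], rule exI[of _ "tensor_class m f"], rule exI[of _ \<kappa>], rule exI[of _ \<theta>],
        intro conjI ballI allI)
      (rule refl \<phi> \<phi>_surj \<phi>_class \<iota> \<iota>_inj \<phi>\<iota> inj_curve_eval_base Spec_sub inj_on_Spec_map[OF \<phi>_surj]
        Spec_comp tensor_points tensor_inj proj tensor_point \<kappa> \<kappa>_vars \<theta>
        \<theta>_factor[THEN conjunct1] \<theta>_factor[THEN conjunct2] emb product_points product_inj product_point
        card_product_vars chart inj_on_subset[OF inj_affine_chart subset_UNIV]; assumption)+
qed

end
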